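(* Suppose that $1<\alpha<2$ and let $V\subset\mathbb R^2$ be the closed convex cone used to define $d(0)=V$. Then, for each $z\in S$, the extended Skorokhod problem $(S,d(\cdot))$ for the Brownian motion $X$ on $(C_S,\mathcal F,\mathcal F_t,P^z)$ has a solution $P^z$-a.s. if and only if $$\overline{\mathrm{co}}\big(V\cup\{av_1,a\ge0\}\cup\{av_2,a\ge0\}\big)=\mathbb R^2 .$$ In this case, $(Z,Y)$ solves the extended Skorokhod problem $(S,d(\cdot))$ for $X$ ($P^z$-a.s.).
   Context: Setting (reflected Brownian motion in a wedge). Let $0<\xi<2\pi$, $-\pi/2<\theta_1,\theta_2<\pi/2$ and $\alpha=(\theta_1+\theta_2)/\xi$. In polar coordinates let $S=\{(r,\theta):r\ge 0,\ 0\le\theta\le\xi\}\subset\mathbb R^2$, $\partial S_1=\{(r,\theta): r\ge0,\theta=0\}$, $\partial S_2=\{(r,\theta): r\ge 0,\theta=\xi\}$. Let $n_j$ be the unit normal to $\partial S_j\setminus\{0\}$ pointing into $S$, and let $v_j$ be the direction of reflection on $\partial S_j\setminus\{0\}$, which makes angle $\theta_j$ with $n_j$ (angles toward the origin are positive), normalized so that $v_j\cdot n_j=1$; explicitly $v_1=(-\tan\theta_1,1)$ and $v_2=(\sin\xi-\tan\theta_2\cos\xi,\,-\cos\xi-\tan\theta_2\sin\xi)$. Put $D_j=v_j\cdot\nabla$. Let $C_S$ be the set of continuous functions $\mathbb R_+=[0,\infty)\to S$, $Z(t)(\omega)=\omega(t)$ the coordinate process, $\mathcal M_t=\sigma\{Z(s):0\le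 s\le t\}$, $\mathcal M=\sigma\{Z(s):s\ge0\}$. $C_b^2(S)$ is the set of functions that are twice continuously differentiable on some domain containing $S$ and have bounded partial derivatives up to and including order $2$ on $S$. $\{P^z,z\in S\}$ is the unique (for $\alpha<2$) family of probability measures on $(C_S,\mathcal M)$ such that for each $z\in S$: (1) $P^z(Z(0)=z)=1$; (2) for each $f\in C_b^2(S)$ that is constant in a neighborhood of the origin and satisfies $D_if\ge0$ on $\partial S_i$, $i=1,2$, the process $f(Z(t))-\frac12\int_0^t\Delta f(Z(s))ds$ is a submartingale on $(C_S,\mathcal M,\mathcal M_t,P^z)$; (3) $E^z[\int_0^\infty 1\{Z(t)=0\}dt]=0$. For a probability measure $\mu$ on the Borel sets of $S$ let $P^\mu=\int_S\mu(dz)P^z$, let $\mathcal M^\mu$ be the $P^\mu$-completion of $\mathcal M$, and $\mathcal M^\mu_t$ the augmentation of $\mathcal M_t$ by the $P^\mu$-null sets of $\mathcal M^\mu$; put $\mathcal F=\bigcap_\mu\mathcal M^\mu$, $\mathcal F_t=\bigcap_\mu\mathcal M_t^\mu$. Zero energy: a continuous $2$-dimensional process $Y$ on $(C_S,\mathcal F,\mathcal F_t,P^z)$ is of zero energy if for each $T>0$ and every sequence $\{\pi^n\}$ of partitions $t_0\le\dots\le t_m$ of $[0,T]$ with mesh $\max_i|t_i-t_{i-1}|\to0$, $\sum_{t_i\in\pi^n}\|Y(t_i)-Y(t_{i-1})\|^2\to0$ in $P^z$-probability. The pair $(X,Y)$: when $1<\alpha<2$ there is a single pair $(X,Y)$ of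 processes on $(C_S,\mathcal F,\mathcal F_t)$ with $Z=X+Y$ such that for each $z\in S$, $X$ is a standard two-dimensional Brownian motion started from $z$ on $(C_S,\mathcal F,\mathcal F_t,P^z)$ and $Y$ is continuous, adapted, with $Y(0)=0$, and of zero energy on $(C_S,\mathcal F,\mathcal F_t,P^z)$. For each $z$ this decomposition is unique up to $P^z$-indistinguishability. Extended Skorokhod problem (ESP). Let $V\subset\mathbb R^2$ be a (non-empty) closed convex cone and define $d(z)=\{av_1:a\ge0\}$ for $z\in\partial S_1\setminus\{0\}$, $d(z)=\{av_2:a\ge0\}$ for $z\in\partial S_2\setminus\{0\}$, $d(0)=V$, and $d(z)=\{0\}$ for $z$ in the interior of $S$. $D(\mathbb R_+,\mathbb R^2)$ is the space of right-continuous functions $\mathbb R_+\to\mathbb R^2$ with left limits and $D_S(\mathbb R_+,\mathbb R^2)=\{f\in D(\mathbb R_+,\mathbb R^2):f(0)\in S\}$; $\overline{\mathrm{co}}(A)$ is the closure of the convex hull of $A$. A pair $(\phi,\eta)\in D_S(\mathbb R_+,\mathbb R^2)\times D(\mathbb R_+,\mathbb R^2)$ solves the ESP $(S,d(\cdot))$ for $\psi\in D_S(\mathbb R_+,\mathbb R^2)$ if $\phi(0)=\psi(0)$ and for all $t\in\mathbb R_+$: (1) $\phi(t)=\psi(t)+\eta(t)$; (2) $\phi(t)\in S$; (3) for every $s\in[0,t]$, $\eta(t)-\eta(s)\in\overline{\mathrm{co}}[\bigcup_{u\in(s,t]}d(\phi(u))]$ (vacuous for $s=t$); (4) $\eta(t)-\eta(t-)\in\overline{\mathrm{co}}[d(\phi(t))]$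 (with $\eta(0-)=0$). "Has a solution $P^z$-a.s." means that for $P^z$-almost every $\omega$ the path $X(\cdot,\omega)$ admits a pair $(\phi,\eta)$ solving the ESP for it. *)

theory Defs
  imports "HOL-Probability.Probability"
begin

text \<open>
  Paths and processes are indexed by \<^typ>\<open>real\<close>, but only times in \<open>{0..}\<close> carry meaning.
\<close>

definition polar :: "real \<Rightarrow> real \<Rightarrow> real^2" where
  "polar r \<theta> = vector [r * cos \<theta>, r * sin \<theta>]"

definition wedge :: "real \<Rightarrow> (real^2) set" where
  "wedge \<xi> = {polar r \<theta> | r \<theta>. 0 \<le> r \<and> 0 \<le> \<theta> \<and> \<theta> \<le> \<xi>}"

definition side1 :: "(real^2) set" where
  "side1 = {polar r 0 | r. 0 \<le> r}"

definition side2 :: "real \<Rightarrow> (real^2) set" where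
  "side2 \<xi> = {polar r \<xi> | r. 0 \<le> r}"

text \<open>
  The inward unit normals are \<open>(0, 1)\<close> and \<open>(sin \<xi>, - cos \<xi>)\<close>; a reflection vector is the normal plus
  \<open>tan \<theta>\<^sub>j\<close> times the unit tangent pointing towards the origin.
\<close>

definition refl1 :: "real \<Rightarrow> real^2" where
  "refl1 \<theta>1 = vector [- tan \<theta>1, 1]"

definition refl2 :: "real \<Rightarrow> real \<Rightarrow> real^2" where
  "refl2 \<xi> \<theta>2 = vector [sin \<xi> - tan \<theta>2 * cos \<xi>, - cos \<xi> - tan \<theta>2 * sin \<xi>]"

definition ray :: "real^2 \<Rightarrow> (real^2) set" where
  "ray v = {a *\<^sub>R v | a. 0 \<le> a}"

definition partial_deriv :: "2 \<Rightarrow> (real^2 \<Rightarrow> real) \<Rightarrow> real^2 \<Rightarrow> real" where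
  "partial_deriv i f x = frechet_derivative f (at x) (axis i 1)"

definition gradient :: "(real^2 \<Rightarrow> real) \<Rightarrow> real^2 \<Rightarrow> real^2" where
  "gradient f x = (\<chi> i. partial_deriv i f x)"

definition laplacian :: "(real^2 \<Rightarrow> real) \<Rightarrow> real^2 \<Rightarrow> real" where
  "laplacian f x = (\<Sum>i\<in>UNIV. partial_deriv i (partial_deriv i f) x)"

definition C2_on :: "(real^2 \<Rightarrow> real) \<Rightarrow> (real^2) set \<Rightarrow> bool" where
  "C2_on f U \<longleftrightarrow> f differentiable_on U \<and>
     (\<forall>i. partial_deriv i f differentiable_on U) \<and>
     (\<forall>i j. continuous_on U (partial_deriv j (partial_deriv i f)))"

text \<open>
  The partial derivatives of order \<open>0\<close> count, so that \<open>f\<close> itself is bounded on \<open>S\<close>. Values of \<open>f\<close>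
  off the domain \<open>U\<close> are irrelevant.
\<close>

definition Cb2 :: "(real^2) set \<Rightarrow> (real^2 \<Rightarrow> real) set" where
  "Cb2 S = {f. (\<exists>U. open U \<and> connected U \<and> S \<subseteq> U \<and> C2_on f U) \<and>
     bounded (f ` S) \<and>
     (\<forall>i. bounded (partial_deriv i f ` S)) \<and>
     (\<forall>i j. bounded (partial_deriv j (partial_deriv i f) ` S))}"

definition test_fun :: "real \<Rightarrow> real \<Rightarrow> real \<Rightarrow> (real^2 \<Rightarrow> real) \<Rightarrow> bool" where
  "test_fun \<xi> \<theta>1 \<theta>2 f \<longleftrightarrow> f \<in> Cb2 (wedge \<xi>) \<and>
     (\<exists>c. \<forall>\<^sub>F x in nhds 0. f x = c) \<and>
     (\<forall>x\<in>side1. 0 \<le> refl1 \<theta>1 \<bullet> gradient f x) \<and>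
     (\<forall>x\<in>side2 \<xi>. 0 \<le> refl2 \<xi> \<theta>2 \<bullet> gradient f x)"

text \<open>
  Paths are extensional on \<open>{0..}\<close>, so they correspond bijectively to functions on \<open>{0..}\<close>. The
  coordinate process is \<open>Z t \<omega> = \<omega> t\<close>.
\<close>

type_synonym path = "real \<Rightarrow> real^2"

definition path_space :: "real \<Rightarrow> path set" where
  "path_space \<xi> = {\<omega> \<in> {0..} \<rightarrow>\<^sub>E wedge \<xi>. continuous_on {0..} \<omega>}"

definition coord_algebra :: "real \<Rightarrow> real set \<Rightarrow> path measure" where
  "coord_algebra \<xi> I =
     sigma (path_space \<xi>) {(\<lambda>\<omega>. \<omega> s) -` B \<inter> path_space \<xi> | s B. s \<in> I \<and> B \<in> sets borel}"

definition submartingale :: "'a measure \<Rightarrow> (real \<Rightarrow> 'a measure) \<Rightarrow> (real \<Rightarrow> 'a \<Rightarrow> real) \<Rightarrow> bool" where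
  "submartingale M G N \<longleftrightarrow>
     (\<forall>t\<ge>0. N t \<in> borel_measurable (G t) \<and> integrable M (N t)) \<and>
     (\<forall>s t. 0 \<le> s \<and> s \<le> t \<longrightarrow> (AE \<omega> in M. N s \<omega> \<le> real_cond_exp M (G s) (N t) \<omega>))"

definition reflected_BM_family :: "real \<Rightarrow> real \<Rightarrow> real \<Rightarrow> (real^2 \<Rightarrow> path measure) \<Rightarrow> bool" where
  "reflected_BM_family \<xi> \<theta>1 \<theta>2 P \<longleftrightarrow> (\<forall>z\<in>wedge \<xi>.
     prob_space (P z) \<and>
     space (P z) = path_space \<xi> \<and> sets (P z) = sets (coord_algebra \<xi> {0..}) \<and>
     measure (P z) {\<omega> \<in> path_space \<xi>. \<omega> 0 = z} = 1 \<and>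
     (\<forall>f. test_fun \<xi> \<theta>1 \<theta>2 f \<longrightarrow>
        submartingale (P z) (\<lambda>t. coord_algebra \<xi> {0..t})
          (\<lambda>t \<omega>. f (\<omega> t) - 1/2 * integral {0..t} (\<lambda>s. laplacian f (\<omega> s)))) \<and>
     (\<integral>\<^sup>+\<omega>. (\<integral>\<^sup>+t\<in>{0..}. indicator {0} (\<omega> t) \<partial>lborel) \<partial>P z) = 0)"

definition initial_laws :: "real \<Rightarrow> (real^2) measure set" where
  "initial_laws \<xi> = {\<mu>. prob_space \<mu> \<and> sets \<mu> = sets (restrict_space borel (wedge \<xi>))}"

text \<open>
  For a reflected Brownian motion family with \<open>\<alpha> < 2\<close>, \<open>z \<mapsto> P z\<close> is a probability kernel, a
  consequence of well-posedness that is not assumed here; \<open>bind \<mu> P\<close> is then \<open>\<integral> \<mu>(dz) P z\<close>. In the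
  two definitions that follow, \<^const>\<open>sigma\<close> is applied to an intersection of sigma-algebras and
  so adds no further sets.
\<close>

definition univ_algebra :: "real \<Rightarrow> (real^2 \<Rightarrow> path measure) \<Rightarrow> path measure" where
  "univ_algebra \<xi> P =
     sigma (path_space \<xi>) (\<Inter>\<mu>\<in>initial_laws \<xi>. sets (completion (bind \<mu> P)))"

definition univ_filtration :: "real \<Rightarrow> (real^2 \<Rightarrow> path measure) \<Rightarrow> real \<Rightarrow> path measure" where
  "univ_filtration \<xi> P t =
     sigma (path_space \<xi>) (\<Inter>\<mu>\<in>initial_laws \<xi>.
       sigma_sets (path_space \<xi>)
         (sets (coord_algebra \<xi> {0..t}) \<union> null_sets (completion (bind \<mu> P))))"

definition univ_law :: "real \<Rightarrow> (real^2 \<Rightarrow> path measure) \<Rightarrow> real^2 \<Rightarrow> path measure" where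
  "univ_law \<xi> P z = restr_to_subalg (completion (P z)) (univ_algebra \<xi> P)"

definition adapted :: "(real \<Rightarrow> 'a measure) \<Rightarrow> (real \<Rightarrow> 'a \<Rightarrow> real^2) \<Rightarrow> bool" where
  "adapted G X \<longleftrightarrow> (\<forall>t\<ge>0. X t \<in> borel_measurable (G t))"

definition continuous_process :: "'a measure \<Rightarrow> (real \<Rightarrow> 'a \<Rightarrow> real^2) \<Rightarrow> bool" where
  "continuous_process M X \<longleftrightarrow> (AE \<omega> in M. continuous_on {0..} (\<lambda>t. X t \<omega>))"

definition std_brownian_motion ::
  "'a measure \<Rightarrow> (real \<Rightarrow> 'a measure) \<Rightarrow> real^2 \<Rightarrow> (real \<Rightarrow> 'a \<Rightarrow> real^2) \<Rightarrow> bool" where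
  "std_brownian_motion M G z X \<longleftrightarrow>
     adapted G X \<and> continuous_process M X \<and> (AE \<omega> in M. X 0 \<omega> = z) \<and>
     (\<forall>s t. 0 \<le> s \<and> s < t \<longrightarrow>
        distributed M lborel (\<lambda>\<omega>. X t \<omega> - X s \<omega>)
          (\<lambda>x. ennreal (\<Prod>i\<in>UNIV. normal_density 0 (sqrt (t - s)) (x $ i))) \<and>
        prob_space.indep_set M (sets (G s))
          (sets (vimage_algebra (space M) (\<lambda>\<omega>. X t \<omega> - X s \<omega>) borel)))"

definition tendsto_in_prob :: "'a measure \<Rightarrow> (nat \<Rightarrow> 'a \<Rightarrow> real) \<Rightarrow> real \<Rightarrow> bool" where
  "tendsto_in_prob M V c \<longleftrightarrow>
     (\<forall>\<epsilon>>0. (\<lambda>n. measure M {\<omega> \<in> space M. \<epsilon> < \<bar>V n \<omega> - c\<bar>}) \<longlonglongrightarrow> 0)"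

definition is_partition :: "real \<Rightarrow> nat \<Rightarrow> (nat \<Rightarrow> real) \<Rightarrow> bool" where
  "is_partition T m t \<longleftrightarrow> t 0 = 0 \<and> t m = T \<and> (\<forall>i<m. t i \<le> t (Suc i))"

definition mesh :: "nat \<Rightarrow> (nat \<Rightarrow> real) \<Rightarrow> real" where
  "mesh m t = Max ((\<lambda>i. \<bar>t (Suc i) - t i\<bar>) ` {..<m})"

definition zero_energy :: "'a measure \<Rightarrow> (real \<Rightarrow> 'a \<Rightarrow> real^2) \<Rightarrow> bool" where
  "zero_energy M Y \<longleftrightarrow>
     (\<forall>T>0. \<forall>m t. (\<forall>n. is_partition T (m n) (t n)) \<and> (\<lambda>n. mesh (m n) (t n)) \<longlonglongrightarrow> 0 \<longrightarrow>
        tendsto_in_prob M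
          (\<lambda>n \<omega>. \<Sum>i<m n. (norm (Y (t n (Suc i)) \<omega> - Y (t n i) \<omega>))\<^sup>2) 0)"

definition zero_energy_decomposition ::
  "real \<Rightarrow> (real^2 \<Rightarrow> path measure) \<Rightarrow> (real \<Rightarrow> path \<Rightarrow> real^2) \<Rightarrow> (real \<Rightarrow> path \<Rightarrow> real^2) \<Rightarrow> bool" where
  "zero_energy_decomposition \<xi> P X Y \<longleftrightarrow>
     (\<forall>\<omega>\<in>path_space \<xi>. \<forall>t\<ge>0. \<omega> t = X t \<omega> + Y t \<omega>) \<and>
     (\<forall>z\<in>wedge \<xi>.
        std_brownian_motion (univ_law \<xi> P z) (univ_filtration \<xi> P) z X \<and>
        continuous_process (univ_law \<xi> P z) Y \<and> adapted (univ_filtration \<xi> P) Y \<and>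
        (AE \<omega> in univ_law \<xi> P z. Y 0 \<omega> = 0) \<and>
        zero_energy (univ_law \<xi> P z) Y)"

definition cadlag :: "(real \<Rightarrow> real^2) \<Rightarrow> bool" where
  "cadlag f \<longleftrightarrow> (\<forall>t\<ge>0. (f \<longlongrightarrow> f t) (at_right t)) \<and> (\<forall>t>0. \<exists>l. (f \<longlongrightarrow> l) (at_left t))"

definition left_limit :: "(real \<Rightarrow> real^2) \<Rightarrow> real \<Rightarrow> real^2" where
  "left_limit f t = (if t = 0 then 0 else Lim (at_left t) f)"

definition refl_cone :: "real \<Rightarrow> real \<Rightarrow> real \<Rightarrow> (real^2) set \<Rightarrow> real^2 \<Rightarrow> (real^2) set" where
  "refl_cone \<xi> \<theta>1 \<theta>2 V z =
     (if z = 0 then V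
      else if z \<in> side1 then ray (refl1 \<theta>1)
      else if z \<in> side2 \<xi> then ray (refl2 \<xi> \<theta>2)
      else {0})"

text \<open>
  The condition on the increments is imposed for \<open>s < t\<close> only: for \<open>s = t\<close> the union is over the
  empty interval \<open>(t, t]\<close> and the condition is void by convention.
\<close>

definition solves_ESP ::
  "(real^2) set \<Rightarrow> (real^2 \<Rightarrow> (real^2) set) \<Rightarrow>
   (real \<Rightarrow> real^2) \<Rightarrow> (real \<Rightarrow> real^2) \<Rightarrow> (real \<Rightarrow> real^2) \<Rightarrow> bool" where
  "solves_ESP S d \<psi> \<phi> \<eta> \<longleftrightarrow>
     cadlag \<psi> \<and> \<psi> 0 \<in> S \<and> cadlag \<phi> \<and> \<phi> 0 \<in> S \<and> cadlag \<eta> \<and> \<phi> 0 = \<psi> 0 \<and>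
     (\<forall>t\<ge>0.
        \<phi> t = \<psi> t + \<eta> t \<and>
        \<phi> t \<in> S \<and>
        (\<forall>s. 0 \<le> s \<and> s < t \<longrightarrow>
           \<eta> t - \<eta> s \<in> closure (convex hull (\<Union>u\<in>{s<..t}. d (\<phi> u)))) \<and>
        \<eta> t - left_limit \<eta> t \<in> closure (convex hull (d (\<phi> t))))"

end

theory Submission imports Defs begin


text \<open>
  For \<open>\<alpha> > 1\<close> one has \<open>\<xi> < \<theta>1 + \<theta>2 < \<pi>\<close>, and \<open>- S\<close> lies in the cone of the two directions of reflection.
  If the cone in question is not the whole plane, it lies in a half-plane \<open>a \<bullet> x \<ge> 0\<close>; every solution
  \<open>(\<phi>, \<eta>)\<close> then has \<open>a \<bullet> \<eta>\<close> nondecreasing and \<open>a \<bullet> \<phi> \<le> 0\<close>, whence \<open>a \<bullet> X \<le> 0\<close>, which fails with positive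
  probability for a Brownian motion.

  Conversely, away from the corner the increments of \<open>Y\<close> lie in the cone of the current direction of
  reflection: testing the submartingale property with functions that are locally linear shows that
  \<open>w \<bullet> Y\<close> is, up to a martingale, nondecreasing, and the zero energy of \<open>Y\<close> kills the martingale. At the corner
  the increments are unrestricted, because the path hits both sides immediately before each visit that
  ends an excursion: a path avoiding one side cannot reach the corner, since the harmonic function
  \<open>ln r + c * \<theta>\<close>, with \<open>c\<close> chosen such that its derivative in the direction of reflection vanishes on the other
  side, tends to \<open>-\<infinity>\<close> there.
\<close>


section \<open>Calculus of twice continuously differentiable functions in the plane\<close>

text \<open>Two points lie behind the overview. First, a time interval with a corner visit also
  contains one that ends an excursion: the path is at the corner on no interval of time, so some
  earlier time in the interval is off it, and before the first zero after that time both sides are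
  hit. The hull over the interval is then the whole plane by assumption. Second, \<open>P\<close> is
  not assumed to be a measurable kernel, yet the filtration is built from the mixtures
  \<open>bind \<mu> P\<close>. Measurability is forced by \<open>X\<close>: a non-measurable kernel
  makes every mixture the zero measure, hence every set of paths a member of the sigma-algebra at
  time 0, which then cannot be independent of a Gaussian increment.

  All stopping is done on grids: a step is counted if the path has stayed in a closed set up to the
  left end of the step. Such events are measurable by continuity and known when the step begins, so
  the submartingale inequality applies step by step; the single step in which the path leaves the
  set is estimated separately.\<close>

lemma partial_deriv_eq:
  assumes "(f has_derivative f') (at x)"
  shows "partial_deriv i f x = f' (axis i 1)"
  using frechet_derivative_at[OF assms] by (simp add: partial_deriv_def)

text \<open>\<open>frechet_derivative\<close> is a choice among all derivatives. Agreement on an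
  open set gives the same candidates, hence the same choice, even where no derivative
  exists.\<close>

lemma partial_deriv_cong:
  assumes "open U" "x \<in> U" "\<And>y. y \<in> U \<Longrightarrow> f y = g y"
  shows "partial_deriv i f x = partial_deriv i g x"
proof -
  have "(f has_derivative D) (at x) \<longleftrightarrow> (g has_derivative D) (at x)" for D
    using has_derivative_transform_within_open[of f D x UNIV U g]
      has_derivative_transform_within_open[of g D x UNIV U f] assms by auto
  then show ?thesis by (simp add: partial_deriv_def frechet_derivative_def)
qed

lemma gradient_eq:
  assumes "(f has_derivative (\<lambda>h. a \<bullet> h)) (at x)"
  shows "gradient f x = a"
  by (simp add: vec_eq_iff gradient_def partial_deriv_eq[OF assms] inner_axis)

lemma gradient_cong:
  assumes "open U" "x \<in> U" "\<And>y. y \<in> U \<Longrightarrow> f y = g y"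
  shows "gradient f x = gradient g x"
  using partial_deriv_cong[OF assms] by (simp add: gradient_def)

lemma laplacian_cong:
  assumes "open U" "x \<in> U" "\<And>y. y \<in> U \<Longrightarrow> f y = g y"
  shows "laplacian f x = laplacian g x"
  unfolding laplacian_def
  by (intro sum.cong refl partial_deriv_cong[OF assms(1,2)] partial_deriv_cong[OF assms(1)])
    (use assms(3) in auto)

definition C1_on :: "(real^2 \<Rightarrow> real) \<Rightarrow> (real^2) set \<Rightarrow> bool" where
  "C1_on f U \<longleftrightarrow> f differentiable_on U \<and> (\<forall>i. continuous_on U (partial_deriv i f))"

text \<open>Reduces second-order regularity to first-order regularity of the partial derivatives, so
  that closure rules for \<open>C1_on\<close> can be applied twice.\<close>

lemma C2_on_iff: "C2_on f U \<longleftrightarrow> f differentiable_on U \<and> (\<forall>i. C1_on (partial_deriv i f) U)"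
  by (auto simp: C2_on_def C1_on_def)

lemma C1_onD:
  assumes "C1_on f U" "open U" "x \<in> U"
  shows "(f has_derivative frechet_derivative f (at x)) (at x)"
  using assms
  by (metis C1_on_def at_within_open differentiable_on_def frechet_derivative_works)

lemma C1_on_continuous: "C1_on f U \<Longrightarrow> continuous_on U f"
  by (simp add: C1_on_def differentiable_imp_continuous_on)

lemma C1_on_continuous_frechet:
  "C1_on f U \<Longrightarrow> continuous_on U (\<lambda>x. frechet_derivative f (at x) (axis i 1))"
  by (simp add: C1_on_def partial_deriv_def[abs_def])

lemma C1_onI:
  assumes "open U" "\<And>x. x \<in> U \<Longrightarrow> (f has_derivative f' x) (at x)"
    and "\<And>i. continuous_on U (\<lambda>x. f' x (axis i 1))"
  shows "C1_on f U"
proof -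
  have "f differentiable_on U"
    using assms(2) by (meson differentiableI differentiable_at_imp_differentiable_on)
  moreover have "continuous_on U (partial_deriv i f)" for i
    using assms(3)[of i] by (rule continuous_on_eq) (simp add: partial_deriv_eq[OF assms(2)])
  ultimately show ?thesis by (simp add: C1_on_def)
qed

lemma C1_on_cong:
  assumes "open U" "\<And>x. x \<in> U \<Longrightarrow> f x = g x" "C1_on f U"
  shows "C1_on g U"
proof (rule C1_onI[OF assms(1)])
  fix x assume x: "x \<in> U"
  show "(g has_derivative frechet_derivative f (at x)) (at x)"
    using has_derivative_transform_within_open[OF C1_onD[OF assms(3,1) x] assms(1) x] assms(2)
    by auto
next
  fix i
  show "continuous_on U (\<lambda>x. frechet_derivative f (at x) (axis i 1))"
    using assms(3) unfolding C1_on_def by (simp add: partial_deriv_def[abs_def])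
qed

lemma C1_on_const: "open U \<Longrightarrow> C1_on (\<lambda>x. c) U"
  by (rule C1_onI[where f' = "\<lambda>x h. 0"]) auto

lemma C1_on_inner: "open U \<Longrightarrow> C1_on (\<lambda>x. a \<bullet> x) U"
  by (rule C1_onI[where f' = "\<lambda>x h. a \<bullet> h"]) (auto intro!: derivative_eq_intros)

lemma C1_on_add:
  assumes "open U" "C1_on f U" "C1_on g U"
  shows "C1_on (\<lambda>x. f x + g x) U"
    and "x \<in> U \<Longrightarrow> partial_deriv i (\<lambda>x. f x + g x) x = partial_deriv i f x + partial_deriv i g x"
proof -
  have D: "((\<lambda>x. f x + g x) has_derivative
      (\<lambda>h. frechet_derivative f (at x) h + frechet_derivative g (at x) h)) (at x)" if "x \<in> U" for x
    using C1_onD[OF assms(2,1) that] C1_onD[OF assms(3,1) that] by (rule has_derivative_add)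
  show "C1_on (\<lambda>x. f x + g x) U"
    by (intro C1_onI[OF assms(1) D] continuous_intros C1_on_continuous_frechet assms)
  show "x \<in> U \<Longrightarrow> partial_deriv i (\<lambda>x. f x + g x) x = partial_deriv i f x + partial_deriv i g x"
    using partial_deriv_eq[OF D] by (simp add: partial_deriv_def)
qed

lemma C1_on_mult:
  assumes "open U" "C1_on f U" "C1_on g U"
  shows "C1_on (\<lambda>x. f x * g x) U"
    and "x \<in> U \<Longrightarrow> partial_deriv i (\<lambda>x. f x * g x) x = f x * partial_deriv i g x + partial_deriv i f x * g x"
proof -
  have D: "((\<lambda>x. f x * g x) has_derivative
      (\<lambda>h. f x * frechet_derivative g (at x) h + frechet_derivative f (at x) h * g x)) (at x)" if "x \<in> U" for x
    using C1_onD[OF assms(2,1) that] C1_onD[OF assms(3,1) that] by (rule has_derivative_mult)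
  show "C1_on (\<lambda>x. f x * g x) U"
    by (intro C1_onI[OF assms(1) D] continuous_intros C1_on_continuous_frechet C1_on_continuous assms)
  show "x \<in> U \<Longrightarrow> partial_deriv i (\<lambda>x. f x * g x) x = f x * partial_deriv i g x + partial_deriv i f x * g x"
    using partial_deriv_eq[OF D] by (simp add: partial_deriv_def)
qed

lemma C1_on_compose:
  assumes "open U" "C1_on f U" "f ` U \<subseteq> I"
    and g: "\<And>t. t \<in> I \<Longrightarrow> (g has_real_derivative g' t) (at t)" and g': "continuous_on I g'"
  shows "C1_on (\<lambda>x. g (f x)) U"
    and "x \<in> U \<Longrightarrow> partial_deriv i (\<lambda>x. g (f x)) x = partial_deriv i f x * g' (f x)"
proof -
  have D: "((\<lambda>x. g (f x)) has_derivative (\<lambda>h. frechet_derivative f (at x) h * g' (f x))) (at x)"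
    if "x \<in> U" for x
    using DERIV_compose_FDERIV[OF g C1_onD[OF assms(2,1) that]] assms(3) that by auto
  show "C1_on (\<lambda>x. g (f x)) U"
    by (intro C1_onI[OF assms(1) D] continuous_intros C1_on_continuous_frechet
        continuous_on_compose2[OF g' C1_on_continuous] assms)
  show "x \<in> U \<Longrightarrow> partial_deriv i (\<lambda>x. g (f x)) x = partial_deriv i f x * g' (f x)"
    using partial_deriv_eq[OF D] by (simp add: partial_deriv_def)
qed

lemma C2_on_imp_C1_on: "C2_on f U \<Longrightarrow> C1_on f U"
  unfolding C2_on_iff by (auto simp: C1_on_def differentiable_imp_continuous_on)

lemma C2_onI:
  assumes "open U" "C1_on f U"
    and "\<And>i x. x \<in> U \<Longrightarrow> partial_deriv i f x = d i x" and "\<And>i. C1_on (d i) U"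
  shows "C2_on f U"
  unfolding C2_on_iff
proof (intro conjI allI)
  show "f differentiable_on U" using assms(2) by (simp add: C1_on_def)
  show "C1_on (partial_deriv i f) U" for i
    by (rule C1_on_cong[OF assms(1) _ assms(4)[of i]]) (use assms(3) in auto)
qed

lemma C2_onD: "C2_on f U \<Longrightarrow> C1_on (partial_deriv i f) U"
  by (simp add: C2_on_iff)

lemma C2_on_cong:
  assumes "open U" "\<And>x. x \<in> U \<Longrightarrow> f x = g x" "C2_on f U"
  shows "C2_on g U"
  by (rule C2_onI[OF assms(1) C1_on_cong[OF assms(1,2) C2_on_imp_C1_on[OF assms(3)]] _ C2_onD[OF assms(3)]])
    (use partial_deriv_cong[OF assms(1) _ assms(2)] in auto)

lemma C2_on_const: "open U \<Longrightarrow> C2_on (\<lambda>x. c) U"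
  by (rule C2_onI[where d = "\<lambda>i x. 0"])
    (auto intro!: C1_on_const simp: partial_deriv_eq[OF has_derivative_const])

lemma partial_deriv_inner: "partial_deriv i (\<lambda>x. a \<bullet> x) x = a $ i"
  by (subst partial_deriv_eq[of _ "\<lambda>h. a \<bullet> h"]) (auto intro!: derivative_eq_intros simp: inner_axis)

lemma C2_on_inner: "open U \<Longrightarrow> C2_on (\<lambda>x. a \<bullet> x) U"
  by (rule C2_onI[where d = "\<lambda>i x. a $ i"]) (auto intro!: C1_on_const C1_on_inner partial_deriv_inner)

lemma C2_on_add:
  assumes "open U" "C2_on f U" "C2_on g U"
  shows "C2_on (\<lambda>x. f x + g x) U"
  using assms by (intro C2_onI[OF assms(1) _ C1_on_add(2)] C1_on_add(1) C2_onD C2_on_imp_C1_on)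

lemma C2_on_mult:
  assumes "open U" "C2_on f U" "C2_on g U"
  shows "C2_on (\<lambda>x. f x * g x) U"
  using assms by (intro C2_onI[OF assms(1) _ C1_on_mult(2)] C1_on_mult(1) C1_on_add(1) C2_onD C2_on_imp_C1_on)

lemma C2_on_compose:
  assumes "open U" "C2_on f U" "f ` U \<subseteq> I"
    and g: "\<And>t. t \<in> I \<Longrightarrow> (g has_real_derivative g' t) (at t)"
    and g': "\<And>t. t \<in> I \<Longrightarrow> (g' has_real_derivative g'' t) (at t)" and g'': "continuous_on I g''"
  shows "C2_on (\<lambda>x. g (f x)) U"
proof -
  have c: "continuous_on I g'"
    using g' by (meson DERIV_isCont continuous_at_imp_continuous_on)
  note f1 = C2_on_imp_C1_on[OF assms(2)]
  show ?thesis
    by (rule C2_onI[OF assms(1) C1_on_compose(1)[OF assms(1) f1 assms(3) g c]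
          C1_on_compose(2)[OF assms(1) f1 assms(3) g c]])
      (auto intro!: C1_on_mult(1) assms C2_onD C1_on_compose(1)[OF assms(1) f1 assms(3) g' g''])
qed

lemma C2_on_affine: 
  assumes "open U" "C2_on f U" shows "C2_on (\<lambda>x. c * f x + d) U"
  using assms by (intro C2_on_add C2_on_mult C2_on_const)

lemma C2_on_Un:
  assumes "open U" "open W" "C2_on f U" "C2_on f W"
  shows "C2_on f (U \<union> W)"
proof -
  have C1: "C1_on g (U \<union> W)" if "C1_on g U" "C1_on g W" for g
    using that assms(1,2) unfolding C1_on_def differentiable_on_eq_differentiable_at[OF assms(1)]
      differentiable_on_eq_differentiable_at[OF assms(2)]
      differentiable_on_eq_differentiable_at[OF open_Un[OF assms(1,2)]]
    by (auto intro!: continuous_on_open_Un)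
  show ?thesis
    using C1[OF C2_on_imp_C1_on C2_on_imp_C1_on, OF assms(3,4)] C1[OF C2_onD C2_onD, OF assms(3,4)]
    by (auto simp: C2_on_iff C1_on_def)
qed

lemma laplacian_inner: "laplacian (\<lambda>x. w \<bullet> x) x = 0"
proof -
  have "partial_deriv i (\<lambda>x. w \<bullet> x) = (\<lambda>x. w $ i)" for i
    using partial_deriv_inner by auto
  then show ?thesis by (simp add: laplacian_def partial_deriv_eq[OF has_derivative_const])
qed

text \<open>The third power is the least one that makes the truncation twice continuously differentiable.\<close>

definition cube :: "real \<Rightarrow> real" where "cube t = (max 0 t)^3"
definition step :: "real \<Rightarrow> real" where "step t = cube t * inverse (cube t + cube (1 - t))"

text \<open>At the kink the difference quotient is at most \<open>\<bar>h\<bar>^n\<close>, which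
  vanishes because \<open>n \<ge> 1\<close>; elsewhere the function is locally a power or
  constant.\<close>

lemma DERIV_max_power:
  assumes "n \<ge> 1"
  shows "((\<lambda>t::real. (max 0 t)^Suc n) has_real_derivative (real (Suc n) * (max 0 t)^n)) (at t)"
proof -
  consider "t > 0" | "t < 0" | "t = 0" by linarith
  then show ?thesis
  proof cases
    case 1
    have "((\<lambda>t::real. t^Suc n) has_real_derivative (real (Suc n) * t^n)) (at t)"
      using DERIV_pow[of "Suc n" t] by simp
    then show ?thesis
      using 1 by (auto intro: has_field_derivative_transform_within_open[of _ _ _ "{0<..}"])
  next
    case 2
    have "((\<lambda>t::real. (max 0 t)^Suc n) has_real_derivative 0) (at t)"
      by (rule has_field_derivative_transform_within_open[of "\<lambda>t. 0" _ _ "{..<0}"]) (use 2 in auto)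
    then show ?thesis
      using 2 assms by (simp add: zero_power)
  next
    case 3
    have "((\<lambda>h::real. ((max 0 (t+h))^Suc n - (max 0 t)^Suc n) / h) \<longlongrightarrow> 0) (at 0)"
    proof (rule Lim_null_comparison)
      show "((\<lambda>h::real. \<bar>h\<bar>^n) \<longlongrightarrow> 0) (at 0)"
        using assms by (auto intro!: tendsto_eq_intros)
      show "\<forall>\<^sub>F h::real in at 0. norm (((max 0 (t+h))^Suc n - (max 0 t)^Suc n) / h) \<le> \<bar>h\<bar>^n"
        unfolding 3 by (intro always_eventually) (auto simp: max_def abs_mult power_abs)
    qed
    then show ?thesis using 3 assms by (simp add: DERIV_def power_0_left)
  qed
qed

lemma C2_on_cube:
  assumes "open U" "C2_on f U"
  shows "C2_on (\<lambda>x. cube (f x)) U"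
proof (rule C2_on_compose[OF assms, of UNIV])
  show "(cube has_real_derivative 3 * (max 0 t)^2) (at t)" for t
    using DERIV_max_power[of 2 t] unfolding cube_def[abs_def] by (simp add: numeral_eq_Suc)
  show "((\<lambda>t. 3 * (max 0 t)^2) has_real_derivative 6 * max 0 t) (at t)" for t :: real
    using DERIV_cmult[OF DERIV_max_power[of 1 t], of 3] by (simp add: numeral_eq_Suc)
qed (auto intro!: continuous_intros)

lemma C2_on_inverse:
  assumes "open U" "C2_on f U" "\<And>x. x \<in> U \<Longrightarrow> f x > 0"
  shows "C2_on (\<lambda>x. inverse (f x)) U"
proof (rule C2_on_compose[OF assms(1,2), of "{0<..}"])
  show "(inverse has_real_derivative - (inverse t ^ 2)) (at t)" if "t \<in> {0<..}" for t :: real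
    using that by (auto intro!: derivative_eq_intros simp: power2_eq_square)
  show "((\<lambda>t. - (inverse t ^ 2)) has_real_derivative 2 * inverse t ^ 3) (at t)" if "t \<in> {0<..}" for t :: real
    using that by (auto intro!: derivative_eq_intros simp: power2_eq_square power3_eq_cube)
qed (use assms(3) in \<open>auto intro!: continuous_intros\<close>)

text \<open>\<open>t\<close> and \<open>1 - t\<close> cannot both be nonpositive; this keeps the
  denominator of \<open>step\<close> positive.\<close>

lemma cube_pos: "cube t + cube (1 - t) > 0"
proof (cases "t > 0")
  case True
  then have "cube t > 0" by (simp add: cube_def)
  moreover have "cube (1 - t) \<ge> 0" by (simp add: cube_def)
  ultimately show ?thesis by linarith
next
  case False
  then have "cube (1 - t) > 0" by (simp add: cube_def)
  moreover have "cube t \<ge> 0" by (simp add: cube_def)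
  ultimately show ?thesis by linarith
qed

lemma C2_on_step:
  assumes "open U" "C2_on f U"
  shows "C2_on (\<lambda>x. step (f x)) U"
  unfolding step_def
  using C2_on_affine[OF assms, of "-1" 1]
  by (intro C2_on_mult C2_on_cube C2_on_inverse C2_on_add assms cube_pos) simp_all

lemma step_nonneg: "0 \<le> step t"
  using cube_pos[of t] by (auto simp: step_def cube_def)

lemma step_le_1: "step t \<le> 1"
  using cube_pos[of t] by (auto simp: step_def cube_def field_simps)

lemma step_0: "t \<le> 0 \<Longrightarrow> step t = 0"
  by (simp add: step_def cube_def)

lemma step_1: "t \<ge> 1 \<Longrightarrow> step t = 1"
  by (simp add: step_def cube_def)

lemma DERIV_step: "\<exists>D. (step has_real_derivative D) (at t)"
proof -
  have cube: "(cube has_real_derivative 3 * (max 0 t)^2) (at t)" for t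
    using DERIV_max_power[of 2 t] unfolding cube_def[abs_def] by (simp add: numeral_eq_Suc)
  have "((\<lambda>t. cube (1 - t)) has_real_derivative (3 * (max 0 (1-t))^2) * (-1)) (at t)"
    by (rule DERIV_chain2[OF cube]) (auto intro!: derivative_eq_intros)
  then have "((\<lambda>t. cube t * inverse (cube t + cube (1 - t))) differentiable (at t))"
    using cube[of t] cube_pos[of t]
    by (intro differentiable_mult differentiable_inverse differentiable_add)
      (auto simp: real_differentiable_def)
  then show ?thesis by (simp add: real_differentiable_def step_def[abs_def])
qed

text \<open>Continuity on the compact set \<open>C\<close> bounds all derivatives there. Outside
  \<open>C\<close> the function vanishes on full neighbourhoods, since derivatives at boundary
  points of \<open>S\<close> also see values off \<open>S\<close>.\<close>

lemma Cb2_of_compact_support: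
  assumes U: "open U" "connected U" "S \<subseteq> U" "C2_on f U" and C: "compact C" "C \<subseteq> U"
    and z: "\<And>x. x \<in> S \<Longrightarrow> x \<notin> C \<Longrightarrow> \<exists>W. open W \<and> x \<in> W \<and> (\<forall>y\<in>W. f y = 0)"
  shows "f \<in> Cb2 S"
proof -
  have b: "bounded (g ` S)" if "continuous_on U g" "\<And>x. x \<in> S \<Longrightarrow> x \<notin> C \<Longrightarrow> g x = 0"
    for g :: "real^2 \<Rightarrow> real"
  proof (rule bounded_subset)
    show "bounded (insert 0 (g ` C))"
      using compact_imp_bounded[OF compact_continuous_image[OF continuous_on_subset[OF that(1) C(2)] C(1)]]
      by simp
    show "g ` S \<subseteq> insert 0 (g ` C)" using that(2) by auto
  qed
  have p0: "partial_deriv i (\<lambda>_. 0) x = 0" for i x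
    by (simp add: partial_deriv_eq[OF has_derivative_const])
  have z1: "\<exists>W. open W \<and> x \<in> W \<and> (\<forall>y\<in>W. partial_deriv i f y = 0)" if "x \<in> S" "x \<notin> C" for i x
    using z[OF that] partial_deriv_cong[of _ _ f "\<lambda>_. 0" i] by (metis p0)
  have z2: "partial_deriv j (partial_deriv i f) x = 0" if "x \<in> S" "x \<notin> C" for i j x
    using z1[OF that] partial_deriv_cong[of _ _ "partial_deriv i f" "\<lambda>_. 0" j] by (metis p0)
  have "bounded (f ` S)" using C1_on_continuous[OF C2_on_imp_C1_on[OF U(4)]] z by (intro b) auto
  moreover have "bounded (partial_deriv i f ` S)" for i
    using C1_on_continuous[OF C2_onD[OF U(4)]] z1 by (intro b) auto
  moreover have "bounded (partial_deriv j (partial_deriv i f) ` S)" for i j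
    using C2_onD[OF U(4)] z2 by (intro b) (auto simp: C1_on_def)
  ultimately show ?thesis using U by (auto simp: Cb2_def)
qed


lemma inner_real2: "(x::real^2) \<bullet> y = x $ 1 * y $ 1 + x $ 2 * y $ 2"
  by (simp add: inner_vec_def sum_2)

text \<open>Lets an oblique boundary condition be checked by differentiating along a line in the
  direction of reflection.\<close>

lemma DERIV_gradient:
  assumes "f differentiable (at x)"
  shows "((\<lambda>h. f (x + h *\<^sub>R v)) has_real_derivative (v \<bullet> gradient f x)) (at 0)"
proof -
  define D where "D = frechet_derivative f (at x)"
  have D: "(f has_derivative D) (at x)"
    using assms by (simp add: D_def frechet_derivative_works[symmetric])
  then have lin: "linear D" by (rule has_derivative_linear)
  have v: "v = v $ 1 *\<^sub>R axis 1 1 + v $ 2 *\<^sub>R axis 2 1"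
    by (simp add: vec_eq_iff forall_2 axis_def)
  have "D v = v $ 1 * D (axis 1 1) + v $ 2 * D (axis 2 1)"
    by (subst v) (simp only: linear_add[OF lin] linear_cmul[OF lin] real_scaleR_def)
  then have Dv: "D v = v \<bullet> gradient f x"
    by (simp add: inner_real2 gradient_def partial_deriv_def D_def)
  have "((\<lambda>h. f (x + h *\<^sub>R v)) has_derivative (\<lambda>h. D (h *\<^sub>R v))) (at 0)"
    by (rule has_derivative_compose[of "\<lambda>h. x + h *\<^sub>R v"]) (auto intro!: derivative_eq_intros D)
  then show ?thesis
    using Dv lin by (simp add: has_field_derivative_def linear_cmul mult_commute_abs)
qed

lemma C2_on_differentiable:
  assumes "C2_on f U" "open U" "x \<in> U"
  shows "f differentiable (at x)"
  using C1_onD[OF C2_on_imp_C1_on assms(2,3), OF assms(1)] by (rule differentiableI)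

section \<open>Test functions that are linear near a point\<close>

text \<open>The plateau has half-width \<open>2 * r\<close>, wider than the half-width
  \<open>r\<close> of the box used later, so that a function cut off this way is unchanged in a
  neighbourhood of each point of that box.\<close>

definition bump :: "real \<Rightarrow> real \<Rightarrow> real \<Rightarrow> real" where
  "bump c r t = step (3 + (t - c) / r) * step (3 - (t - c) / r)"

lemma bump_1: "0 < r \<Longrightarrow> \<bar>t - c\<bar> \<le> 2 * r \<Longrightarrow> bump c r t = 1"
  by (simp add: bump_def step_1 field_simps abs_le_iff)

lemma bump_0: "0 < r \<Longrightarrow> 3 * r \<le> \<bar>t - c\<bar> \<Longrightarrow> bump c r t = 0"
  by (auto simp: bump_def abs_if field_simps intro!: step_0 split: if_splits)

lemma bump_nonneg: "0 \<le> bump c r t"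
  by (simp add: bump_def step_nonneg)

lemma C2_on_bump:
  assumes "open U"
  shows "C2_on (\<lambda>x. bump c r (a \<bullet> x)) U"
proof -
  have 1: "3 + (a \<bullet> x - c) / r = (1 / r) * (a \<bullet> x) + (3 - c / r)" for x
    by (simp add: diff_divide_distrib)
  have 2: "3 - (a \<bullet> x - c) / r = (- 1 / r) * (a \<bullet> x) + (3 + c / r)" for x
    by (simp add: diff_divide_distrib)
  show ?thesis
    unfolding bump_def 1 2 using assms
    by (intro C2_on_mult C2_on_step C2_on_affine C2_on_inner)
qed

text \<open>In the applications \<open>a\<close> and \<open>b\<close> are the coordinates dual to
  vectors \<open>e\<close> and \<open>v\<close>. When \<open>v\<close> is the direction of
  reflection, motion along \<open>v\<close> fixes the first cutoff and changes only the argument of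
  the second.\<close>

definition cutoff_linear ::
  "real^2 \<Rightarrow> real^2 \<Rightarrow> real^2 \<Rightarrow> real \<Rightarrow> real^2 \<Rightarrow> real^2 \<Rightarrow> real" where
  "cutoff_linear a b x0 r w x = bump (a \<bullet> x0) r (a \<bullet> x) * bump (b \<bullet> x0) r (b \<bullet> x) * (w \<bullet> x)"

definition box_around :: "real^2 \<Rightarrow> real^2 \<Rightarrow> real^2 \<Rightarrow> real \<Rightarrow> (real^2) set" where
  "box_around a b x0 r = {x. \<bar>a \<bullet> x - a \<bullet> x0\<bar> \<le> r \<and> \<bar>b \<bullet> x - b \<bullet> x0\<bar> \<le> r}"

lemma closed_box_around: "closed (box_around a b x0 r)"
  unfolding box_around_def by (intro closed_Collect_conj closed_Collect_le continuous_intros)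

lemma box_around_subset_cball:
  assumes dual: "\<And>x. x = (a \<bullet> x) *\<^sub>R e + (b \<bullet> x) *\<^sub>R v"
  shows "box_around a b x0 r \<subseteq> cball x0 (r * (norm e + norm v))"
proof
  fix x assume x: "x \<in> box_around a b x0 r"
  have "norm (x - x0) = norm ((a \<bullet> (x - x0)) *\<^sub>R e + (b \<bullet> (x - x0)) *\<^sub>R v)"
    using dual[of "x - x0"] by simp
  also have "\<dots> \<le> \<bar>a \<bullet> (x - x0)\<bar> * norm e + \<bar>b \<bullet> (x - x0)\<bar> * norm v"
    by (rule norm_triangle_le) simp
  also have "\<dots> \<le> r * norm e + r * norm v"
    using x by (intro add_mono mult_right_mono) (auto simp: box_around_def inner_diff_right)
  finally show "x \<in> cball x0 (r * (norm e + norm v))"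
    by (simp add: dist_norm norm_minus_commute algebra_simps)
qed

lemma box_around_disjoint:
  assumes dual: "\<And>x. x = (a \<bullet> x) *\<^sub>R e + (b \<bullet> x) *\<^sub>R v" and "closed F" "x0 \<notin> F"
  obtains r where "0 < r" "box_around a b x0 (3 * r) \<inter> F = {}"
proof -
  obtain d where d: "d > 0" "ball x0 d \<inter> F = {}"
    using openE[of "- F" x0] assms(2,3) by (auto simp: open_Compl disjoint_eq_subset_Compl)
  define k where "k = norm e + norm v + 1"
  \<comment> \<open>Then \<open>3 * r * k\<close> is \<open>3 * d / 4\<close>, strictly below
    \<open>d\<close>; the summand 1 in \<open>k\<close> rules out a division by zero.\<close>
  define r where "r = d / (4 * k)"
  have k: "k \<ge> 1" by (simp add: k_def)
  then have r: "r > 0" using d(1) by (simp add: r_def)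
  have "3 * r * (norm e + norm v) \<le> 3 * r * k" using r by (intro mult_left_mono) (auto simp: k_def)
  also have "\<dots> < d" using k d(1) by (simp add: r_def)
  finally have "box_around a b x0 (3 * r) \<subseteq> ball x0 d"
    using box_around_subset_cball[OF dual, of x0 "3 * r"] by force
  then show thesis using d(2) r that by blast
qed

lemma cutoff_linear_eq:
  assumes "0 < r" "x \<in> box_around a b x0 (2 * r)"
  shows "cutoff_linear a b x0 r w x = w \<bullet> x"
  using assms by (simp add: cutoff_linear_def box_around_def bump_1)

lemma cutoff_linear_eq_0:
  assumes "0 < r" "x \<notin> box_around a b x0 (3 * r)"
  shows "cutoff_linear a b x0 r w x = 0"
  using assms bump_0[of r "a \<bullet> x" "a \<bullet> x0"] bump_0[of r "b \<bullet> x" "b \<bullet> x0"]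
  by (auto simp: cutoff_linear_def box_around_def)

lemma laplacian_cutoff_linear:
  assumes "0 < r" "x \<in> box_around a b x0 r"
  shows "laplacian (cutoff_linear a b x0 r w) x = 0"
proof -
  define O1 where "O1 = {x. \<bar>a \<bullet> x - a \<bullet> x0\<bar> < 2 * r \<and> \<bar>b \<bullet> x - b \<bullet> x0\<bar> < 2 * r}"
  have "open O1" unfolding O1_def by (intro open_Collect_conj open_Collect_less continuous_intros)
  moreover have "x \<in> O1" using assms by (auto simp: O1_def box_around_def)
  ultimately show ?thesis
    using cutoff_linear_eq[OF assms(1)]
    by (subst laplacian_cong[where g = "\<lambda>x. w \<bullet> x"]) (auto simp: O1_def box_around_def laplacian_inner)
qed

lemma C2_on_cutoff_linear: "C2_on (cutoff_linear a b x0 r w) UNIV"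
  unfolding cutoff_linear_def[abs_def] by (intro C2_on_mult C2_on_bump C2_on_inner open_UNIV)

text \<open>
  Each side is either avoided by the support or is the line on which \<open>b \<bullet> x\<close> vanishes; on the latter
  both cutoffs are constant in the direction \<open>v\<close> of reflection.
\<close>

lemma test_fun_cutoff_linear:
  fixes a b e v x0 w :: "real^2"
  assumes dual: "\<And>x. x = (a \<bullet> x) *\<^sub>R e + (b \<bullet> x) *\<^sub>R v" and v: "a \<bullet> v = 0" "b \<bullet> v = 1"
    and r: "0 < r" and F: "box_around a b x0 (3 * r) \<inter> F = {}" "0 \<in> F"
    and s1: "side1 \<subseteq> F \<or> (refl1 \<theta>1 = v \<and> (\<forall>x\<in>side1. b \<bullet> x = 0) \<and> b \<bullet> x0 = 0 \<and> 0 \<le> w \<bullet> v)"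
    and s2: "side2 \<xi> \<subseteq> F \<or> (refl2 \<xi> \<theta>2 = v \<and> (\<forall>x\<in>side2 \<xi>. b \<bullet> x = 0) \<and> b \<bullet> x0 = 0 \<and> 0 \<le> w \<bullet> v)"
  shows "test_fun \<xi> \<theta>1 \<theta>2 (cutoff_linear a b x0 r w)"
proof -
  define f where "f = cutoff_linear a b x0 r w"
  define C where "C = box_around a b x0 (3 * r)"
  have "closed C" by (simp add: C_def closed_box_around)
  have "compact C"
    using \<open>closed C\<close> box_around_subset_cball[OF dual] bounded_cball
    unfolding C_def compact_eq_bounded_closed by (blast intro: bounded_subset)
  have out: "f y = 0" if "y \<in> - C" for y
    using cutoff_linear_eq_0[OF r] that by (simp add: f_def C_def)
  have F_C: "F \<subseteq> - C" using F by (auto simp: C_def)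
  have C2: "f \<in> Cb2 (wedge \<xi>)"
    by (rule Cb2_of_compact_support[of UNIV _ _ C])
      (use C2_on_cutoff_linear \<open>compact C\<close> \<open>closed C\<close> out in \<open>auto simp: f_def open_Compl intro!: exI[of _ "- C"]\<close>)
  have near0: "\<forall>\<^sub>F x in nhds 0. f x = 0"
    using \<open>closed C\<close> out F(2) F_C by (auto simp: eventually_nhds open_Compl intro!: exI[of _ "- C"])
  have g0: "u \<bullet> gradient f x = 0" if "x \<in> F" for x u
  proof -
    have "gradient f x = gradient (\<lambda>_. 0) x"
      using \<open>closed C\<close> that F_C out by (intro gradient_cong[of "- C"]) auto
    also have "\<dots> = 0" by (rule gradient_eq) simp
    finally show ?thesis by simp
  qed
  have gv: "0 \<le> v \<bullet> gradient f x" if "b \<bullet> x = 0" "b \<bullet> x0 = 0" "0 \<le> w \<bullet> v" for x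
  proof -
    let ?k = "bump (a \<bullet> x0) r (a \<bullet> x)"
    \<comment> \<open>Here \<open>b \<bullet> (x + h *\<^sub>R v) = h\<close>: a short move along
      \<open>v\<close> stays on the plateau of the second cutoff and does not change the first, so
      \<open>f\<close> is affine in \<open>h\<close>.\<close>
    have "((\<lambda>h. ?k * (w \<bullet> x + h * (w \<bullet> v))) has_real_derivative ?k * (w \<bullet> v)) (at 0)"
      by (auto intro!: derivative_eq_intros)
    then have "((\<lambda>h. f (x + h *\<^sub>R v)) has_real_derivative ?k * (w \<bullet> v)) (at 0)"
    proof (rule has_field_derivative_transform_within_open[of _ _ _ "{-r<..<r}"])
      fix h assume "h \<in> {-r<..<r}"
      then show "?k * (w \<bullet> x + h * (w \<bullet> v)) = f (x + h *\<^sub>R v)"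
        using that v r by (simp add: f_def cutoff_linear_def inner_add_right bump_1 abs_le_iff)
    qed (use r in auto)
    from DERIV_unique[OF this DERIV_gradient]
    have "v \<bullet> gradient f x = ?k * (w \<bullet> v)"
      using C2_on_differentiable[OF C2_on_cutoff_linear open_UNIV, of x] by (simp add: f_def)
    then show ?thesis using that(3) by (simp add: bump_nonneg)
  qed
  have "0 \<le> refl1 \<theta>1 \<bullet> gradient f x" if "x \<in> side1" for x
    using s1 that g0[of x] gv[of x] by auto
  moreover have "0 \<le> refl2 \<xi> \<theta>2 \<bullet> gradient f x" if "x \<in> side2 \<xi>" for x
    using s2 that g0[of x] gv[of x] by auto
  ultimately show ?thesis
    using C2 near0 unfolding test_fun_def f_def[symmetric] by blast
qed

section \<open>Logarithmic test functions\<close>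

text \<open>For \<open>\<xi> < pi\<close> the wedge without its corner lies in the open half-plane
  around the bisector, where the polar angle is an \<open>arctan\<close> without branch cut.\<close>

definition bisector :: "real \<Rightarrow> real^2" where "bisector \<xi> = vector [cos (\<xi> / 2), sin (\<xi> / 2)]"
definition bisector_perp :: "real \<Rightarrow> real^2" where "bisector_perp \<xi> = vector [- sin (\<xi> / 2), cos (\<xi> / 2)]"

text \<open>The polar angle measured from the bisector of the wedge.\<close>

definition angle :: "real \<Rightarrow> real^2 \<Rightarrow> real" where
  "angle \<xi> x = arctan ((bisector_perp \<xi> \<bullet> x) / (bisector \<xi> \<bullet> x))"

text \<open>The real part of \<open>1 - i * c\<close> times the complex logarithm, with the angle
  taken from the bisector. Writing it through \<open>x \<bullet> x\<close> avoids differentiating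
  the norm.\<close>

definition log_potential :: "real \<Rightarrow> real \<Rightarrow> real^2 \<Rightarrow> real" where
  "log_potential \<xi> c x = ln (x \<bullet> x) / 2 + c * angle \<xi> x"

lemma inner_vector2: "vector [p, q] \<bullet> (x::real^2) = p * x $ 1 + q * x $ 2"
  by (simp add: inner_real2)

lemma bisector_norm: "(bisector \<xi> \<bullet> x)\<^sup>2 + (bisector_perp \<xi> \<bullet> x)\<^sup>2 = x \<bullet> x"
proof -
  have "(bisector \<xi> \<bullet> x)\<^sup>2 + (bisector_perp \<xi> \<bullet> x)\<^sup>2 =
    ((cos (\<xi>/2))\<^sup>2 + (sin (\<xi>/2))\<^sup>2) * (x $ 1 * x $ 1 + x $ 2 * x $ 2)"
    unfolding bisector_def bisector_perp_def inner_vector2 by algebra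
  then show ?thesis by (simp add: inner_real2)
qed

lemma has_derivative_log_potential:
  assumes "0 < bisector \<xi> \<bullet> x"
  shows "(log_potential \<xi> c has_derivative
    (\<lambda>h. ((1 / (x \<bullet> x)) *\<^sub>R (x + c *\<^sub>R vector [- x $ 2, x $ 1])) \<bullet> h)) (at x)"
proof -
  let ?p = "bisector \<xi>" and ?q = "bisector_perp \<xi>"
  have pos: "x \<bullet> x > 0" using assms by auto
  have n: "(?p \<bullet> x)\<^sup>2 + (?q \<bullet> x)\<^sup>2 = x \<bullet> x" by (rule bisector_norm)
  have "((\<lambda>x. (?q \<bullet> x) / (?p \<bullet> x)) has_derivative
      (\<lambda>h. ((?q \<bullet> h) * (?p \<bullet> x) - (?q \<bullet> x) * (?p \<bullet> h)) / (?p \<bullet> x)\<^sup>2)) (at x)"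
    using assms by (auto intro!: derivative_eq_intros simp: power2_eq_square field_simps)
  from DERIV_compose_FDERIV[OF DERIV_arctan this]
  have "(angle \<xi> has_derivative (\<lambda>h. ((?q \<bullet> h) * (?p \<bullet> x) - (?q \<bullet> x) * (?p \<bullet> h)) / (?p \<bullet> x)\<^sup>2 *
      inverse (1 + (?q \<bullet> x / (?p \<bullet> x))\<^sup>2))) (at x)"
    by (simp add: angle_def[abs_def])
  also have "(\<lambda>h. ((?q \<bullet> h) * (?p \<bullet> x) - (?q \<bullet> x) * (?p \<bullet> h)) / (?p \<bullet> x)\<^sup>2 *
      inverse (1 + (?q \<bullet> x / (?p \<bullet> x))\<^sup>2)) = (\<lambda>h. (vector [- x $ 2, x $ 1] \<bullet> h) / (x \<bullet> x))"
  proof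
    fix h
    have gen: "a / b * inverse d = a / (b * d)" for a b d :: real
      by (simp add: divide_inverse)
    have A: "(?p \<bullet> x)\<^sup>2 * (1 + (?q \<bullet> x / (?p \<bullet> x))\<^sup>2) = x \<bullet> x"
      using assms n by (simp add: field_simps)
    \<comment> \<open>The sum of squares is kept as an explicit factor so that the identity is
      polynomial in \<open>cos\<close>, \<open>sin\<close> and the coordinates.\<close>
    have B: "(?q \<bullet> h) * (?p \<bullet> x) - (?q \<bullet> x) * (?p \<bullet> h) =
      ((cos (\<xi>/2))\<^sup>2 + (sin (\<xi>/2))\<^sup>2) * (vector [- x $ 2, x $ 1] \<bullet> h)"
      unfolding bisector_def bisector_perp_def inner_vector2 by algebra
    have "((?q \<bullet> h) * (?p \<bullet> x) - (?q \<bullet> x) * (?p \<bullet> h)) / (?p \<bullet> x)\<^sup>2 *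
      inverse (1 + (?q \<bullet> x / (?p \<bullet> x))\<^sup>2) =
      ((?q \<bullet> h) * (?p \<bullet> x) - (?q \<bullet> x) * (?p \<bullet> h)) /
      ((?p \<bullet> x)\<^sup>2 * (1 + (?q \<bullet> x / (?p \<bullet> x))\<^sup>2))"
      by (rule gen)
    then show "((?q \<bullet> h) * (?p \<bullet> x) - (?q \<bullet> x) * (?p \<bullet> h)) / (?p \<bullet> x)\<^sup>2 *
      inverse (1 + (?q \<bullet> x / (?p \<bullet> x))\<^sup>2) = (vector [- x $ 2, x $ 1] \<bullet> h) / (x \<bullet> x)"
      unfolding A B by simp
  qed
  finally have 1: "(angle \<xi> has_derivative (\<lambda>h. (vector [- x $ 2, x $ 1] \<bullet> h) / (x \<bullet> x))) (at x)" .
  have "((\<lambda>x. x \<bullet> x) has_derivative (\<lambda>h. x \<bullet> h + h \<bullet> x)) (at x)"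
    by (intro derivative_intros)
  from has_derivative_mult_right[OF DERIV_compose_FDERIV[OF DERIV_ln[OF pos] this], of "1/2"]
  have "((\<lambda>x. ln (x \<bullet> x) / 2) has_derivative (\<lambda>h. (x \<bullet> h) / (x \<bullet> x))) (at x)"
    by (simp add: inner_commute inverse_eq_divide)
  from has_derivative_add[OF this has_derivative_mult_right[OF 1, of c]]
  have "(log_potential \<xi> c has_derivative
      (\<lambda>h. (x \<bullet> h) / (x \<bullet> x) + c * ((vector [- x $ 2, x $ 1] \<bullet> h) / (x \<bullet> x)))) (at x)"
    by (simp add: log_potential_def[abs_def])
  then show ?thesis
    by (rule has_derivative_eq_rhs) (auto simp: inner_add_left add_divide_distrib)
qed

lemma open_bisector: "open {x. 0 < bisector \<xi> \<bullet> x}"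
  by (intro open_Collect_less continuous_intros)

text \<open>Both partial derivatives are linear forms divided by \<open>x \<bullet> x\<close>. The
  two diagonal coefficients add up to 2, and in \<open>x $ 1 * (a1 \<bullet> x) + x $ 2 * (a2
  \<bullet> x) = x \<bullet> x\<close> the terms with \<open>c\<close> cancel.\<close>

lemma laplacian_log_potential:
  assumes "0 < bisector \<xi> \<bullet> x"
  shows "laplacian (log_potential \<xi> c) x = 0"
proof -
  define a1 a2 :: "real^2" where "a1 = vector [1, -c]" and "a2 = vector [c, 1]"
  have pos: "x \<bullet> x > 0" using assms by auto
  have D: "((\<lambda>x. (a \<bullet> x) / (x \<bullet> x)) has_derivative
      (\<lambda>h. ((a \<bullet> h) * (x \<bullet> x) - (a \<bullet> x) * (2 * (x \<bullet> h))) / (x \<bullet> x)\<^sup>2)) (at x)" for a :: "real^2"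
    using pos by (auto intro!: derivative_eq_intros simp: inner_commute power2_eq_square field_simps)
  have p: "partial_deriv 1 (log_potential \<xi> c) y = (a1 \<bullet> y) / (y \<bullet> y)"
    "partial_deriv 2 (log_potential \<xi> c) y = (a2 \<bullet> y) / (y \<bullet> y)" if "0 < bisector \<xi> \<bullet> y" for y
    unfolding partial_deriv_eq[OF has_derivative_log_potential[OF that]]
    by (auto simp: a1_def a2_def inner_axis inner_vector2 add_divide_distrib diff_divide_distrib)
  have "partial_deriv 1 (partial_deriv 1 (log_potential \<xi> c)) x =
      ((a1 \<bullet> axis 1 1) * (x \<bullet> x) - (a1 \<bullet> x) * (2 * (x \<bullet> axis 1 1))) / (x \<bullet> x)\<^sup>2"
    using assms p by (subst partial_deriv_cong[OF open_bisector, of x \<xi>]) (auto simp: partial_deriv_eq[OF D])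
  moreover have "partial_deriv 2 (partial_deriv 2 (log_potential \<xi> c)) x =
      ((a2 \<bullet> axis 2 1) * (x \<bullet> x) - (a2 \<bullet> x) * (2 * (x \<bullet> axis 2 1))) / (x \<bullet> x)\<^sup>2"
    using assms p by (subst partial_deriv_cong[OF open_bisector, of x \<xi>]) (auto simp: partial_deriv_eq[OF D])
  ultimately have "laplacian (log_potential \<xi> c) x =
      (((a1 \<bullet> axis 1 1) * (x \<bullet> x) - (a1 \<bullet> x) * (2 * (x \<bullet> axis 1 1))) +
       ((a2 \<bullet> axis 2 1) * (x \<bullet> x) - (a2 \<bullet> x) * (2 * (x \<bullet> axis 2 1)))) / (x \<bullet> x)\<^sup>2"
    by (simp add: laplacian_def sum_2 add_divide_distrib)
  also have "\<dots> = 0"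
    by (simp add: a1_def a2_def inner_axis inner_vector2 inner_real2 axis_def algebra_simps)
  finally show ?thesis .
qed

lemma C2_on_angle: "C2_on (angle \<xi>) {x. 0 < bisector \<xi> \<bullet> x}"
  unfolding angle_def[abs_def] divide_inverse
proof (rule C2_on_compose[OF open_bisector, of "\<lambda>x. (bisector_perp \<xi> \<bullet> x) * inverse (bisector \<xi> \<bullet> x)" _ UNIV])
  show "(arctan has_real_derivative inverse (1 + t\<^sup>2)) (at t)" for t
    by (rule DERIV_arctan)
  show "((\<lambda>t. inverse (1 + t\<^sup>2)) has_real_derivative - 2 * t * inverse (1 + t\<^sup>2) ^ 2) (at t)" for t :: real
    using sum_power2_gt_zero_iff[of 1 t]
    by (auto intro!: derivative_eq_intros simp: power2_eq_square add_nonneg_eq_0_iff)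
  show "continuous_on UNIV (\<lambda>t::real. - 2 * t * inverse (1 + t\<^sup>2) ^ 2)"
    by (intro continuous_intros) (smt (verit) zero_le_power2)
qed (intro C2_on_mult C2_on_inverse C2_on_inner open_bisector, auto)

lemma C2_on_log_potential: "C2_on (log_potential \<xi> c) {x. 0 < bisector \<xi> \<bullet> x}"
proof -
  let ?U = "{x. 0 < bisector \<xi> \<bullet> x}"
  have sq: "x \<bullet> x = (axis 1 1 \<bullet> x) * (axis 1 1 \<bullet> x) + (axis 2 1 \<bullet> x) * (axis 2 1 \<bullet> x)" for x :: "real^2"
    by (simp add: inner_real2 axis_def)
  have "C2_on (\<lambda>x. x \<bullet> x) ?U"
    unfolding sq by (intro C2_on_add C2_on_mult C2_on_inner open_bisector)
  then have "C2_on (\<lambda>x. ln (x \<bullet> x)) ?U"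
  proof (rule C2_on_compose[OF open_bisector, where I = "{0<..}" and g' = inverse and g'' = "\<lambda>t. - (inverse t ^ 2)"])
    show "(ln has_real_derivative inverse t) (at t)" if "t \<in> {0<..}" for t :: real
      using that by (auto intro!: derivative_eq_intros simp: inverse_eq_divide)
    show "(inverse has_real_derivative - (inverse t ^ 2)) (at t)" if "t \<in> {0<..}" for t :: real
      using that by (auto intro!: derivative_eq_intros simp: power2_eq_square)
  qed (auto intro!: continuous_intros)
  from C2_on_affine[OF open_bisector this, of "1/2" 0]
    C2_on_affine[OF open_bisector C2_on_angle, of c \<xi> 0]
  show ?thesis
    unfolding log_potential_def[abs_def] by (simp add: C2_on_add open_bisector)
qed


lemma norm_eq_exp_ln: "0 < bisector \<xi> \<bullet> x \<Longrightarrow> ln (x \<bullet> x) / 2 = ln (norm x)"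
  by (auto simp: norm_eq_sqrt_inner ln_sqrt)

lemma angle_bounds: "\<bar>angle \<xi> x\<bar> < pi / 2"
  using arctan_bounded[of "bisector_perp \<xi> \<bullet> x / (bisector \<xi> \<bullet> x)"] by (auto simp: angle_def abs_if)

text \<open>The angle is bounded, so the levels of the potential are comparable with circles around
  the corner: low values mean closeness to the corner, high values a large norm.\<close>

lemma log_potential_bounds:
  assumes "0 < bisector \<xi> \<bullet> x"
  shows "\<bar>log_potential \<xi> c x - ln (norm x)\<bar> \<le> \<bar>c\<bar> * (pi / 2)"
  unfolding log_potential_def norm_eq_exp_ln[OF assms]
  using mult_left_mono[OF less_imp_le[OF angle_bounds], of "\<bar>c\<bar>" \<xi> x] by (simp add: abs_mult)

section \<open>Polar coordinates in the wedge\<close>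

lemma polar_nth: "polar r \<theta> $ 1 = r * cos \<theta>" "polar r \<theta> $ 2 = r * sin \<theta>"
  by (simp_all add: polar_def)

lemma bisector_polar:
  "bisector \<xi> \<bullet> polar r \<theta> = r * cos (\<theta> - \<xi> / 2)" "bisector_perp \<xi> \<bullet> polar r \<theta> = r * sin (\<theta> - \<xi> / 2)"
  by (simp_all add: bisector_def bisector_perp_def inner_vector2 polar_nth cos_diff sin_diff algebra_simps)

lemma norm_polar: "0 \<le> r \<Longrightarrow> norm (polar r \<theta>) = r"
proof -
  assume "0 \<le> r"
  have "polar r \<theta> \<bullet> polar r \<theta> = r\<^sup>2 * ((cos \<theta>)\<^sup>2 + (sin \<theta>)\<^sup>2)"
    unfolding inner_real2 polar_nth by algebra
  then show ?thesis using \<open>0 \<le> r\<close> by (simp add: norm_eq_sqrt_inner)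
qed

lemma angle_polar:
  assumes "0 < r" "0 \<le> \<theta>" "\<theta> \<le> \<xi>" "\<xi> < pi"
  shows "angle \<xi> (polar r \<theta>) = \<theta> - \<xi> / 2"
  unfolding angle_def bisector_polar using assms arctan_tan[of "\<theta> - \<xi> / 2"]
  by (simp add: tan_def)

text \<open>The angle to the bisector is at most \<open>\<xi> / 2\<close>. This places the wedge in
  a closed cone that meets the boundary of the half-plane only at the corner.\<close>

lemma wedge_bisector:
  assumes "x \<in> wedge \<xi>" "\<xi> < pi"
  shows "cos (\<xi> / 2) * norm x \<le> bisector \<xi> \<bullet> x"
proof -
  obtain r \<theta> where x: "x = polar r \<theta>" "0 \<le> r" "0 \<le> \<theta>" "\<theta> \<le> \<xi>"
    using assms(1) by (auto simp: wedge_def)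
  have "cos (\<xi> / 2) \<le> cos \<bar>\<theta> - \<xi> / 2\<bar>"
    using x assms(2) by (intro cos_monotone_0_pi_le) linarith+
  then show ?thesis
    using x by (simp add: bisector_polar norm_polar mult.commute mult_left_mono)
qed

lemma wedge_bisector_pos:
  assumes "x \<in> wedge \<xi>" "0 < \<xi>" "\<xi> < pi" "x \<noteq> 0"
  shows "0 < bisector \<xi> \<bullet> x"
proof -
  have "0 < cos (\<xi> / 2)" using assms by (intro cos_gt_zero) auto
  then have "0 < cos (\<xi> / 2) * norm x" using assms by simp
  then show ?thesis using wedge_bisector[of x \<xi>] assms by linarith
qed

text \<open>An extreme angle means a point of a side; this is how estimates on the angle are read as
  visits to the sides.\<close>

lemma wedge_angle_le:
  assumes "x \<in> wedge \<xi>" "0 < \<xi>" "\<xi> < pi" "x \<noteq> 0"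
  shows "\<bar>angle \<xi> x\<bar> \<le> \<xi> / 2"
    and "angle \<xi> x = - \<xi> / 2 \<Longrightarrow> x \<in> side1" and "angle \<xi> x = \<xi> / 2 \<Longrightarrow> x \<in> side2 \<xi>"
proof -
  obtain r \<theta> where x: "x = polar r \<theta>" "0 \<le> r" "0 \<le> \<theta>" "\<theta> \<le> \<xi>"
    using assms(1) by (auto simp: wedge_def)
  have "r \<noteq> 0" using x assms(4) by (auto simp: vec_eq_iff forall_2 polar_nth)
  then have "angle \<xi> x = \<theta> - \<xi> / 2"
    using x assms by (simp add: angle_polar)
  then show "\<bar>angle \<xi> x\<bar> \<le> \<xi> / 2" "angle \<xi> x = - \<xi> / 2 \<Longrightarrow> x \<in> side1"
    "angle \<xi> x = \<xi> / 2 \<Longrightarrow> x \<in> side2 \<xi>"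
    using x by (simp_all only: abs_le_iff, auto simp: side1_def side2_def)
qed

lemma zero_polar: "polar 0 \<theta> = 0"
  by (simp add: vec_eq_iff forall_2 polar_nth)

lemma side1_subset_wedge: "0 \<le> \<xi> \<Longrightarrow> side1 \<subseteq> wedge \<xi>"
  and side2_subset_wedge: "0 \<le> \<xi> \<Longrightarrow> side2 \<xi> \<subseteq> wedge \<xi>"
  by (auto simp: side1_def side2_def wedge_def)

lemma side1_angle:
  assumes "x \<in> side1" "x \<noteq> 0" "0 < \<xi>" "\<xi> < pi"
  shows "angle \<xi> x = - \<xi> / 2"
proof -
  obtain r where "x = polar r 0" "0 \<le> r" using assms(1) by (auto simp: side1_def)
  moreover from this have "r \<noteq> 0" using assms(2) by (auto simp: zero_polar)
  ultimately show ?thesis using angle_polar[of r 0 \<xi>] assms by simp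
qed

lemma side2_angle:
  assumes "x \<in> side2 \<xi>" "x \<noteq> 0" "0 < \<xi>" "\<xi> < pi"
  shows "angle \<xi> x = \<xi> / 2"
proof -
  obtain r where "x = polar r \<xi>" "0 \<le> r" using assms(1) by (auto simp: side2_def)
  moreover from this have "r \<noteq> 0" using assms(2) by (auto simp: zero_polar)
  ultimately show ?thesis using angle_polar[of r \<xi> \<xi>] assms by simp
qed

section \<open>Cut-off logarithmic potentials\<close>

definition log_profile :: "real \<Rightarrow> real \<Rightarrow> real \<Rightarrow> real" where
  "log_profile \<beta> \<gamma> s = s * (step (s + (2 - \<beta>)) * step (- s + (\<gamma> + 2)))"

text \<open>
  For \<open>\<sigma> = 1\<close> the function is cut off near the second side, for \<open>\<sigma> = - 1\<close> near the first one.
\<close>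

definition log_cutoff :: "real \<Rightarrow> real \<Rightarrow> real \<Rightarrow> real \<Rightarrow> real \<Rightarrow> real \<Rightarrow> real^2 \<Rightarrow> real" where
  "log_cutoff \<xi> c \<sigma> \<beta> \<gamma> \<delta> x =
    (if 0 < bisector \<xi> \<bullet> x
     then log_profile \<beta> \<gamma> (log_potential \<xi> c x) * step ((\<xi> / 2 - \<sigma> * angle \<xi> x) / \<delta> - 1) else 0)"

text \<open>Around the range from \<open>\<beta>\<close> to \<open>\<gamma>\<close> one unit is left
  for the exact identity, so that derivatives on the range are unaffected, and one more for the
  transition to zero. Cutting off low values makes a test function constant near the corner, cutting
  off high values makes its support bounded.\<close>

lemma log_profile_eq: "\<beta> - 1 \<le> s \<Longrightarrow> s \<le> \<gamma> + 1 \<Longrightarrow> log_profile \<beta> \<gamma> s = s"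
  by (simp add: log_profile_def step_1)

lemma log_profile_0: "s \<le> \<beta> - 2 \<or> \<gamma> + 2 \<le> s \<Longrightarrow> log_profile \<beta> \<gamma> s = 0"
  by (auto simp: log_profile_def step_0)

text \<open>The bound does not depend on \<open>\<beta>\<close>. This lets the lower level go to
  minus infinity while the test function stays bounded above.\<close>

lemma log_profile_le:
  assumes "0 \<le> \<gamma>"
  shows "log_profile \<beta> \<gamma> s \<le> \<gamma> + 2"
proof -
  let ?k = "step (s + (2 - \<beta>)) * step (- s + (\<gamma> + 2))"
  have k: "0 \<le> ?k" "?k \<le> 1" by (simp_all add: step_nonneg step_le_1 mult_le_one)
  show ?thesis
  proof (cases "s \<ge> \<gamma> + 2")
    case True then show ?thesis using assms by (simp add: log_profile_0)
  next
    case False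
    have "s * ?k \<le> max 0 s * ?k" using k by (intro mult_right_mono) auto
    also have "\<dots> \<le> max 0 s * 1" using k by (intro mult_left_mono) auto
    finally show ?thesis using False assms by (simp add: log_profile_def)
  qed
qed

lemma log_cutoff_le: "0 \<le> \<gamma> \<Longrightarrow> log_cutoff \<xi> c \<sigma> \<beta> \<gamma> \<delta> x \<le> \<gamma> + 2"
proof -
  assume g: "0 \<le> \<gamma>"
  have "p * step t \<le> \<gamma> + 2" if "p \<le> \<gamma> + 2" for p t
  proof -
    have "p * step t \<le> (\<gamma> + 2) * step t" using that by (intro mult_right_mono step_nonneg)
    also have "\<dots> \<le> (\<gamma> + 2) * 1" using g by (intro mult_left_mono step_le_1) auto
    finally show ?thesis by simp
  qed
  then show ?thesis using log_profile_le[OF g] g by (simp add: log_cutoff_def)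
qed

lemma continuous_on_angle: "continuous_on {x. 0 < bisector \<xi> \<bullet> x} (angle \<xi>)"
  by (rule C1_on_continuous[OF C2_on_imp_C1_on[OF C2_on_angle]])

lemma continuous_on_log_potential: "continuous_on {x. 0 < bisector \<xi> \<bullet> x} (log_potential \<xi> c)"
  by (rule C1_on_continuous[OF C2_on_imp_C1_on[OF C2_on_log_potential]])

lemma open_angle:
  "open {x. 0 < bisector \<xi> \<bullet> x \<and> m < \<sigma> * angle \<xi> x}" "open {x. 0 < bisector \<xi> \<bullet> x \<and> \<sigma> * angle \<xi> x < m}"
proof -
  have 1: "continuous_on {x. 0 < bisector \<xi> \<bullet> x} (\<lambda>x. \<sigma> * angle \<xi> x)"
    by (intro continuous_intros continuous_on_angle)
  have "open ({x. 0 < bisector \<xi> \<bullet> x} \<inter> (\<lambda>x. \<sigma> * angle \<xi> x) -` {m<..})"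
    "open ({x. 0 < bisector \<xi> \<bullet> x} \<inter> (\<lambda>x. \<sigma> * angle \<xi> x) -` {..<m})"
    by (intro continuous_open_preimage[OF 1 open_bisector] open_greaterThan open_lessThan)+
  then show "open {x. 0 < bisector \<xi> \<bullet> x \<and> m < \<sigma> * angle \<xi> x}"
    "open {x. 0 < bisector \<xi> \<bullet> x \<and> \<sigma> * angle \<xi> x < m}"
    by (simp_all add: Collect_conj_eq vimage_def greaterThan_def lessThan_def)
qed

lemma open_log_potential:
  "open {x. 0 < bisector \<xi> \<bullet> x \<and> m < log_potential \<xi> c x \<and> log_potential \<xi> c x < k}"
  using continuous_open_preimage[OF continuous_on_log_potential open_bisector open_greaterThanLessThan, of \<xi> c m k]
  by (simp add: Collect_conj_eq vimage_def greaterThanLessThan_def greaterThan_def lessThan_def)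

lemma log_cutoff_eq:
  assumes "0 < bisector \<xi> \<bullet> x" "\<beta> - 1 \<le> log_potential \<xi> c x" "log_potential \<xi> c x \<le> \<gamma> + 1"
    and "0 < \<delta>" "\<sigma> * angle \<xi> x \<le> \<xi> / 2 - 2 * \<delta>"
  shows "log_cutoff \<xi> c \<sigma> \<beta> \<gamma> \<delta> x = log_potential \<xi> c x"
  using assms by (simp add: log_cutoff_def log_profile_eq step_1 field_simps)

lemma laplacian_log_cutoff:
  assumes "0 < bisector \<xi> \<bullet> x" "\<beta> - 1 < log_potential \<xi> c x" "log_potential \<xi> c x < \<gamma> + 1"
    and "0 < \<delta>" "\<sigma> * angle \<xi> x < \<xi> / 2 - 2 * \<delta>"
  shows "laplacian (log_cutoff \<xi> c \<sigma> \<beta> \<gamma> \<delta>) x = 0"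
proof -
  have "laplacian (log_cutoff \<xi> c \<sigma> \<beta> \<gamma> \<delta>) x = laplacian (log_potential \<xi> c) x"
    by (rule laplacian_cong[OF open_Int[OF open_log_potential[of \<xi> "\<beta> - 1" c "\<gamma> + 1"]
            open_angle(2)[of \<xi> \<sigma> "\<xi> / 2 - 2 * \<delta>"]]])
      (use assms in \<open>auto intro!: log_cutoff_eq\<close>)
  then show ?thesis by (simp add: laplacian_log_potential[OF assms(1)])
qed

lemma log_cutoff_small:
  assumes "norm x \<le> exp (\<beta> - 2 - \<bar>c\<bar> * (pi / 2))"
  shows "log_cutoff \<xi> c \<sigma> \<beta> \<gamma> \<delta> x = 0"
proof (cases "0 < bisector \<xi> \<bullet> x")
  case True
  then have "0 < norm x" by auto
  then have "ln (norm x) \<le> \<beta> - 2 - \<bar>c\<bar> * (pi / 2)"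
    using assms by (simp add: ln_le_cancel_iff[symmetric] del: ln_le_cancel_iff)
  then have "log_potential \<xi> c x \<le> \<beta> - 2"
    using log_potential_bounds[OF True, of c] by linarith
  then show ?thesis by (simp add: log_cutoff_def log_profile_0)
qed (simp add: log_cutoff_def)

lemma log_cutoff_large:
  assumes "exp (\<gamma> + 2 + \<bar>c\<bar> * (pi / 2)) \<le> norm x"
  shows "log_cutoff \<xi> c \<sigma> \<beta> \<gamma> \<delta> x = 0"
proof (cases "0 < bisector \<xi> \<bullet> x")
  case True
  then have "0 < norm x" by auto
  then have "\<gamma> + 2 + \<bar>c\<bar> * (pi / 2) \<le> ln (norm x)"
    using assms by (simp add: ln_ge_iff)
  then have "\<gamma> + 2 \<le> log_potential \<xi> c x"
    using log_potential_bounds[OF True, of c] by linarith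
  then show ?thesis by (simp add: log_cutoff_def log_profile_0)
qed (simp add: log_cutoff_def)

lemma C2_on_log_cutoff: "C2_on (log_cutoff \<xi> c \<sigma> \<beta> \<gamma> \<delta>) {x. 0 < bisector \<xi> \<bullet> x}"
proof -
  have a: "(\<xi> / 2 - \<sigma> * t) / \<delta> - 1 = (- \<sigma> / \<delta>) * t + (\<xi> / (2 * \<delta>) - 1)" for t
    by (cases "\<delta> = 0") (simp_all add: field_simps)
  let ?U = "{x. 0 < bisector \<xi> \<bullet> x}"
  note pot = C2_on_affine[OF open_bisector C2_on_log_potential]
  have 1: "C2_on (\<lambda>x. step (log_potential \<xi> c x + (2 - \<beta>))) ?U"
    using C2_on_step[OF open_bisector pot[of 1 \<xi> c "2 - \<beta>"]] by simp
  have 2: "C2_on (\<lambda>x. step (- log_potential \<xi> c x + (\<gamma> + 2))) ?U"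
    using C2_on_step[OF open_bisector pot[of "- 1" \<xi> c "\<gamma> + 2"]] by simp
  have "C2_on (\<lambda>x. log_profile \<beta> \<gamma> (log_potential \<xi> c x) * step ((\<xi> / 2 - \<sigma> * angle \<xi> x) / \<delta> - 1)) ?U"
    unfolding log_profile_def a
    by (intro C2_on_mult 1 2 C2_on_step C2_on_affine C2_on_angle C2_on_log_potential open_bisector)
  then show ?thesis
    by (rule C2_on_cong[OF open_bisector, rotated]) (simp add: log_cutoff_def)
qed

text \<open>Existence is enough: the derivative enters the gradient only as a scalar factor in front
  of a vector orthogonal to the direction of reflection.\<close>

lemma DERIV_log_profile: "\<exists>D. (log_profile \<beta> \<gamma> has_real_derivative D) (at s)"
proof -
  have "(\<lambda>s. step (s + (2 - \<beta>))) differentiable (at s)"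
    using DERIV_step[of "s + (2 - \<beta>)"] DERIV_shift[of step _ s "2 - \<beta>"]
    by (auto simp: real_differentiable_def)
  moreover have "(\<lambda>s. step (- s + (\<gamma> + 2))) differentiable (at s)"
  proof -
    obtain D where D: "(step has_real_derivative D) (at (- s + (\<gamma> + 2)))"
      using DERIV_step by blast
    have "((\<lambda>s. step (- s + (\<gamma> + 2))) has_real_derivative D * (- 1)) (at s)"
      by (rule DERIV_chain2[of step D "\<lambda>s. - s + (\<gamma> + 2)", OF D]) (auto intro!: derivative_eq_intros)
    then show ?thesis by (auto simp: real_differentiable_def)
  qed
  ultimately have "log_profile \<beta> \<gamma> differentiable (at s)"
    unfolding log_profile_def[abs_def] by (intro differentiable_mult differentiable_ident)
  then show ?thesis by (simp add: real_differentiable_def)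
qed

text \<open>These values of \<open>c\<close> turn the gradient of the potential orthogonal to the
  direction of reflection: on the first side it is a multiple of \<open>(1, tan \<theta>1)\<close>,
  against \<open>(- tan \<theta>1, 1)\<close>.\<close>

lemma refl_log_potential:
  assumes "0 < \<xi>" "\<xi> < pi" "x \<noteq> 0"
  shows "x \<in> side1 \<Longrightarrow> refl1 \<theta>1 \<bullet> (x + tan \<theta>1 *\<^sub>R vector [- x $ 2, x $ 1]) = 0"
    and "x \<in> side2 \<xi> \<Longrightarrow> refl2 \<xi> \<theta>2 \<bullet> (x + (- tan \<theta>2) *\<^sub>R vector [- x $ 2, x $ 1]) = 0"
proof -
  show "refl1 \<theta>1 \<bullet> (x + tan \<theta>1 *\<^sub>R vector [- x $ 2, x $ 1]) = 0" if "x \<in> side1"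
    using that by (auto simp: side1_def refl1_def inner_vector2 polar_nth)
  show "refl2 \<xi> \<theta>2 \<bullet> (x + (- tan \<theta>2) *\<^sub>R vector [- x $ 2, x $ 1]) = 0" if side: "x \<in> side2 \<xi>"
  proof -
    obtain r where r: "x = polar r \<xi>" using side unfolding side2_def by blast
    have "refl2 \<xi> \<theta>2 \<bullet> (x + (- tan \<theta>2) *\<^sub>R vector [- x $ 2, x $ 1]) =
      r * tan \<theta>2 * (((cos \<xi>)\<^sup>2 + (sin \<xi>)\<^sup>2) - ((cos \<xi>)\<^sup>2 + (sin \<xi>)\<^sup>2))"
      unfolding refl2_def r inner_vector2 vector_add_component vector_scaleR_component real_scaleR_def vector_2 polar_nth
      by algebra
    then show ?thesis by simp
  qed
qed

text \<open>The boundary conditions hold with equality. Near the uncut side the function depends on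
  the potential alone, whose oblique derivative vanishes there; near the other side the angular
  factor makes it zero.\<close>

lemma test_fun_log_cutoff:
  assumes \<xi>: "0 < \<xi>" "\<xi> < pi" and \<delta>: "0 < \<delta>" "2 * \<delta> < \<xi>"
    and c: "(\<sigma> = 1 \<and> c = tan \<theta>1) \<or> (\<sigma> = - 1 \<and> c = - tan \<theta>2)"
  shows "test_fun \<xi> \<theta>1 \<theta>2 (log_cutoff \<xi> c \<sigma> \<beta> \<gamma> \<delta>)"
proof -
  define f where "f = log_cutoff \<xi> c \<sigma> \<beta> \<gamma> \<delta>"
  define U where "U = {x. 0 < bisector \<xi> \<bullet> x}"
  define r where "r = exp (\<beta> - 2 - \<bar>c\<bar> * (pi / 2))"
  define R where "R = exp (\<gamma> + 2 + \<bar>c\<bar> * (pi / 2))"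
  define C where "C = {x. cos (\<xi> / 2) * norm x \<le> bisector \<xi> \<bullet> x \<and> r \<le> norm x \<and> norm x \<le> R}"
  have r: "0 < r" by (simp add: r_def)
  have cpos: "0 < cos (\<xi> / 2)" using \<xi> by (intro cos_gt_zero) auto
  have fr: "f x = 0" if "x \<in> ball 0 r" for x
    using that log_cutoff_small[of x \<beta> c] by (simp add: f_def r_def)
  have fR: "f x = 0" if "R < norm x" for x
    using that log_cutoff_large[of \<gamma> c x] by (simp add: f_def R_def)
  \<comment> \<open>The ball around the corner completes the half-plane to an open connected set
    that contains the wedge; on the ball \<open>f\<close> is zero.\<close>
  have C2: "C2_on f (U \<union> ball 0 r)"
  proof (rule C2_on_Un)
    show "C2_on f (ball 0 r)"
      by (rule C2_on_cong[of "ball 0 r" "\<lambda>_. 0"]) (auto simp: fr intro!: C2_on_const)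
  qed (auto simp: U_def open_bisector f_def C2_on_log_cutoff)
  have "bisector \<xi> \<bullet> ((r / 2) *\<^sub>R bisector \<xi>) = r / 2" "norm ((r / 2) *\<^sub>R bisector \<xi>) < r"
    using r by (simp_all add: bisector_def norm_eq_sqrt_inner inner_vector2 flip: power2_eq_square)
  then have "(r / 2) *\<^sub>R bisector \<xi> \<in> U \<inter> ball 0 r" using r by (simp add: U_def)
  moreover have "convex U" unfolding U_def by (rule convex_halfspace_gt)
  ultimately have conn: "connected (U \<union> ball 0 r)"
    by (intro connected_Un convex_connected convex_ball) auto
  have sub: "wedge \<xi> \<subseteq> U \<union> ball 0 r"
  proof
    fix x assume "x \<in> wedge \<xi>"
    then show "x \<in> U \<union> ball 0 r"
      using wedge_bisector_pos[of x \<xi>] \<xi> r by (cases "x = 0") (simp_all add: U_def)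
  qed
  have "closed C" unfolding C_def by (intro closed_Collect_conj closed_Collect_le continuous_intros)
  moreover have "C \<subseteq> cball 0 R" by (auto simp: C_def)
  ultimately have "compact C"
    unfolding compact_eq_bounded_closed using bounded_cball bounded_subset by blast
  moreover have "C \<subseteq> U \<union> ball 0 r"
  proof
    fix x assume x: "x \<in> C"
    then have "0 < cos (\<xi> / 2) * norm x" using r cpos by (auto simp: C_def intro!: mult_pos_pos)
    then show "x \<in> U \<union> ball 0 r" using x unfolding C_def U_def by auto
  qed
  moreover have "\<exists>W. open W \<and> x \<in> W \<and> (\<forall>y\<in>W. f y = 0)" if "x \<in> wedge \<xi>" "x \<notin> C" for x
  proof -
    have "norm x < r \<or> R < norm x"
      using that wedge_bisector[OF that(1) \<xi>(2)] by (auto simp: C_def)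
    then show ?thesis
    proof
      assume "norm x < r" then show ?thesis using fr by (intro exI[of _ "ball 0 r"]) auto
    next
      assume "R < norm x" then show ?thesis
        using fR by (intro exI[of _ "{x. R < norm x}"]) (auto intro!: open_Collect_less continuous_intros)
    qed
  qed
  ultimately have Cb2: "f \<in> Cb2 (wedge \<xi>)"
    using C2 conn sub by (intro Cb2_of_compact_support) (auto simp: U_def open_bisector)
  have near0: "\<forall>\<^sub>F x in nhds 0. f x = 0"
    unfolding eventually_nhds using fr r by (intro exI[of _ "ball 0 r"]) auto
  have grad0: "u \<bullet> gradient f x = 0" if "open W" "x \<in> W" "\<And>y. y \<in> W \<Longrightarrow> f y = 0" for u x W
  proof -
    have "gradient f x = gradient (\<lambda>_. 0) x" by (rule gradient_cong[OF that])
    also have "\<dots> = 0" by (rule gradient_eq) simp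
    finally show ?thesis by simp
  qed
  have z0: "u \<bullet> gradient f 0 = 0" for u
    by (rule grad0[of "ball 0 r"]) (use r fr in auto)
  have far: "u \<bullet> gradient f x = 0" if "x \<in> U" "\<sigma> * angle \<xi> x = \<xi> / 2" for u x
  proof (rule grad0[OF open_angle(1)[of \<xi> "\<xi> / 2 - \<delta>" \<sigma>]])
    fix y assume "y \<in> {x. 0 < bisector \<xi> \<bullet> x \<and> \<xi> / 2 - \<delta> < \<sigma> * angle \<xi> x}"
    then show "f y = 0" using \<delta> by (auto simp: f_def log_cutoff_def field_simps intro!: step_0)
  qed (use that \<delta> in \<open>auto simp: U_def\<close>)
  have near: "u \<bullet> gradient f x = 0"
    if "x \<in> U" "\<sigma> * angle \<xi> x = - \<xi> / 2" "u \<bullet> (x + c *\<^sub>R vector [- x $ 2, x $ 1]) = 0" for u x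
  proof -
    have "gradient f x = gradient (\<lambda>x. log_profile \<beta> \<gamma> (log_potential \<xi> c x)) x"
    proof (rule gradient_cong[OF open_angle(2)[of \<xi> \<sigma> "\<xi> / 2 - 2 * \<delta>"]])
      fix y assume "y \<in> {x. 0 < bisector \<xi> \<bullet> x \<and> \<sigma> * angle \<xi> x < \<xi> / 2 - 2 * \<delta>}"
      then show "f y = log_profile \<beta> \<gamma> (log_potential \<xi> c y)"
        using \<delta> by (simp add: f_def log_cutoff_def field_simps step_1)
    qed (use that \<delta> in \<open>auto simp: U_def\<close>)
    moreover obtain D where D: "(log_profile \<beta> \<gamma> has_real_derivative D) (at (log_potential \<xi> c x))"
      using DERIV_log_profile by blast
    have "gradient (\<lambda>x. log_profile \<beta> \<gamma> (log_potential \<xi> c x)) x =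
        (D / (x \<bullet> x)) *\<^sub>R (x + c *\<^sub>R vector [- x $ 2, x $ 1])"
      using DERIV_compose_FDERIV[OF D has_derivative_log_potential[of \<xi> x c]] that(1)
      by (intro gradient_eq) (simp add: U_def mult.commute)
    ultimately show ?thesis using that(3) by simp
  qed
  have "0 \<le> refl1 \<theta>1 \<bullet> gradient f x" if "x \<in> side1" for x
  proof (cases "x = 0")
    case True then show ?thesis using z0 by simp
  next
    case False
    have xU: "x \<in> U" using that False wedge_bisector_pos[of x \<xi>] side1_subset_wedge[of \<xi>] \<xi> by (auto simp: U_def)
    have an: "angle \<xi> x = - \<xi> / 2" using that False \<xi> by (rule side1_angle)
    show ?thesis
      using c near[OF xU _ ] far[OF xU] an refl_log_potential(1)[OF \<xi> False that, of \<theta>1] by auto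
  qed
  moreover have "0 \<le> refl2 \<xi> \<theta>2 \<bullet> gradient f x" if "x \<in> side2 \<xi>" for x
  proof (cases "x = 0")
    case True then show ?thesis using z0 by simp
  next
    case False
    have xU: "x \<in> U" using that False wedge_bisector_pos[of x \<xi>] side2_subset_wedge[of \<xi>] \<xi> by (auto simp: U_def)
    have an: "angle \<xi> x = \<xi> / 2" using that False \<xi> by (rule side2_angle)
    show ?thesis
      using c near[OF xU _ ] far[OF xU] an refl_log_potential(2)[OF \<xi> False that, of \<theta>2] by auto
  qed
  ultimately show ?thesis
    using Cb2 near0 unfolding test_fun_def f_def[symmetric] by blast
qed

text \<open>The lower bound on the norm keeps the set off the corner, inside the region where
  potential and angle are continuous, so that it is closed in the plane. The margin
  \<open>3 * \<delta>\<close> exceeds the \<open>2 * \<delta>\<close> at which the angular factor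
  reaches one, which leaves an open neighbourhood for computing the Laplacian.\<close>

definition log_region :: "real \<Rightarrow> real \<Rightarrow> real \<Rightarrow> real \<Rightarrow> real \<Rightarrow> real \<Rightarrow> (real^2) set" where
  "log_region \<xi> c \<sigma> \<beta> \<gamma> \<delta> = {x. cos (\<xi> / 2) * norm x \<le> bisector \<xi> \<bullet> x \<and>
     exp (\<beta> - \<bar>c\<bar> * (pi / 2)) \<le> norm x \<and> log_potential \<xi> c x \<in> {\<beta>..\<gamma>} \<and>
     \<sigma> * angle \<xi> x \<in> {..\<xi> / 2 - 3 * \<delta>}}"

lemma log_region_bisector:
  assumes "0 < \<xi>" "\<xi> < pi" "x \<in> log_region \<xi> c \<sigma> \<beta> \<gamma> \<delta>"
  shows "0 < bisector \<xi> \<bullet> x"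
proof -
  have "0 < cos (\<xi> / 2)" using assms by (intro cos_gt_zero) auto
  moreover have "0 < norm x" using assms(3) unfolding log_region_def by (smt (verit) exp_gt_zero mem_Collect_eq)
  ultimately have "0 < cos (\<xi> / 2) * norm x" by simp
  then show ?thesis using assms(3) unfolding log_region_def by auto
qed

lemma log_region_iff:
  assumes "0 < \<xi>" "\<xi> < pi" "x \<in> wedge \<xi>"
  shows "x \<in> log_region \<xi> c \<sigma> \<beta> \<gamma> \<delta> \<longleftrightarrow> x \<noteq> 0 \<and> \<beta> \<le> log_potential \<xi> c x \<and>
    log_potential \<xi> c x \<le> \<gamma> \<and> \<sigma> * angle \<xi> x \<le> \<xi> / 2 - 3 * \<delta>"
proof (cases "x = 0")
  case False
  then have b: "0 < bisector \<xi> \<bullet> x" using wedge_bisector_pos assms by blast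
  have "exp (\<beta> - \<bar>c\<bar> * (pi / 2)) \<le> norm x" if "\<beta> \<le> log_potential \<xi> c x"
  proof -
    have "\<beta> - \<bar>c\<bar> * (pi / 2) \<le> ln (norm x)"
      using that log_potential_bounds[OF b, of c] by linarith
    then show ?thesis using False by (simp add: ln_ge_iff)
  qed
  then show ?thesis using False wedge_bisector[OF assms(3,2)] by (auto simp: log_region_def)
qed (simp add: log_region_def)

lemma closed_log_region:
  assumes "0 < \<xi>" "\<xi> < pi"
  shows "closed (log_region \<xi> c \<sigma> \<beta> \<gamma> \<delta>)"
proof -
  define A where "A = {x. cos (\<xi> / 2) * norm x \<le> bisector \<xi> \<bullet> x \<and> exp (\<beta> - \<bar>c\<bar> * (pi / 2)) \<le> norm x}"
  have A: "closed A" unfolding A_def by (intro closed_Collect_conj closed_Collect_le continuous_intros)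
  have "0 < cos (\<xi> / 2)" using assms by (intro cos_gt_zero) auto
  then have sub: "A \<subseteq> {x. 0 < bisector \<xi> \<bullet> x}"
    unfolding A_def by (smt (verit) exp_gt_zero mem_Collect_eq mult_pos_pos subsetI)
  have "closed (A \<inter> log_potential \<xi> c -` {\<beta>..\<gamma>})"
    by (intro continuous_closed_preimage continuous_on_subset[OF continuous_on_log_potential sub] A closed_atLeastAtMost)
  moreover have "closed (A \<inter> (\<lambda>x. \<sigma> * angle \<xi> x) -` {..\<xi> / 2 - 3 * \<delta>})"
    by (intro continuous_closed_preimage continuous_intros continuous_on_subset[OF continuous_on_angle sub] A closed_atMost)
  ultimately have "closed ((A \<inter> log_potential \<xi> c -` {\<beta>..\<gamma>}) \<inter> (A \<inter> (\<lambda>x. \<sigma> * angle \<xi> x) -` {..\<xi> / 2 - 3 * \<delta>}))"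
    by (rule closed_Int)
  also have "\<dots> = log_region \<xi> c \<sigma> \<beta> \<gamma> \<delta>" unfolding A_def log_region_def by blast
  finally show ?thesis .
qed

lemma log_cutoff_log_region:
  assumes "0 < \<xi>" "\<xi> < pi" "0 < \<delta>" "x \<in> log_region \<xi> c \<sigma> \<beta> \<gamma> \<delta>"
  shows "log_cutoff \<xi> c \<sigma> \<beta> \<gamma> \<delta> x = log_potential \<xi> c x"
    and "laplacian (log_cutoff \<xi> c \<sigma> \<beta> \<gamma> \<delta>) x = 0"
  using log_region_bisector[OF assms(1,2,4)] assms(3,4)
  by (auto simp: log_region_def intro!: log_cutoff_eq laplacian_log_cutoff)

section \<open>Geometry of the wedge and of the directions of reflection\<close>

text \<open>While a path stays in \<open>K\<close>, the compensator of such an \<open>f\<close>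
  stands still and the compensated process moves as \<open>w \<bullet> \<omega>\<close>.\<close>

definition locally_linear_test :: "real \<Rightarrow> real \<Rightarrow> real \<Rightarrow> (real^2) set \<Rightarrow> real^2 \<Rightarrow> bool" where
  "locally_linear_test \<xi> \<theta>1 \<theta>2 K w \<longleftrightarrow>
    (\<exists>f. test_fun \<xi> \<theta>1 \<theta>2 f \<and> (\<forall>x\<in>K. f x = w \<bullet> x \<and> laplacian f x = 0))"

lemma closed_ray_line:
  fixes e n :: "real^2"
  assumes "e \<bullet> e = 1" "e \<bullet> n = 0" "\<And>x. x = (e \<bullet> x) *\<^sub>R e + (n \<bullet> x) *\<^sub>R n"
  shows "closed (ray e)"
proof -
  have "ray e = {x. n \<bullet> x = 0 \<and> 0 \<le> e \<bullet> x}"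
  proof (intro set_eqI iffI)
    fix x assume "x \<in> {x. n \<bullet> x = 0 \<and> 0 \<le> e \<bullet> x}"
    then show "x \<in> ray e" using assms(3)[of x] by (auto simp: ray_def)
  qed (use assms in \<open>auto simp: ray_def inner_commute\<close>)
  then show ?thesis by (simp add: closed_Collect_conj closed_Collect_eq closed_Collect_le continuous_intros)
qed

lemma side_eq_ray: "side1 = ray (vector [1, 0])" "side2 \<xi> = ray (vector [cos \<xi>, sin \<xi>])"
proof -
  have "polar r \<theta> = r *\<^sub>R vector [cos \<theta>, sin \<theta>]" for r \<theta>
    by (simp add: vec_eq_iff forall_2 polar_nth)
  then show "side1 = ray (vector [1, 0])" "side2 \<xi> = ray (vector [cos \<xi>, sin \<xi>])"
    by (simp_all add: side1_def side2_def ray_def)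
qed

text \<open>\<open>Q\<close> is a switch: \<open>True\<close> at a point of a side, where only
  \<open>w\<close> with \<open>0 \<le> w \<bullet> v\<close> are admissible, and
  \<open>False\<close> off the sides, where every \<open>w\<close> is.\<close>

lemma locally_linear_test_cutoff_linear:
  assumes dual: "\<And>x. x = (a \<bullet> x) *\<^sub>R e + (b \<bullet> x) *\<^sub>R v" "a \<bullet> v = 0" "b \<bullet> v = 1"
    and F: "closed F" "x0 \<notin> F" "0 \<in> F"
    and s1: "side1 \<subseteq> F \<or> (refl1 \<theta>1 = v \<and> (\<forall>x\<in>side1. b \<bullet> x = 0) \<and> b \<bullet> x0 = 0 \<and> Q)"
    and s2: "side2 \<xi> \<subseteq> F \<or> (refl2 \<xi> \<theta>2 = v \<and> (\<forall>x\<in>side2 \<xi>. b \<bullet> x = 0) \<and> b \<bullet> x0 = 0 \<and> Q)"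
  shows "\<exists>K. closed K \<and> x0 \<in> interior K \<and>
    (\<forall>w. (Q \<longrightarrow> 0 \<le> w \<bullet> v) \<longrightarrow> locally_linear_test \<xi> \<theta>1 \<theta>2 K w)"
proof -
  obtain r where r: "0 < r" "box_around a b x0 (3 * r) \<inter> F = {}"
    using box_around_disjoint[OF dual(1) F(1,2)] by metis
  define K where "K = box_around a b x0 r"
  have "open {x. \<bar>a \<bullet> x - a \<bullet> x0\<bar> < r \<and> \<bar>b \<bullet> x - b \<bullet> x0\<bar> < r}"
    by (intro open_Collect_conj open_Collect_less continuous_intros)
  then have "x0 \<in> interior K"
    by (rule interiorI) (use r in \<open>auto simp: K_def box_around_def\<close>)
  moreover have "locally_linear_test \<xi> \<theta>1 \<theta>2 K w" if "Q \<longrightarrow> 0 \<le> w \<bullet> v" for w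
    unfolding locally_linear_test_def
  proof (intro exI conjI ballI)
    show "test_fun \<xi> \<theta>1 \<theta>2 (cutoff_linear a b x0 r w)"
      by (rule test_fun_cutoff_linear[OF dual r F(3)]) (use s1 s2 that in auto)
    show "cutoff_linear a b x0 r w x = w \<bullet> x" if "x \<in> K" for x
      using that r by (intro cutoff_linear_eq) (auto simp: K_def box_around_def)
    show "laplacian (cutoff_linear a b x0 r w) x = 0" if "x \<in> K" for x
      using that r by (intro laplacian_cutoff_linear) (auto simp: K_def)
  qed
  ultimately show ?thesis using closed_box_around K_def by blast
qed


lemma locally_linear_cover_side:
  fixes e n x0 :: "real^2"
  assumes en: "e \<bullet> e = 1" "e \<bullet> n = 0" "n \<bullet> n = 1" "\<And>x. x = (e \<bullet> x) *\<^sub>R e + (n \<bullet> x) *\<^sub>R n"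
    and F: "closed F" "x0 \<notin> F" "0 \<in> F" and x0: "n \<bullet> x0 = 0"
    and s1: "side1 \<subseteq> F \<or> (refl1 \<theta>1 = n - t *\<^sub>R e \<and> (\<forall>x\<in>side1. n \<bullet> x = 0))"
    and s2: "side2 \<xi> \<subseteq> F \<or> (refl2 \<xi> \<theta>2 = n - t *\<^sub>R e \<and> (\<forall>x\<in>side2 \<xi>. n \<bullet> x = 0))"
  shows "\<exists>K W. closed K \<and> x0 \<in> interior K \<and> finite W \<and> (\<forall>w\<in>W. locally_linear_test \<xi> \<theta>1 \<theta>2 K w) \<and>
    (\<forall>y. (\<forall>w\<in>W. 0 \<le> w \<bullet> y) \<longrightarrow> y \<in> ray (n - t *\<^sub>R e))"
proof -
  \<comment> \<open>\<open>a\<close> is orthogonal to \<open>v\<close>, so the half-planes given by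
    \<open>a\<close>, \<open>- a\<close> and \<open>n\<close> intersect exactly in the ray of
    \<open>v\<close>.\<close>
  define a where "a = e + t *\<^sub>R n"
  define v where "v = n - t *\<^sub>R e"
  have ne: "n \<bullet> e = 0" using en by (simp add: inner_commute)
  have dual: "x = (a \<bullet> x) *\<^sub>R e + (n \<bullet> x) *\<^sub>R v" for x
    using en(4)[of x] by (simp add: a_def v_def inner_add_left algebra_simps)
  have v: "a \<bullet> v = 0" "n \<bullet> v = 1"
    using en ne by (simp_all add: a_def v_def inner_add_left inner_diff_right)
  have "\<exists>K. closed K \<and> x0 \<in> interior K \<and>
      (\<forall>w. (True \<longrightarrow> 0 \<le> w \<bullet> v) \<longrightarrow> locally_linear_test \<xi> \<theta>1 \<theta>2 K w)"
    by (rule locally_linear_test_cutoff_linear[OF dual v F]) (use s1 s2 x0 in \<open>auto simp: v_def\<close>)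
  then obtain K where K: "closed K" "x0 \<in> interior K"
    "\<And>w. 0 \<le> w \<bullet> v \<Longrightarrow> locally_linear_test \<xi> \<theta>1 \<theta>2 K w"
    by auto
  have "y \<in> ray v" if "\<forall>w\<in>{a, - a, n}. 0 \<le> w \<bullet> y" for y
  proof -
    have "a \<bullet> y = 0" "0 \<le> n \<bullet> y" using that by auto
    then show ?thesis using dual[of y] by (auto simp: ray_def)
  qed
  then show ?thesis
    using K v unfolding v_def[symmetric] by (intro exI[of _ K] exI[of _ "{a, - a, n}"]) auto
qed

lemma closed_sides: "closed side1" "closed (side2 \<xi>)"
proof -
  show "closed side1" unfolding side_eq_ray
    by (rule closed_ray_line[of _ "vector [0, 1]"]) (auto simp: inner_vector2 vec_eq_iff forall_2)
  show "closed (side2 \<xi>)" unfolding side_eq_ray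
  proof (rule closed_ray_line[of _ "vector [sin \<xi>, - cos \<xi>]"])
    have 1: "(cos \<xi> * a + sin \<xi> * b) * cos \<xi> + (sin \<xi> * a - cos \<xi> * b) * sin \<xi> = ((sin \<xi>)\<^sup>2 + (cos \<xi>)\<^sup>2) * a"
      "(cos \<xi> * a + sin \<xi> * b) * sin \<xi> - (sin \<xi> * a - cos \<xi> * b) * cos \<xi> = ((sin \<xi>)\<^sup>2 + (cos \<xi>)\<^sup>2) * b" for a b
      by algebra+
    show "x = (vector [cos \<xi>, sin \<xi>] \<bullet> x) *\<^sub>R vector [cos \<xi>, sin \<xi>] +
        (vector [sin \<xi>, - cos \<xi>] \<bullet> x) *\<^sub>R vector [sin \<xi>, - cos \<xi>]" for x :: "real^2"
      using 1[of "x $ 1" "x $ 2"] by (auto simp: inner_vector2 vec_eq_iff forall_2)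
  qed (auto simp: inner_vector2 simp flip: power2_eq_square)
qed

lemma sides_disjoint:
  assumes "x \<in> side1" "x \<in> side2 \<xi>" "0 < \<xi>" "\<xi> < pi"
  shows "x = 0"
  using side1_angle[OF assms(1) _ assms(3,4)] side2_angle[OF assms(2) _ assms(3,4)] assms(3) by fastforce

lemma zero_in_sides: "0 \<in> side1" "0 \<in> side2 \<xi>"
  by (auto simp: side1_def side2_def intro!: exI[of _ 0] simp: zero_polar)

text \<open>Off the corner every cone of directions is an intersection of finitely many half-planes:
  three for a ray, four for the origin alone. Hence finitely many test functions detect whether an
  increment lies in it.\<close>

lemma locally_linear_cover:
  assumes \<xi>: "0 < \<xi>" "\<xi> < pi" and x0: "x0 \<noteq> 0"
  shows "\<exists>K W. closed K \<and> x0 \<in> interior K \<and> finite W \<and> (\<forall>w\<in>W. locally_linear_test \<xi> \<theta>1 \<theta>2 K w) \<and>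
    (\<forall>y. (\<forall>w\<in>W. 0 \<le> w \<bullet> y) \<longrightarrow> y \<in> refl_cone \<xi> \<theta>1 \<theta>2 V x0)"
proof -
  consider "x0 \<in> side1" | "x0 \<notin> side1" "x0 \<in> side2 \<xi>" | "x0 \<notin> side1" "x0 \<notin> side2 \<xi>" by blast
  then show ?thesis
  proof cases
    case 1
    let ?e = "vector [1, 0] :: real^2" and ?n = "vector [0, 1] :: real^2"
    have dec: "x = (?e \<bullet> x) *\<^sub>R ?e + (?n \<bullet> x) *\<^sub>R ?n" for x
      by (simp add: inner_vector2 vec_eq_iff forall_2)
    have en: "?e \<bullet> ?e = 1" "?e \<bullet> ?n = 0" "?n \<bullet> ?n = 1"
      by (simp_all add: inner_vector2)
    have v: "refl1 \<theta>1 = ?n - tan \<theta>1 *\<^sub>R ?e"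
      by (simp add: refl1_def vec_eq_iff forall_2)
    have n0: "?n \<bullet> x = 0" if "x \<in> side1" for x
      using that by (auto simp: side1_def inner_vector2 polar_nth)
    have rc: "refl_cone \<xi> \<theta>1 \<theta>2 V x0 = ray (refl1 \<theta>1)" using 1 x0 by (simp add: refl_cone_def)
    have "x0 \<notin> side2 \<xi>" using 1 x0 sides_disjoint \<xi> by blast
    then show ?thesis unfolding rc v
      by (intro locally_linear_cover_side[OF en dec, of "side2 \<xi>"])
        (use 1 closed_sides zero_in_sides n0 v in auto)
  next
    case 2
    let ?e = "vector [cos \<xi>, sin \<xi>] :: real^2" and ?n = "vector [sin \<xi>, - cos \<xi>] :: real^2"
    have 1: "(cos \<xi> * a + sin \<xi> * b) * cos \<xi> + (sin \<xi> * a - cos \<xi> * b) * sin \<xi> = ((sin \<xi>)\<^sup>2 + (cos \<xi>)\<^sup>2) * a"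
      "(cos \<xi> * a + sin \<xi> * b) * sin \<xi> - (sin \<xi> * a - cos \<xi> * b) * cos \<xi> = ((sin \<xi>)\<^sup>2 + (cos \<xi>)\<^sup>2) * b" for a b
      by algebra+
    have dec: "x = (?e \<bullet> x) *\<^sub>R ?e + (?n \<bullet> x) *\<^sub>R ?n" for x
      using 1[of "x $ 1" "x $ 2"] by (auto simp: inner_vector2 vec_eq_iff forall_2)
    have en: "?e \<bullet> ?e = 1" "?e \<bullet> ?n = 0" "?n \<bullet> ?n = 1"
      by (auto simp: inner_vector2 simp flip: power2_eq_square)
    have v: "refl2 \<xi> \<theta>2 = ?n - tan \<theta>2 *\<^sub>R ?e"
      by (simp add: refl2_def vec_eq_iff forall_2)
    have n0: "?n \<bullet> x = 0" if "x \<in> side2 \<xi>" for x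
      using that by (auto simp: side2_def inner_vector2 polar_nth)
    have rc: "refl_cone \<xi> \<theta>1 \<theta>2 V x0 = ray (refl2 \<xi> \<theta>2)" using 2 x0 by (simp add: refl_cone_def)
    show ?thesis unfolding rc v
      by (rule locally_linear_cover_side[OF en dec, of side1])
        (use 2 closed_sides zero_in_sides n0 v in auto)
  next
    case 3
    have dual: "x = (axis 1 1 \<bullet> x) *\<^sub>R axis 1 1 + (axis 2 1 \<bullet> x) *\<^sub>R axis 2 1" for x :: "real^2"
      by (simp add: inner_real2 axis_def vec_eq_iff forall_2)
    have "\<exists>K. closed K \<and> x0 \<in> interior K \<and>
        (\<forall>w. (False \<longrightarrow> 0 \<le> w \<bullet> axis 2 (1::real)) \<longrightarrow> locally_linear_test \<xi> \<theta>1 \<theta>2 K w)"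
      by (rule locally_linear_test_cutoff_linear[OF dual, of "side1 \<union> side2 \<xi>"])
        (use 3 closed_sides zero_in_sides in \<open>auto simp: inner_real2 axis_def\<close>)
    then obtain K where K: "closed K" "x0 \<in> interior K" "\<And>w. locally_linear_test \<xi> \<theta>1 \<theta>2 K w"
      by auto
    have "y = 0" if "\<forall>w\<in>{axis 1 1, - axis 1 1, axis 2 1, - axis 2 1}. 0 \<le> w \<bullet> y" for y :: "real^2"
      using that dual[of y] by (auto simp: inner_real2 axis_def)
    moreover have "refl_cone \<xi> \<theta>1 \<theta>2 V x0 = {0}" using 3 x0 by (simp add: refl_cone_def)
    ultimately show ?thesis
      using K by (intro exI[of _ K] exI[of _ "{axis 1 1, - axis 1 1, axis 2 1, - axis 2 1}"]) auto
  qed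
qed

text \<open>
  Cramer's rule writes \<open>- x\<close> as a nonnegative combination of the two directions of reflection, the
  determinant being a positive multiple of \<open>sin (\<theta>1 + \<theta>2 - \<xi>)\<close>.
\<close>

lemma inner_wedge_nonpos:
  assumes \<xi>: "0 < \<xi>" "\<xi> < \<theta>1 + \<theta>2" and \<theta>: "- pi/2 < \<theta>1" "\<theta>1 < pi/2" "- pi/2 < \<theta>2" "\<theta>2 < pi/2"
    and w: "0 \<le> w \<bullet> refl1 \<theta>1" "0 \<le> w \<bullet> refl2 \<xi> \<theta>2" and x: "x \<in> wedge \<xi>"
  shows "w \<bullet> x \<le> 0"
proof -
  obtain r \<theta> where r: "x = polar r \<theta>" "0 \<le> r" "0 \<le> \<theta>" "\<theta> \<le> \<xi>"
    using x by (auto simp: wedge_def)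
  have c: "0 < cos \<theta>1" "0 < cos \<theta>2" using \<theta> by (auto intro!: cos_gt_zero_pi)
  define D where "D = sin (\<theta>1 + \<theta>2 - \<xi>)"
  have D: "0 < D" unfolding D_def using \<xi> \<theta> by (intro sin_gt_zero) auto
  define p where "p = cos \<theta>1 * cos (\<xi> - \<theta> - \<theta>2)"
  define q where "q = cos \<theta>2 * cos (\<theta> - \<theta>1)"
  \<comment> \<open>Both cosines are nonnegative since
    \<open>\<xi> - \<theta>2 < \<theta>1 < pi/2\<close> and
    \<open>\<xi> - \<theta>1 < \<theta>2 < pi/2\<close>.\<close>
  have p: "0 \<le> p" unfolding p_def using r \<xi> \<theta> c by (intro mult_nonneg_nonneg cos_ge_zero) auto
  have q: "0 \<le> q" unfolding q_def using r \<xi> \<theta> c by (intro mult_nonneg_nonneg cos_ge_zero) auto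
  have E: "p *\<^sub>R refl1 \<theta>1 + q *\<^sub>R refl2 \<xi> \<theta>2 = - D *\<^sub>R vector [cos \<theta>, sin \<theta>]"
  proof -
    \<comment> \<open>With this angle, \<open>cos \<theta>2\<close> times the second direction of
      reflection is \<open>(sin A, - cos A)\<close>, and the identity reduces to addition
      formulas.\<close>
    define A where "A = \<xi> - \<theta>2"
    have t1: "cos \<theta>1 * tan \<theta>1 = sin \<theta>1" and t2: "cos \<theta>2 * tan \<theta>2 = sin \<theta>2"
      using c by (simp_all add: tan_def)
    have DA: "- D = sin (A - \<theta>1)"
      unfolding D_def A_def sin_minus[symmetric] by (simp add: algebra_simps)
    have pA: "p = cos \<theta>1 * cos (A - \<theta>)" by (simp add: p_def A_def algebra_simps)
    have "p * - tan \<theta>1 + q * (sin \<xi> - tan \<theta>2 * cos \<xi>) =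
        - ((cos \<theta>1 * tan \<theta>1) * cos (A - \<theta>)) +
        cos (\<theta> - \<theta>1) * (cos \<theta>2 * sin \<xi> - (cos \<theta>2 * tan \<theta>2) * cos \<xi>)"
      by (simp add: pA q_def algebra_simps)
    also have "\<dots> = - (sin \<theta>1 * cos (A - \<theta>)) + cos (\<theta> - \<theta>1) * sin A"
      unfolding t1 t2 by (simp add: A_def sin_diff algebra_simps)
    also have "\<dots> = - D * cos \<theta>"
      unfolding DA cos_diff sin_diff by (simp add: algebra_simps)
    finally have "p * - tan \<theta>1 + q * (sin \<xi> - tan \<theta>2 * cos \<xi>) = - D * cos \<theta>" .
    moreover have "p * 1 + q * (- cos \<xi> - tan \<theta>2 * sin \<xi>) =
        cos \<theta>1 * cos (A - \<theta>) - cos (\<theta> - \<theta>1) * (cos \<theta>2 * cos \<xi> + (cos \<theta>2 * tan \<theta>2) * sin \<xi>)"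
      by (simp add: pA q_def algebra_simps)
    then have "p * 1 + q * (- cos \<xi> - tan \<theta>2 * sin \<xi>) =
        cos \<theta>1 * cos (A - \<theta>) - cos (\<theta> - \<theta>1) * cos A"
      unfolding t2 by (simp add: A_def cos_diff algebra_simps)
    then have "p * 1 + q * (- cos \<xi> - tan \<theta>2 * sin \<xi>) = - D * sin \<theta>"
      unfolding DA cos_diff sin_diff by (simp add: algebra_simps)
    ultimately show ?thesis
      by (simp add: refl1_def refl2_def vec_eq_iff forall_2)
  qed
  have "0 \<le> p * (w \<bullet> refl1 \<theta>1) + q * (w \<bullet> refl2 \<xi> \<theta>2)"
    using p q w by (intro add_nonneg_nonneg mult_nonneg_nonneg)
  also have "\<dots> = w \<bullet> (p *\<^sub>R refl1 \<theta>1 + q *\<^sub>R refl2 \<xi> \<theta>2)" by (simp add: inner_add_right)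
  also have "\<dots> = - D * (w \<bullet> vector [cos \<theta>, sin \<theta>])" unfolding E by simp
  finally have "w \<bullet> vector [cos \<theta>, sin \<theta>] \<le> 0" using D by (simp add: mult_le_0_iff)
  moreover have "x = r *\<^sub>R vector [cos \<theta>, sin \<theta>]"
    by (simp add: r vec_eq_iff forall_2 polar_nth)
  ultimately show ?thesis using r(2) by (simp add: mult_nonneg_nonpos)
qed


section \<open>Probabilistic preliminaries\<close>

text \<open>Second-order Taylor bound for the square of the negative part, whose derivative
  \<open>2 * min x 0\<close> is Lipschitz with constant 2. It plays the part of Ito's formula in the
  discrete setting.\<close>

lemma min_zero_square_add:
  "(min (x + u) 0)\<^sup>2 \<le> (min x 0)\<^sup>2 + 2 * (min x 0 * u) + (u::real)\<^sup>2"
proof (cases "x \<le> 0")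
  case True
  have "(min (x + u) 0)\<^sup>2 \<le> (x + u)\<^sup>2" by (simp add: min_def)
  then show ?thesis using True by (simp add: power2_sum)
next
  case False
  then have "\<bar>min (x + u) 0\<bar> \<le> \<bar>u\<bar>" by (auto simp: min_def)
  then have "(min (x + u) 0)\<^sup>2 \<le> u\<^sup>2" by (rule abs_le_square_iff[THEN iffD1])
  then show ?thesis using False by simp
qed

lemma integrable_mult_of_squares:
  fixes f g :: "'a \<Rightarrow> real"
  assumes [measurable]: "f \<in> borel_measurable M" "g \<in> borel_measurable M"
    and "integrable M (\<lambda>x. (f x)\<^sup>2)" "integrable M (\<lambda>x. (g x)\<^sup>2)"
  shows "integrable M (\<lambda>x. f x * g x)"
proof (rule Bochner_Integration.integrable_bound)
  show "integrable M (\<lambda>x. (f x)\<^sup>2 + (g x)\<^sup>2)" using assms by simp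
  have "\<bar>a * b\<bar> \<le> a\<^sup>2 + b\<^sup>2" for a b :: real
  proof -
    have "2 * (\<bar>a\<bar> * \<bar>b\<bar>) \<le> a\<^sup>2 + b\<^sup>2" "0 \<le> \<bar>a\<bar> * \<bar>b\<bar>"
      using sum_squares_bound[of "\<bar>a\<bar>" "\<bar>b\<bar>"] by simp_all
    then show ?thesis unfolding abs_mult by linarith
  qed
  then show "AE x in M. norm (f x * g x) \<le> norm ((f x)\<^sup>2 + (g x)\<^sup>2)" by simp
qed simp

lemma integrable_square_add:
  fixes f g :: "'a \<Rightarrow> real"
  assumes [measurable]: "f \<in> borel_measurable M" "g \<in> borel_measurable M"
    and "integrable M (\<lambda>x. (f x)\<^sup>2)" "integrable M (\<lambda>x. (g x)\<^sup>2)"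
  shows "integrable M (\<lambda>x. (f x + g x)\<^sup>2)"
  using assms integrable_mult_of_squares[OF assms] by (simp add: power2_sum mult.assoc)

lemma integrable_square_sum:
  fixes f :: "nat \<Rightarrow> 'a \<Rightarrow> real"
  assumes "\<And>i. i < m \<Longrightarrow> f i \<in> borel_measurable M" "\<And>i. i < m \<Longrightarrow> integrable M (\<lambda>x. (f i x)\<^sup>2)"
  shows "integrable M (\<lambda>x. (\<Sum>i<m. f i x)\<^sup>2)"
  using assms
proof (induction m)
  case (Suc m)
  then show ?case
    by (simp, intro integrable_square_add borel_measurable_sum) auto
qed simp

lemma (in finite_measure) integrable_of_square:
  fixes f :: "'a \<Rightarrow> real"
  assumes "f \<in> borel_measurable M" "integrable M (\<lambda>x. (f x)\<^sup>2)"
  shows "integrable M f"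
  using integrable_mult_of_squares[of "\<lambda>_. 1" M f] assms by simp

text \<open>The cross terms produced by \<open>min_zero_square_add\<close> have nonpositive
  expectation, so only the squares of the increments survive. In the application the weight is
  nonpositive and the increments have nonnegative drift.\<close>

lemma negative_part_estimate:
  fixes W :: "nat \<Rightarrow> 'a \<Rightarrow> real"
  assumes W: "\<And>i. i < m \<Longrightarrow> W i \<in> borel_measurable M" "\<And>i. i < m \<Longrightarrow> integrable M (\<lambda>x. (W i x)\<^sup>2)"
    and drift: "\<And>k. k < m \<Longrightarrow> (\<integral>x. min (\<Sum>i<k. W i x) 0 * W k x \<partial>M) \<le> 0"
  shows "integrable M (\<lambda>x. (min (\<Sum>i<m. W i x) 0)\<^sup>2)"
    and "(\<integral>x. (min (\<Sum>i<m. W i x) 0)\<^sup>2 \<partial>M) \<le> (\<Sum>i<m. \<integral>x. (W i x)\<^sup>2 \<partial>M)"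
proof -
  have meas: "(\<lambda>x. \<Sum>i<k. W i x) \<in> borel_measurable M" if "k \<le> m" for k
    using W(1) that by (intro borel_measurable_sum) auto
  have int: "integrable M (\<lambda>x. (min (\<Sum>i<k. W i x) 0)\<^sup>2)" if "k \<le> m" for k
  proof (rule Bochner_Integration.integrable_bound)
    show "integrable M (\<lambda>x. (\<Sum>i<k. W i x)\<^sup>2)"
      using W that by (intro integrable_square_sum) auto
    show "(\<lambda>x. (min (\<Sum>i<k. W i x) 0)\<^sup>2) \<in> borel_measurable M"
      using meas[OF that] by measurable
    show "AE x in M. norm ((min (\<Sum>i<k. W i x) 0)\<^sup>2) \<le> norm ((\<Sum>i<k. W i x)\<^sup>2)"
      by (auto simp: min_def)
  qed
  then show "integrable M (\<lambda>x. (min (\<Sum>i<m. W i x) 0)\<^sup>2)" by simp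
  have "(\<integral>x. (min (\<Sum>i<k. W i x) 0)\<^sup>2 \<partial>M) \<le> (\<Sum>i<k. \<integral>x. (W i x)\<^sup>2 \<partial>M)" if "k \<le> m" for k
    using that
  proof (induction k)
    case (Suc k)
    let ?S = "\<lambda>x. min (\<Sum>i<k. W i x) 0"
    have k: "k < m" "k \<le> m" using Suc by auto
    have SW: "integrable M (\<lambda>x. ?S x * W k x)"
      using meas[OF k(2)] W[OF k(1)] int[OF k(2)] by (intro integrable_mult_of_squares) auto
    have "(\<integral>x. (min (\<Sum>i<Suc k. W i x) 0)\<^sup>2 \<partial>M) \<le> (\<integral>x. (?S x)\<^sup>2 + 2 * (?S x * W k x) + (W k x)\<^sup>2 \<partial>M)"
      using int[of "Suc k"] int[OF k(2)] Suc.prems SW W[OF k(1)]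
      by (intro integral_mono) (auto intro!: min_zero_square_add)
    also have "\<dots> = (\<integral>x. (?S x)\<^sup>2 \<partial>M) + 2 * (\<integral>x. ?S x * W k x \<partial>M) + (\<integral>x. (W k x)\<^sup>2 \<partial>M)"
      using int[OF k(2)] SW W[OF k(1)] by simp
    finally show ?case using Suc.IH[OF k(2)] drift[OF k(1)] by simp
  qed simp
  then show "(\<integral>x. (min (\<Sum>i<m. W i x) 0)\<^sup>2 \<partial>M) \<le> (\<Sum>i<m. \<integral>x. (W i x)\<^sup>2 \<partial>M)" by simp
qed

lemma (in prob_space) prob_tendsto_0_of_AE:
  assumes [measurable]: "\<And>n. A n \<in> events" and "AE x in M. \<forall>\<^sub>F n in sequentially. x \<notin> A n"
  shows "(\<lambda>n. prob (A n)) \<longlonglongrightarrow> 0"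
proof -
  have "(\<lambda>n. \<integral>x. indicator (A n) x \<partial>M) \<longlonglongrightarrow> (\<integral>x. (0::real) \<partial>M)"
  proof (rule integral_dominated_convergence[where w = "\<lambda>_. 1"])
    have "(\<lambda>n. indicator (A n) x :: real) \<longlonglongrightarrow> 0" if "\<forall>\<^sub>F n in sequentially. x \<notin> A n" for x
      by (rule tendsto_eventually, rule eventually_mono[OF that]) simp
    then show "AE x in M. (\<lambda>n. indicator (A n) x :: real) \<longlonglongrightarrow> 0"
      by (rule eventually_mono[OF assms(2)])
    show "AE x in M. norm (indicator (A n) x :: real) \<le> 1" for n
      by (intro AE_I2) (simp add: indicator_def)
  qed simp_all
  then show ?thesis by simp
qed

text \<open>Fatou's lemma for events. The result is a covering event, so that it also serves for
  sets of paths whose measurability is not established.\<close>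

lemma (in prob_space) prob_liminf_le:
  assumes [measurable]: "\<And>n. A n \<in> events" and "\<And>n. n0 \<le> n \<Longrightarrow> prob (A n) \<le> c"
  shows "\<exists>L\<in>events. prob L \<le> c \<and> (\<forall>x\<in>space M. (\<forall>\<^sub>F n in sequentially. x \<in> A n) \<longrightarrow> x \<in> L)"
proof -
  define B where "B k = {x\<in>space M. \<forall>n\<ge>k. x \<in> A n}" for k
  have [measurable]: "B k \<in> events" for k unfolding B_def by measurable
  have "incseq B" by (force simp: incseq_def B_def)
  then have "(\<lambda>k. prob (B k)) \<longlonglongrightarrow> prob (\<Union>k. B k)"
    by (intro finite_Lim_measure_incseq) auto
  moreover have "prob (B k) \<le> c" for k
  proof -
    have "prob (B k) \<le> prob (A (max k n0))"
      by (intro finite_measure_mono) (auto simp: B_def)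
    also have "\<dots> \<le> c" using assms(2) by simp
    finally show ?thesis .
  qed
  ultimately have "prob (\<Union>k. B k) \<le> c" by (intro LIMSEQ_le_const2) auto
  moreover have "(\<Union>k. B k) \<in> events" by measurable
  ultimately show ?thesis
    by (intro bexI[of _ "\<Union>k. B k"]) (auto simp: B_def eventually_sequentially)
qed

text \<open>\<open>Q\<close> is not assumed measurable; covering events of probability at most
  \<open>1 / Suc n\<close> intersect in a null set that still covers it.\<close>

lemma (in prob_space) AE_not_of_small_sets:
  assumes "\<And>\<epsilon>::real. 0 < \<epsilon> \<Longrightarrow> \<exists>L\<in>events. prob L \<le> \<epsilon> \<and> (\<forall>x\<in>space M. Q x \<longrightarrow> x \<in> L)"
  shows "AE x in M. \<not> Q x"
proof -
  have "\<forall>n. \<exists>L. L \<in> events \<and> prob L \<le> 1 / Suc n \<and> (\<forall>x\<in>space M. Q x \<longrightarrow> x \<in> L)"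
    using assms by (metis zero_less_divide_1_iff of_nat_0_less_iff zero_less_Suc)
  then obtain L where L: "\<And>n. L n \<in> events" "\<And>n. prob (L n) \<le> 1 / Suc n"
    "\<And>n x. x \<in> space M \<Longrightarrow> Q x \<Longrightarrow> x \<in> L n" by metis
  have ev: "(\<Inter>n. L n) \<in> events" using L(1) by auto
  have "prob (\<Inter>n. L n) \<le> 1 / Suc n" for n
    using finite_measure_mono[of "\<Inter>n. L n" "L n"] L(1,2)[of n] by fastforce
  then have "prob (\<Inter>n. L n) \<le> 0"
    by (intro LIMSEQ_le_const[OF LIMSEQ_inverse_real_of_nat]) (auto simp: inverse_eq_divide)
  then have "prob (\<Inter>n. L n) = 0" by (simp add: measure_le_0_iff)
  then have "(\<Inter>n. L n) \<in> null_sets M" using ev by (simp add: emeasure_eq_measure null_sets_def)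
  then show ?thesis
    by (rule AE_I') (use L(3) in auto)
qed

lemma prod_Basis_vec:
  fixes x :: "real^'n"
  shows "(\<Prod>b\<in>Basis. g b (x \<bullet> b)) = (\<Prod>i\<in>UNIV. g (axis i 1) (x $ i))"
proof -
  have B: "(Basis :: (real^'n) set) = range (\<lambda>i. axis i 1)" by (auto simp: Basis_vec_def)
  show ?thesis unfolding B
    by (subst prod.reindex) (auto simp: inj_on_def axis_eq_axis inner_axis)
qed

lemma distributed_component:
  fixes D :: "'a \<Rightarrow> real^'n"
  assumes D: "distributed M lborel D (\<lambda>x. ennreal (\<Prod>i\<in>UNIV. normal_density 0 \<sigma> (x $ i)))" and \<sigma>: "0 < \<sigma>"
  shows "distributed M lborel (\<lambda>\<omega>. D \<omega> $ k) (normal_density 0 \<sigma>)"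
  unfolding distributed_def
proof (intro conjI)
  have [measurable]: "D \<in> borel_measurable M" using distributed_measurable[OF D] by simp
  have "(\<lambda>x::real^'n. x $ k) \<in> borel_measurable borel"
    by (intro borel_measurable_continuous_onI continuous_intros)
  note [measurable] = this
  show m: "(\<lambda>\<omega>. D \<omega> $ k) \<in> measurable M lborel" by simp
  show "(\<lambda>x. ennreal (normal_density 0 \<sigma> x)) \<in> borel_measurable lborel" by simp
  show "distr M lborel (\<lambda>\<omega>. D \<omega> $ k) = density lborel (\<lambda>x. ennreal (normal_density 0 \<sigma> x))"
  proof (rule measure_eqI)
    fix A assume "A \<in> sets (distr M lborel (\<lambda>\<omega>. D \<omega> $ k))"
    then have A[measurable]: "A \<in> sets borel" by simp
    \<comment> \<open>Each coordinate gets its own factor and only the \<open>k\<close>-th carries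
      the indicator, so the integral factorises and the other factors integrate to one.\<close>
    define g :: "real^'n \<Rightarrow> real \<Rightarrow> ennreal" where
      "g b t = ennreal (normal_density 0 \<sigma> t) * (if b = axis k 1 then indicator A t else 1)" for b t
    have [measurable]: "g b \<in> borel_measurable borel" for b unfolding g_def by simp
    have one: "(\<integral>\<^sup>+t. ennreal (normal_density 0 \<sigma> t) \<partial>lborel) = 1"
      using nn_integral_eq_integral[OF integrable_normal_density[OF \<sigma>, of 0]] integral_normal_density[OF \<sigma>, of 0]
      by simp
    have "emeasure (distr M lborel (\<lambda>\<omega>. D \<omega> $ k)) A = (\<integral>\<^sup>+\<omega>. indicator A (D \<omega> $ k) \<partial>M)"
      by (subst emeasure_distr[OF m]) (auto simp: nn_integral_indicator[symmetric] simp del: nn_integral_indicator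
          intro!: nn_integral_cong split: split_indicator)
    also have "\<dots> = (\<integral>\<^sup>+x. ennreal (\<Prod>i\<in>UNIV. normal_density 0 \<sigma> (x $ i)) * indicator A (x $ k) \<partial>lborel)"
      by (rule distributed_nn_integral[OF D, symmetric]) simp
    also have "\<dots> = (\<integral>\<^sup>+x. (\<Prod>b\<in>Basis. g b (x \<bullet> b)) \<partial>lborel)"
    proof (rule nn_integral_cong)
      fix x :: "real^'n"
      have "(\<Prod>b\<in>Basis. g b (x \<bullet> b)) =
          (\<Prod>i\<in>UNIV. ennreal (normal_density 0 \<sigma> (x $ i))) * (\<Prod>i\<in>UNIV. if i = k then indicator A (x $ i) else 1)"
        unfolding prod_Basis_vec[of g x] unfolding g_def prod.distrib by (simp add: axis_eq_axis)
      also have "(\<Prod>i\<in>UNIV. if i = k then indicator A (x $ i) else 1) = (indicator A (x $ k) :: ennreal)"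
        by simp
      finally show "ennreal (\<Prod>i\<in>UNIV. normal_density 0 \<sigma> (x $ i)) * indicator A (x $ k) = (\<Prod>b\<in>Basis. g b (x \<bullet> b))"
        by (simp add: prod_ennreal)
    qed
    also have "\<dots> = (\<Prod>b\<in>Basis. \<integral>\<^sup>+t. g b t \<partial>lborel)"
      by (rule nn_integral_lborel_prod) auto
    also have "\<dots> = (\<integral>\<^sup>+t. g (axis k 1) t \<partial>lborel) * (\<Prod>b\<in>Basis - {axis k 1}. \<integral>\<^sup>+t. g b t \<partial>lborel)"
      by (rule prod.remove) (auto simp: Basis_vec_def)
    also have "(\<Prod>b\<in>Basis - {axis k 1}. \<integral>\<^sup>+t. g b t \<partial>lborel) = 1"
      by (rule prod.neutral) (auto simp: g_def one)
    also have "(\<integral>\<^sup>+t. g (axis k 1) t \<partial>lborel) * 1 = emeasure (density lborel (\<lambda>x. ennreal (normal_density 0 \<sigma> x))) A"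
      by (simp add: g_def emeasure_density)
    finally show "emeasure (distr M lborel (\<lambda>\<omega>. D \<omega> $ k)) A = emeasure (density lborel (\<lambda>x. ennreal (normal_density 0 \<sigma> x))) A" .
  qed simp
qed

lemma normal_moments:
  fixes B :: "'a \<Rightarrow> real"
  assumes B: "distributed M lborel B (normal_density 0 \<sigma>)" and \<sigma>: "0 < \<sigma>"
  shows "integrable M B" "(\<integral>\<omega>. B \<omega> \<partial>M) = 0" "integrable M (\<lambda>\<omega>. (B \<omega>)^2)"
    "integrable M (\<lambda>\<omega>. (B \<omega>)^4)" "(\<integral>\<omega>. (B \<omega>)^4 \<partial>M) = 3 * \<sigma>^4"
proof -
  have nn: "\<And>x. 0 \<le> normal_density 0 \<sigma> x" by simp
  have int: "integrable M (\<lambda>\<omega>. (B \<omega>)^k)" for k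
    using distributed_integrable[OF B, of "\<lambda>x. x^k"] integrable_normal_moment[OF \<sigma>, of 0 k] by simp
  from int[of 1] int[of 2] int[of 4]
  show "integrable M B" "integrable M (\<lambda>\<omega>. (B \<omega>)^2)" "integrable M (\<lambda>\<omega>. (B \<omega>)^4)" by simp_all
  show "(\<integral>\<omega>. B \<omega> \<partial>M) = 0"
    using distributed_integral[OF B, of "\<lambda>x. x"] integral_normal_moment_nz_1[OF \<sigma>, of 0] by simp
  show "(\<integral>\<omega>. (B \<omega>)^4 \<partial>M) = 3 * \<sigma>^4"
    using distributed_integral[OF B, of "\<lambda>x. x^4"] integral_normal_moment_even[OF \<sigma>, of 0 2] \<sigma>
    by (simp add: fact_numeral power_divide power_mult[symmetric] field_simps)
qed

text \<open>The constant 8 comes from applying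
  \<open>(x + y)\<^sup>2 \<le> 2 * x\<^sup>2 + 2 * y\<^sup>2\<close> twice.\<close>

lemma inner_power4_le: "(w \<bullet> (b::real^2))^4 \<le> 8 * (w $ 1)^4 * (b $ 1)^4 + 8 * (w $ 2)^4 * (b $ 2)^4"
proof -
  have s: "(x + y)\<^sup>2 \<le> 2 * x\<^sup>2 + 2 * (y::real)\<^sup>2" for x y
    using sum_squares_bound[of x y] by (simp add: power2_sum)
  have "(x + y)^4 \<le> 8 * x^4 + 8 * y^4" for x y :: real
  proof -
    have "(x + y)^4 = ((x + y)\<^sup>2)\<^sup>2" by simp
    also have "\<dots> \<le> (2 * x\<^sup>2 + 2 * y\<^sup>2)\<^sup>2" using s by (intro power_mono) auto
    also have "\<dots> \<le> 2 * (2 * x\<^sup>2)\<^sup>2 + 2 * (2 * y\<^sup>2)\<^sup>2" by (rule s)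
    finally show ?thesis by (simp add: power_mult_distrib)
  qed
  from this[of "w $ 1 * b $ 1" "w $ 2 * b $ 2"] show ?thesis
    by (simp add: inner_real2 power_mult_distrib mult.assoc)
qed

text \<open>Passes from independent sigma-algebras to a product of expectations; with
  \<open>g\<close> linear it shows that Brownian increments have no drift under a weight known at
  the earlier time.\<close>

lemma (in prob_space) indep_integral_mult_zero:
  fixes H B :: "'a \<Rightarrow> real"
  assumes indep: "indep_set (sets F) (sets (vimage_algebra (space M) D borel))" and F: "subalgebra M F"
    and H: "H \<in> borel_measurable F" "integrable M H"
    and g: "g \<in> borel_measurable borel" "integrable M (\<lambda>\<omega>. g (D \<omega>))" "(\<integral>\<omega>. g (D \<omega>) \<partial>M) = 0"
  shows "integrable M (\<lambda>\<omega>. H \<omega> * g (D \<omega>))" "(\<integral>\<omega>. H \<omega> * g (D \<omega>) \<partial>M) = (0::real)"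
proof -
  have [measurable]: "H \<in> borel_measurable M" using measurable_from_subalg[OF F H(1)] .
  have gm: "(\<lambda>\<omega>. g (D \<omega>)) \<in> borel_measurable M" using g(2) by auto
  have spF: "space F = space M" using F by (simp add: subalgebra_def)
  have "indep_var borel H borel (\<lambda>\<omega>. g (D \<omega>))"
    unfolding indep_var_eq
  proof (intro conjI)
    show "H \<in> borel_measurable M" "(\<lambda>\<omega>. g (D \<omega>)) \<in> borel_measurable M" using gm by auto
    show "indep_set (sigma_sets (space M) {H -` A \<inter> space M |A. A \<in> sets borel})
      (sigma_sets (space M) {(\<lambda>\<omega>. g (D \<omega>)) -` A \<inter> space M |A. A \<in> sets borel})"
      unfolding indep_set_def
    proof (rule indep_sets_mono_sets[OF indep[unfolded indep_set_def]])
      have "{H -` A \<inter> space M |A. A \<in> sets borel} \<subseteq> sets F"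
        using measurable_sets[OF H(1)] spF by auto
      then have 1: "sigma_sets (space M) {H -` A \<inter> space M |A. A \<in> sets borel} \<subseteq> sets F"
        using sets.sigma_sets_subset[of _ F] spF by auto
      have "{(\<lambda>\<omega>. g (D \<omega>)) -` A \<inter> space M |A. A \<in> sets borel} \<subseteq> sets (vimage_algebra (space M) D borel)"
      proof safe
        fix A :: "real set" assume "A \<in> sets borel"
        then have "g -` A \<in> sets borel" using measurable_sets[OF g(1)] by simp
        then have "D -` (g -` A) \<inter> space M \<in> sets (vimage_algebra (space M) D borel)"
          by (rule in_vimage_algebra)
        then show "(\<lambda>\<omega>. g (D \<omega>)) -` A \<inter> space M \<in> sets (vimage_algebra (space M) D borel)"
          by (simp add: vimage_def)
      qed
      then have 2: "sigma_sets (space M) {(\<lambda>\<omega>. g (D \<omega>)) -` A \<inter> space M |A. A \<in> sets borel} \<subseteq>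
          sets (vimage_algebra (space M) D borel)"
        using sets.sigma_sets_subset[of _ "vimage_algebra (space M) D borel"] by auto
      show "case_bool (sigma_sets (space M) {H -` A \<inter> space M |A. A \<in> sets borel})
         (sigma_sets (space M) {(\<lambda>\<omega>. g (D \<omega>)) -` A \<inter> space M |A. A \<in> sets borel}) i
         \<subseteq> case_bool (sets F) (sets (vimage_algebra (space M) D borel)) i" for i
        using 1 2 by (cases i) auto
    qed
  qed
  from indep_var_integrable[OF this H(2) g(2)] indep_var_lebesgue_integral[OF this H(2) g(2)] g(3)
  show "integrable M (\<lambda>\<omega>. H \<omega> * g (D \<omega>))" "(\<integral>\<omega>. H \<omega> * g (D \<omega>) \<partial>M) = 0" by simp_all
qed


section \<open>Discretised martingale arguments\<close>

definition compensated :: "(real^2 \<Rightarrow> real) \<Rightarrow> real \<Rightarrow> path \<Rightarrow> real" where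
  "compensated f t \<omega> = f (\<omega> t) - 1/2 * integral {0..t} (\<lambda>s. laplacian f (\<omega> s))"

lemma test_fun_continuous:
  assumes "test_fun \<xi> \<theta>1 \<theta>2 f"
  shows "continuous_on (wedge \<xi>) f" "continuous_on (wedge \<xi>) (laplacian f)"
    "\<exists>C\<ge>0. \<forall>x\<in>wedge \<xi>. \<bar>f x\<bar> \<le> C \<and> \<bar>laplacian f x\<bar> \<le> C"
proof -
  from assms obtain U where U: "wedge \<xi> \<subseteq> U" "C2_on f U"
    and b: "bounded (f ` wedge \<xi>)" "\<And>i j. bounded (partial_deriv j (partial_deriv i f) ` wedge \<xi>)"
    by (auto simp: test_fun_def Cb2_def)
  show "continuous_on (wedge \<xi>) f"
    using C1_on_continuous[OF C2_on_imp_C1_on[OF U(2)]] U(1) continuous_on_subset by blast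
  have "continuous_on (wedge \<xi>) (\<lambda>x. \<Sum>i\<in>UNIV. partial_deriv i (partial_deriv i f) x)"
    using U(2) unfolding C2_on_def by (intro continuous_on_sum continuous_on_subset[OF _ U(1)]) auto
  then show "continuous_on (wedge \<xi>) (laplacian f)" by (simp add: laplacian_def[abs_def])
  obtain A where A: "\<And>x. x \<in> wedge \<xi> \<Longrightarrow> \<bar>f x\<bar> \<le> A"
    using b(1) by (auto simp: bounded_iff)
  obtain B1 where B1: "\<And>x. x \<in> wedge \<xi> \<Longrightarrow> \<bar>partial_deriv 1 (partial_deriv 1 f) x\<bar> \<le> B1"
    using b(2)[of 1 1] by (auto simp: bounded_iff)
  obtain B2 where B2: "\<And>x. x \<in> wedge \<xi> \<Longrightarrow> \<bar>partial_deriv 2 (partial_deriv 2 f) x\<bar> \<le> B2"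
    using b(2)[of 2 2] by (auto simp: bounded_iff)
  have "\<bar>laplacian f x\<bar> \<le> B1 + B2" if "x \<in> wedge \<xi>" for x
    using B1[OF that] B2[OF that] by (simp add: laplacian_def sum_2)
  then show "\<exists>C\<ge>0. \<forall>x\<in>wedge \<xi>. \<bar>f x\<bar> \<le> C \<and> \<bar>laplacian f x\<bar> \<le> C"
    using A by (intro exI[of _ "max 0 (max A (B1 + B2))"]) (auto simp: le_max_iff_disj)
qed

lemma path_continuous_on_Icc:
  assumes "\<omega> \<in> path_space \<xi>" "0 \<le> s"
  shows "continuous_on {s..t} \<omega>" "\<omega> ` {s..t} \<subseteq> wedge \<xi>"
  using assms by (auto simp: path_space_def PiE_def Pi_def intro: continuous_on_subset)

lemma compensated_diff:
  assumes f: "test_fun \<xi> \<theta>1 \<theta>2 f" and w: "\<omega> \<in> path_space \<xi>" and st: "0 \<le> s" "s \<le> t"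
  shows "compensated f t \<omega> - compensated f s \<omega> =
    f (\<omega> t) - f (\<omega> s) - 1/2 * integral {s..t} (\<lambda>u. laplacian f (\<omega> u))"
proof -
  have "(\<lambda>u. laplacian f (\<omega> u)) integrable_on {0..t}"
    by (intro integrable_continuous_real continuous_on_compose2[OF test_fun_continuous(2)[OF f]]
        path_continuous_on_Icc[OF w]) auto
  from Henstock_Kurzweil_Integration.integral_combine[OF st this]
  show ?thesis by (simp add: compensated_def algebra_simps)
qed

lemma compensator_bound:
  assumes f: "test_fun \<xi> \<theta>1 \<theta>2 f" and w: "\<omega> \<in> path_space \<xi>" and st: "0 \<le> s" "s \<le> t"
    and C: "\<And>x. x \<in> wedge \<xi> \<Longrightarrow> \<bar>laplacian f x\<bar> \<le> C"
  shows "\<bar>integral {s..t} (\<lambda>u. laplacian f (\<omega> u))\<bar> \<le> C * (t - s)"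
proof -
  have "continuous_on {s..t} (\<lambda>u. laplacian f (\<omega> u))"
    by (intro continuous_on_compose2[OF test_fun_continuous(2)[OF f]] path_continuous_on_Icc[OF w st(1)])
  from integral_bound[OF st(2) this, of C]
  have "norm (integral {s..t} (\<lambda>u. laplacian f (\<omega> u))) \<le> C * (t - s)"
    using C path_continuous_on_Icc(2)[OF w st(1), of t] by (auto simp: image_subset_iff)
  then show ?thesis by simp
qed

text \<open>By continuity an excursion out of the closed set lasts for an interval, which contains a
  rational time; adding the endpoints covers \<open>p = t\<close>. This makes staying in a closed
  set an event.\<close>

lemma closed_stay_iff:
  fixes \<omega> :: path
  assumes c: "continuous_on {p..t} \<omega>" and K: "closed K"
  shows "(\<forall>u\<in>{p..t}. \<omega> u \<in> K) \<longleftrightarrow> (\<forall>u\<in>{p..t} \<inter> (\<rat> \<union> {p, t}). \<omega> u \<in> K)"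
proof (intro iffI ballI)
  fix u assume H: "\<forall>u\<in>{p..t} \<inter> (\<rat> \<union> {p, t}). \<omega> u \<in> K" and u: "u \<in> {p..t}"
  show "\<omega> u \<in> K"
  proof (rule ccontr)
    assume "\<omega> u \<notin> K"
    then obtain e where e: "0 < e" "ball (\<omega> u) e \<subseteq> - K"
      using K openE[of "- K" "\<omega> u"] by (auto simp: open_Compl)
    obtain d where d: "0 < d" "\<And>v. v \<in> {p..t} \<Longrightarrow> dist v u < d \<Longrightarrow> dist (\<omega> v) (\<omega> u) < e"
      using c u e(1) unfolding continuous_on_iff by blast
    have "p < t" using H u \<open>\<omega> u \<notin> K\<close> by (cases "p = t") auto
    then have "max p (u - d) < min t (u + d)" using u d(1) by auto
    then obtain q where q: "q \<in> \<rat>" "max p (u - d) < q" "q < min t (u + d)"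
      using Rats_dense_in_real by blast
    then have "q \<in> {p..t}" "dist q u < d" by (auto simp: dist_real_def)
    with d(2) have "\<omega> q \<in> ball (\<omega> u) e" by (simp add: dist_commute)
    then have "\<omega> q \<notin> K" using e(2) by auto
    then show False using H q \<open>q \<in> {p..t}\<close> by auto
  qed
qed auto

text \<open>Gathers what is used for a single starting point. \<open>compensated_drift\<close> is
  the submartingale property tested against nonnegative weights known at time \<open>s\<close>, the
  form in which grid arguments apply it; \<open>no_zero_interval\<close> is the pathwise consequence
  of the zero occupation time of the corner.\<close>

locale reflected_process = prob_space M for M :: "path measure" +
  fixes \<xi> \<theta>1 \<theta>2 :: real and G :: "real \<Rightarrow> path measure" and X Y :: "real \<Rightarrow> path \<Rightarrow> real^2"
  assumes wedge_angle: "0 < \<xi>" "\<xi> < pi"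
    and space_M: "space M = path_space \<xi>"
    and subalgebra_G: "\<And>t. 0 \<le> t \<Longrightarrow> subalgebra M (G t)"
    and G_mono: "\<And>s t. 0 \<le> s \<Longrightarrow> s \<le> t \<Longrightarrow> sets (G s) \<subseteq> sets (G t)"
    and coordinate_measurable: "\<And>t. 0 \<le> t \<Longrightarrow> (\<lambda>\<omega>. \<omega> t) \<in> borel_measurable (G t)"
    and X_measurable: "\<And>t. 0 \<le> t \<Longrightarrow> X t \<in> borel_measurable (G t)"
    and Y_measurable: "\<And>t. 0 \<le> t \<Longrightarrow> Y t \<in> borel_measurable (G t)"
    and increment_law: "\<And>s t. 0 \<le> s \<Longrightarrow> s < t \<Longrightarrow> distributed M lborel (\<lambda>\<omega>. X t \<omega> - X s \<omega>)
          (\<lambda>x. ennreal (\<Prod>i\<in>UNIV. normal_density 0 (sqrt (t - s)) (x $ i)))"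
    and increment_indep: "\<And>s t. 0 \<le> s \<Longrightarrow> s < t \<Longrightarrow> indep_set (sets (G s))
          (sets (vimage_algebra (space M) (\<lambda>\<omega>. X t \<omega> - X s \<omega>) borel))"
    and decomposition: "\<And>\<omega> t. \<omega> \<in> space M \<Longrightarrow> 0 \<le> t \<Longrightarrow> \<omega> t = X t \<omega> + Y t \<omega>"
    and X_continuous: "AE \<omega> in M. continuous_on {0..} (\<lambda>t. X t \<omega>)"
    and Y_continuous: "AE \<omega> in M. continuous_on {0..} (\<lambda>t. Y t \<omega>)"
    and zero_energy: "zero_energy M Y"
    and compensated_measurable: "\<And>f t. test_fun \<xi> \<theta>1 \<theta>2 f \<Longrightarrow> 0 \<le> t \<Longrightarrow>
          compensated f t \<in> borel_measurable (G t)"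
    and compensated_drift: "\<And>f s t H. test_fun \<xi> \<theta>1 \<theta>2 f \<Longrightarrow> 0 \<le> s \<Longrightarrow> s \<le> t \<Longrightarrow>
          H \<in> borel_measurable (G s) \<Longrightarrow> (\<And>\<omega>. 0 \<le> H \<omega>) \<Longrightarrow> integrable M H \<Longrightarrow>
          0 \<le> (\<integral>\<omega>. H \<omega> * (compensated f t \<omega> - compensated f s \<omega>) \<partial>M)"
    and no_zero_interval: "AE \<omega> in M. \<forall>a b. 0 \<le> a \<longrightarrow> a < b \<longrightarrow> (\<exists>t\<in>{a..b}. \<omega> t \<noteq> 0)"
begin

lemma space_G: "0 \<le> t \<Longrightarrow> space (G t) = space M"
  using subalgebra_G[of t] by (simp add: subalgebra_def)

lemma measurable_G_M: "f \<in> borel_measurable (G t) \<Longrightarrow> 0 \<le> t \<Longrightarrow> f \<in> borel_measurable M"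
  using measurable_from_subalg[OF subalgebra_G] by blast

lemma sets_G_M: "A \<in> sets (G t) \<Longrightarrow> 0 \<le> t \<Longrightarrow> A \<in> sets M"
  using subalgebra_G[of t] by (auto simp: subalgebra_def)

lemma measurable_G_mono:
  assumes "f \<in> borel_measurable (G s)" "0 \<le> s" "s \<le> t"
  shows "f \<in> borel_measurable (G t)"
  by (rule measurable_from_subalg[OF _ assms(1)])
    (use assms G_mono[of s t] space_G in \<open>auto simp: subalgebra_def\<close>)

definition stay :: "(real^2) set \<Rightarrow> real \<Rightarrow> real \<Rightarrow> path set" where
  "stay K p t = {\<omega>\<in>space M. \<forall>u\<in>{p..t}. \<omega> u \<in> K}"

lemma stay_measurable:
  assumes "closed K" "0 \<le> p" "0 \<le> t"
  shows "stay K p t \<in> sets (G t)"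
proof -
  let ?Q = "{p..t} \<inter> (\<rat> \<union> {p, t})"
  have "stay K p t = {\<omega>\<in>space (G t). \<forall>u\<in>?Q. \<omega> u \<in> K}"
    unfolding stay_def space_G[OF assms(3)]
    using closed_stay_iff[OF path_continuous_on_Icc(1)[OF _ assms(2)] assms(1)] space_M by blast
  also have "\<dots> \<in> sets (G t)"
  proof (rule sets.sets_Collect_countable_All')
    show "countable ?Q" by (intro countable_Int2 countable_Un countable_rat) auto
    fix u assume "u \<in> ?Q"
    then have "(\<lambda>\<omega>. \<omega> u) \<in> borel_measurable (G t)"
      using assms by (intro measurable_G_mono[OF coordinate_measurable]) auto
    then show "{\<omega> \<in> space (G t). \<omega> u \<in> K} \<in> sets (G t)"
      using assms(1) by (metis (mono_tags) borel_closed pred_def pred_sets2)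
  qed
  finally show ?thesis .
qed

lemma compensated_diff_bounded:
  assumes f: "test_fun \<xi> \<theta>1 \<theta>2 f" and "0 \<le> s" "s \<le> t"
  shows "\<exists>B. \<forall>\<omega>\<in>space M. \<bar>compensated f t \<omega> - compensated f s \<omega>\<bar> \<le> B"
proof -
  obtain C where C: "\<And>x. x \<in> wedge \<xi> \<Longrightarrow> \<bar>f x\<bar> \<le> C" "\<And>x. x \<in> wedge \<xi> \<Longrightarrow> \<bar>laplacian f x\<bar> \<le> C"
    using test_fun_continuous(3)[OF f] by blast
  have "\<bar>compensated f t \<omega> - compensated f s \<omega>\<bar> \<le> 2 * C + C * (t - s)" if "\<omega> \<in> space M" for \<omega>
  proof -
    have w: "\<omega> \<in> path_space \<xi>" using that space_M by simp
    have "\<omega> s \<in> wedge \<xi>" "\<omega> t \<in> wedge \<xi>"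
      using path_continuous_on_Icc(2)[OF w order_refl, of t] assms by auto
    then show ?thesis
      using C(1)[of "\<omega> s"] C(1)[of "\<omega> t"] compensator_bound[OF f w assms(2,3) C(2)]
      unfolding compensated_diff[OF f w assms(2,3)] by linarith
  qed
  then show ?thesis by blast
qed

text \<open>The fourth moment is of order \<open>(t - s)\<^sup>2\<close>, so its sum over a grid
  tends to zero with the step; 24 is 8 from \<open>inner_power4_le\<close> times the Gaussian moment
  3.\<close>

lemma increment_moments:
  assumes st: "0 \<le> s" "s < t"
  shows "integrable M (\<lambda>\<omega>. w \<bullet> (X t \<omega> - X s \<omega>))" "(\<integral>\<omega>. w \<bullet> (X t \<omega> - X s \<omega>) \<partial>M) = 0"
    "integrable M (\<lambda>\<omega>. (w \<bullet> (X t \<omega> - X s \<omega>))\<^sup>2)" "integrable M (\<lambda>\<omega>. (w \<bullet> (X t \<omega> - X s \<omega>))^4)"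
    "(\<integral>\<omega>. (w \<bullet> (X t \<omega> - X s \<omega>))^4 \<partial>M) \<le> 24 * ((w $ 1)^4 + (w $ 2)^4) * (t - s)\<^sup>2"
proof -
  define B where "B k \<omega> = (X t \<omega> - X s \<omega>) $ k" for k \<omega>
  have "0 < sqrt (t - s)" using st by simp
  note m = normal_moments[OF distributed_component[OF increment_law[OF st] this] this, folded B_def]
  have wB: "w \<bullet> (X t \<omega> - X s \<omega>) = w $ 1 * B 1 \<omega> + w $ 2 * B 2 \<omega>" for \<omega>
    by (simp add: inner_real2 B_def)
  have s4: "sqrt (t - s)^4 = (t - s)\<^sup>2"
  proof -
    have "sqrt (t - s)^4 = ((sqrt (t - s))\<^sup>2)\<^sup>2" by simp
    then show ?thesis using st by (simp only: real_sqrt_pow2)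
  qed
  show "integrable M (\<lambda>\<omega>. w \<bullet> (X t \<omega> - X s \<omega>))" "(\<integral>\<omega>. w \<bullet> (X t \<omega> - X s \<omega>) \<partial>M) = 0"
    unfolding wB using m(1,2)[of 1] m(1,2)[of 2] by simp_all
  have [measurable]: "B k \<in> borel_measurable M" for k using m(1) by auto
  show "integrable M (\<lambda>\<omega>. (w \<bullet> (X t \<omega> - X s \<omega>))\<^sup>2)"
    unfolding wB using m(3)[of 1] m(3)[of 2] by (intro integrable_square_add) (auto simp: power_mult_distrib)
  have le: "(w \<bullet> (X t \<omega> - X s \<omega>))^4 \<le> 8 * (w $ 1)^4 * (B 1 \<omega>)^4 + 8 * (w $ 2)^4 * (B 2 \<omega>)^4" for \<omega>
    unfolding B_def by (rule inner_power4_le)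
  have int: "integrable M (\<lambda>\<omega>. 8 * (w $ 1)^4 * (B 1 \<omega>)^4 + 8 * (w $ 2)^4 * (B 2 \<omega>)^4)"
    using m(4)[of 1] m(4)[of 2] by simp
  show i4: "integrable M (\<lambda>\<omega>. (w \<bullet> (X t \<omega> - X s \<omega>))^4)"
  proof (rule Bochner_Integration.integrable_bound[OF int])
    show "(\<lambda>\<omega>. (w \<bullet> (X t \<omega> - X s \<omega>))^4) \<in> borel_measurable M" unfolding wB by measurable
    show "AE \<omega> in M. norm ((w \<bullet> (X t \<omega> - X s \<omega>))^4) \<le>
        norm (8 * (w $ 1)^4 * (B 1 \<omega>)^4 + 8 * (w $ 2)^4 * (B 2 \<omega>)^4)"
    proof (rule AE_I2)
      fix \<omega>
      have "0 \<le> (w \<bullet> (X t \<omega> - X s \<omega>))^4" by simp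
      then show "norm ((w \<bullet> (X t \<omega> - X s \<omega>))^4) \<le>
        norm (8 * (w $ 1)^4 * (B 1 \<omega>)^4 + 8 * (w $ 2)^4 * (B 2 \<omega>)^4)"
        using le[of \<omega>] unfolding real_norm_def by linarith
    qed
  qed
  have "(\<integral>\<omega>. (w \<bullet> (X t \<omega> - X s \<omega>))^4 \<partial>M) \<le>
      (\<integral>\<omega>. 8 * (w $ 1)^4 * (B 1 \<omega>)^4 + 8 * (w $ 2)^4 * (B 2 \<omega>)^4 \<partial>M)"
    by (rule integral_mono[OF i4 int le])
  also have "\<dots> = 8 * (w $ 1)^4 * (3 * (t - s)\<^sup>2) + 8 * (w $ 2)^4 * (3 * (t - s)\<^sup>2)"
    using m(4)[of 1] m(4)[of 2] m(5)[of 1] m(5)[of 2] by (simp add: s4)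
  finally show "(\<integral>\<omega>. (w \<bullet> (X t \<omega> - X s \<omega>))^4 \<partial>M) \<le> 24 * ((w $ 1)^4 + (w $ 2)^4) * (t - s)\<^sup>2"
    by (simp add: algebra_simps)
qed

lemma increment_drift:
  assumes st: "0 \<le> s" "s < t" and H: "H \<in> borel_measurable (G s)" "integrable M H"
  shows "integrable M (\<lambda>\<omega>. H \<omega> * (w \<bullet> (X t \<omega> - X s \<omega>)))" "(\<integral>\<omega>. H \<omega> * (w \<bullet> (X t \<omega> - X s \<omega>)) \<partial>M) = 0"
  by (rule indep_integral_mult_zero[OF increment_indep[OF st] subalgebra_G[OF st(1)] H, of "\<lambda>x. w \<bullet> x"];
      use increment_moments[OF st] in simp)+

text \<open>The Brownian increment has mean zero under any integrable weight known at time
  \<open>s\<close>, so subtracting it leaves the drift as it is.\<close>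

lemma drift_diff:
  assumes f: "test_fun \<xi> \<theta>1 \<theta>2 f" and st: "0 \<le> s" "s < t"
    and H: "H \<in> borel_measurable (G s)" "\<And>\<omega>. 0 \<le> H \<omega>" "integrable M H"
  shows "0 \<le> (\<integral>\<omega>. H \<omega> * ((compensated f t \<omega> - compensated f s \<omega>) - w \<bullet> (X t \<omega> - X s \<omega>)) \<partial>M)"
proof -
  let ?N = "\<lambda>\<omega>. compensated f t \<omega> - compensated f s \<omega>"
  obtain B where B: "\<And>\<omega>. \<omega> \<in> space M \<Longrightarrow> \<bar>?N \<omega>\<bar> \<le> B"
    using compensated_diff_bounded[OF f st(1) less_imp_le[OF st(2)]] by blast
  have Nm: "?N \<in> borel_measurable M"
    using st by (intro borel_measurable_diff measurable_G_M[OF compensated_measurable[OF f]]) auto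
  have "integrable M (\<lambda>\<omega>. ?N \<omega> * H \<omega>)"
    by (rule Bochner_Integration.integrable_bound[OF integrable_mult_right[OF H(3), of B]])
      (use Nm H(3) B in \<open>auto simp: abs_mult intro!: mult_mono AE_I2 order_trans[OF B]\<close>)
  then have "integrable M (\<lambda>\<omega>. H \<omega> * ?N \<omega>)" by (simp add: mult.commute)
  with increment_drift[OF st H(1,3), of w] compensated_drift[OF f st(1) less_imp_le[OF st(2)] H]
  show ?thesis by (simp add: right_diff_distrib)
qed

end


text \<open>Terms are dropped once the squares before their index exceed \<open>e\<close>. The
  stopped sum therefore overshoots \<open>e\<close> by at most its last term, which is at most
  \<open>R\<close>.\<close>

lemma indicator_sum_square_stopped:
  fixes u :: "nat \<Rightarrow> real" and V :: "nat \<Rightarrow> real"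
  assumes V: "\<And>k. V k = (\<Sum>i<k. (u i)\<^sup>2)" and R: "\<And>i. i < m \<Longrightarrow> (u i)\<^sup>2 \<le> R" "0 \<le> R" and k: "k \<le> m"
    and e: "0 \<le> e"
  shows "(\<Sum>i<k. (if V i \<le> e then u i else 0)\<^sup>2) \<le> e + R"
proof -
  have le: "(\<Sum>i<j. (if V i \<le> e then u i else 0)\<^sup>2) \<le> V j" for j
    unfolding V[of j] by (intro sum_mono) auto
  have "(\<Sum>i<j. (if V i \<le> e then u i else 0)\<^sup>2) \<le> e + R" if "j \<le> m" for j
    using that
  proof (induction j)
    case 0 then show ?case using R e by simp
  next
    case (Suc j)
    show ?case
    proof (cases "V j \<le> e")
      case True
      then show ?thesis using le[of j] R(1)[of j] Suc.prems by simp
    next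
      case False then show ?thesis using Suc by simp
    qed
  qed
  then show ?thesis using k by blast
qed

text \<open>A refinement of the lattice of multiples of \<open>1 / N\<close>: the rational endpoints
  \<open>a / N\<close> and \<open>b / N\<close> are grid points for every \<open>n\<close>.\<close>

definition grid_step :: "nat \<Rightarrow> nat \<Rightarrow> real" where
  "grid_step N n = 1 / (real N * real (Suc n))"

definition grid :: "nat \<Rightarrow> nat \<Rightarrow> nat \<Rightarrow> nat \<Rightarrow> real" where
  "grid N a n j = real a / real N + real j * grid_step N n"

lemma grid_step_pos: "0 < N \<Longrightarrow> 0 < grid_step N n"
  by (simp add: grid_step_def)

lemma grid_step_tendsto: "grid_step N \<longlonglongrightarrow> 0"
proof -
  have "(\<lambda>n. (1 / real N) * inverse (real (Suc n))) \<longlonglongrightarrow> (1 / real N) * 0"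
    by (intro tendsto_mult tendsto_const LIMSEQ_inverse_real_of_nat)
  then show ?thesis by (simp add: grid_step_def[abs_def] field_simps)
qed

lemma grid_end:
  assumes "a < b"
  shows "grid N a n ((b - a) * Suc n) = real b / real N"
proof -
  have "real ((b - a) * Suc n) = (real b - real a) * real (Suc n)"
    using assms by (simp only: of_nat_mult of_nat_diff[OF less_imp_le])
  then have "real ((b - a) * Suc n) * grid_step N n = (real b - real a) / real N"
    by (simp add: grid_step_def)
  then show ?thesis by (simp add: grid_def diff_divide_distrib)
qed

section \<open>Increments of the zero energy part off the corner\<close>

context reflected_process begin

text \<open>
  The increments of \<open>w \<bullet> Y\<close> are, inside \<open>K\<close>, those of a submartingale minus a martingale. As
  \<open>Y\<close> has zero energy, the squares of the discretised increments sum up to almost nothing, so that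
  the negative part of the sum of the increments, bounded in \<open>L\<^sup>2\<close> by that sum of squares, vanishes
  in the limit. This replaces the Doob-Meyer decomposition.
\<close>

lemma linear_drift:
  assumes K: "closed K" and f: "test_fun \<xi> \<theta>1 \<theta>2 f" and lin: "\<And>x. x \<in> K \<Longrightarrow> f x = w \<bullet> x \<and> laplacian f x = 0"
    and ab: "(a::nat) < b" and N0: "0 < (N0::nat)"
  shows "AE \<omega> in M. (\<forall>t\<in>{real a / N0..real b / N0}. \<omega> t \<in> K) \<longrightarrow>
    0 \<le> w \<bullet> (Y (real b / N0) \<omega> - Y (real a / N0) \<omega>)"
proof -
  define p q where "p = real a / N0" and "q = real b / N0"
  define h where "h = grid_step N0"
  define m where "m n = (b - a) * Suc n" for n
  define s where "s = grid N0 a"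
  have s_eq: "s n j = p + real j * h n" for n j by (simp add: s_def grid_def h_def p_def)
  have h: "0 < h n" for n unfolding h_def by (rule grid_step_pos[OF N0])
  have h0: "h \<longlonglongrightarrow> 0" unfolding h_def by (rule grid_step_tendsto)
  have p: "0 \<le> p" by (simp add: p_def)
  have s0: "s n 0 = p" for n by (simp add: s_eq)
  have sm: "s n (m n) = q" for n unfolding s_def m_def q_def by (rule grid_end[OF ab])
  have s_pos: "0 \<le> s n j" for n j using p h[of n] by (simp add: s_eq)
  have s_less: "s n j < s n (Suc j)" for n j using h[of n] by (simp add: s_eq algebra_simps)
  have s_diff: "s n (Suc j) - s n j = h n" for n j by (simp add: s_eq algebra_simps)
  have s_mono: "i \<le> j \<Longrightarrow> s n i \<le> s n j" for n i j using h[of n] by (simp add: s_eq)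
  \<comment> \<open>A submartingale increment minus a martingale increment, hence of nonnegative
    drift. As long as the path stays in \<open>K\<close>, it is the increment of
    \<open>w \<bullet> Y\<close>.\<close>
  define U where "U n j \<omega> = (compensated f (s n (Suc j)) \<omega> - compensated f (s n j) \<omega>)
      - w \<bullet> (X (s n (Suc j)) \<omega> - X (s n j) \<omega>)" for n j \<omega>
  \<comment> \<open>Membership is decided at the left end of step \<open>j\<close>. The step in
    which the path leaves \<open>K\<close> is thus still counted, although there \<open>U\<close>
    need not be an increment of \<open>w \<bullet> Y\<close>.\<close>
  define D where "D n j = stay K p (s n j)" for n j
  define u where "u n j \<omega> = indicator (D n j) \<omega> * U n j \<omega>" for n j \<omega>
  define V where "V n k \<omega> = (\<Sum>j<k. (u n j \<omega>)\<^sup>2)" for n k \<omega>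
  have D[measurable]: "D n j \<in> sets (G (s n j))" for n j
    unfolding D_def by (rule stay_measurable[OF K p s_pos])
  have Um: "U n j \<in> borel_measurable (G (s n (Suc j)))" for n j
  proof -
    have [measurable]: "compensated f (s n j) \<in> borel_measurable (G (s n (Suc j)))"
      "X (s n j) \<in> borel_measurable (G (s n (Suc j)))"
      using s_mono[of j "Suc j" n]
      by (auto intro: measurable_G_mono[OF compensated_measurable[OF f s_pos] s_pos]
          measurable_G_mono[OF X_measurable[OF s_pos] s_pos])
    have [measurable]: "compensated f (s n (Suc j)) \<in> borel_measurable (G (s n (Suc j)))"
      "X (s n (Suc j)) \<in> borel_measurable (G (s n (Suc j)))"
      using s_pos compensated_measurable[OF f] X_measurable by auto
    show ?thesis unfolding U_def by measurable
  qed
  have um: "u n j \<in> borel_measurable (G (s n k))" if "j < k" for n j k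
  proof -
    have "indicator (D n j) \<in> borel_measurable (G (s n j))" by simp
    then have "(indicator (D n j) :: path \<Rightarrow> real) \<in> borel_measurable (G (s n k))"
      using that by (intro measurable_G_mono[OF _ s_pos s_mono[of j k n]]) auto
    moreover have "U n j \<in> borel_measurable (G (s n k))"
      using that by (intro measurable_G_mono[OF Um s_pos s_mono]) auto
    ultimately show ?thesis unfolding u_def[abs_def] by (rule borel_measurable_times)
  qed
  have Vm: "V n k \<in> borel_measurable (G (s n k))" for n k
    unfolding V_def by (intro borel_measurable_sum borel_measurable_power um) auto
  have Umeas[measurable]: "U n j \<in> borel_measurable M" for n j
    using measurable_G_M[OF Um s_pos] .
  have Dmeas[measurable]: "D n j \<in> sets M" for n j using sets_G_M[OF D s_pos] .
  have umeas[measurable]: "u n j \<in> borel_measurable M" for n j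
    unfolding u_def[abs_def] by measurable
  have Vmeas[measurable]: "V n k \<in> borel_measurable M" for n k
    using measurable_G_M[OF Vm s_pos] .
  obtain C where C: "0 \<le> C" "\<And>x. x \<in> wedge \<xi> \<Longrightarrow> \<bar>f x\<bar> \<le> C" "\<And>x. x \<in> wedge \<xi> \<Longrightarrow> \<bar>laplacian f x\<bar> \<le> C"
    using test_fun_continuous(3)[OF f] by blast
  have path: "\<omega> \<in> path_space \<xi>" if "\<omega> \<in> space M" for \<omega> using that space_M by simp
  have in_wedge: "\<omega> t \<in> wedge \<xi>" if "\<omega> \<in> space M" "0 \<le> t" for \<omega> t
    using path_continuous_on_Icc(2)[OF path[OF that(1)] that(2), of t] by auto
  \<comment> \<open>Bounds a compensated increment: twice the bound on \<open>f\<close>, plus the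
    compensator over a step of length at most \<open>1 / N0\<close>.\<close>
  define c where "c = 2 * C + C / N0"
  have h_le: "h n \<le> 1 / N0" for n
    unfolding h_def grid_step_def using N0 by (intro divide_left_mono) auto
  have c0: "0 \<le> c" unfolding c_def using C(1) by simp
  define \<Delta> where "\<Delta> n j \<omega> = compensated f (s n (Suc j)) \<omega> - compensated f (s n j) \<omega>" for n j \<omega>
  define B where "B n j \<omega> = w \<bullet> (X (s n (Suc j)) \<omega> - X (s n j) \<omega>)" for n j \<omega>
  have UB: "U n j \<omega> = \<Delta> n j \<omega> - B n j \<omega>" for n j \<omega> by (simp add: U_def \<Delta>_def B_def)
  have \<Delta>_eq: "\<Delta> n j \<omega> = f (\<omega> (s n (Suc j))) - f (\<omega> (s n j)) - 1/2 * integral {s n j..s n (Suc j)} (\<lambda>u. laplacian f (\<omega> u))"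
    and \<Delta>_int: "\<bar>integral {s n j..s n (Suc j)} (\<lambda>u. laplacian f (\<omega> u))\<bar> \<le> C * h n"
    if "\<omega> \<in> space M" for n j \<omega>
    using compensated_diff[OF f path[OF that] s_pos less_imp_le[OF s_less]]
      compensator_bound[OF f path[OF that] s_pos less_imp_le[OF s_less] C(3), of n j]
    unfolding s_diff \<Delta>_def by auto
  have \<Delta>_bound: "\<bar>\<Delta> n j \<omega>\<bar> \<le> c" if "\<omega> \<in> space M" for n j \<omega>
  proof -
    have "C * h n \<le> C / N0" using mult_left_mono[OF h_le C(1)] by simp
    then show ?thesis
      using C(2)[OF in_wedge[OF that s_pos], of n j] C(2)[OF in_wedge[OF that s_pos], of n "Suc j"] \<Delta>_int[OF that, of n j]
      unfolding \<Delta>_eq[OF that] c_def by linarith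
  qed
  have Bm: "integrable M (B n j)" "integrable M (\<lambda>\<omega>. (B n j \<omega>)\<^sup>2)" "integrable M (\<lambda>\<omega>. (B n j \<omega>)^4)"
    "(\<integral>\<omega>. (B n j \<omega>)^4 \<partial>M) \<le> 24 * ((w $ 1)^4 + (w $ 2)^4) * (h n)\<^sup>2" for n j
    using increment_moments[OF s_pos s_less, of w n j] unfolding s_diff B_def by auto
  have Bmeas[measurable]: "B n j \<in> borel_measurable M" for n j using Bm(1) by auto
  have \<Delta>meas[measurable]: "\<Delta> n j \<in> borel_measurable M" for n j
    using s_pos unfolding \<Delta>_def by (intro borel_measurable_diff measurable_G_M[OF compensated_measurable[OF f]]) auto
  have \<Delta>2: "(\<Delta> n j \<omega>)\<^sup>2 \<le> c\<^sup>2" if "\<omega> \<in> space M" for n j \<omega>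
    by (rule abs_le_square_iff[THEN iffD1]) (use \<Delta>_bound[OF that, of n j] c0 in simp)
  have U2: "integrable M (\<lambda>\<omega>. (U n j \<omega>)\<^sup>2)" for n j
  proof -
    have "integrable M (\<lambda>\<omega>. (\<Delta> n j \<omega>)\<^sup>2)"
      by (rule integrable_const_bound[of _ "c\<^sup>2"]) (use \<Delta>2 in auto)
    from integrable_square_add[of "\<Delta> n j" M "\<lambda>\<omega>. - B n j \<omega>"] this Bm(2)[of n j]
    show ?thesis unfolding UB by simp
  qed
  have u2: "integrable M (\<lambda>\<omega>. (u n j \<omega>)\<^sup>2)" for n j
    by (rule Bochner_Integration.integrable_bound[OF U2[of n j]]) (auto simp: u_def indicator_def)

  \<comment> \<open>Increments are switched off once the squares accumulated before step
    \<open>j\<close> exceed \<open>e\<close>. As \<open>V n j\<close> is known at the left end of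
    that step, the sign of the drift is preserved.\<close>
  define W where "W e n j \<omega> = (if V n j \<omega> \<le> e then u n j \<omega> else 0)" for e n j \<omega>
  define S where "S e n k \<omega> = (\<Sum>j<k. W e n j \<omega>)" for e n k \<omega>
  have Wm: "W e n j \<in> borel_measurable (G (s n k))" if "j < k" for e n j k
  proof -
    have [measurable]: "V n j \<in> borel_measurable (G (s n k))"
      using that by (intro measurable_G_mono[OF Vm s_pos s_mono]) auto
    have [measurable]: "u n j \<in> borel_measurable (G (s n k))" by (rule um[OF that])
    show ?thesis unfolding W_def[abs_def] by measurable
  qed
  have Wmeas[measurable]: "W e n j \<in> borel_measurable M" for e n j
    using measurable_G_M[OF Wm[of j "Suc j"] s_pos] by simp
  have Sm: "S e n k \<in> borel_measurable (G (s n k))" for e n k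
    unfolding S_def by (intro borel_measurable_sum Wm) auto
  have W2: "integrable M (\<lambda>\<omega>. (W e n j \<omega>)\<^sup>2)" for e n j
    by (rule Bochner_Integration.integrable_bound[OF u2[of n j]]) (auto simp: W_def)
  have S2: "integrable M (\<lambda>\<omega>. (S e n k \<omega>)\<^sup>2)" for e n k
    unfolding S_def by (rule integrable_square_sum) (auto simp: W2)
  have drift: "(\<integral>\<omega>. min (\<Sum>j<k. W e n j \<omega>) 0 * W e n k \<omega> \<partial>M) \<le> 0" for e n k
  proof -
    \<comment> \<open>The nonnegative weight whose product with \<open>U\<close> is minus the cross
      term of \<open>negative_part_estimate\<close>.\<close>
    define H where "H \<omega> = - min (S e n k \<omega>) 0 * (if V n k \<omega> \<le> e then indicator (D n k) \<omega> else 0)" for \<omega>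
    have [measurable]: "S e n k \<in> borel_measurable (G (s n k))" "V n k \<in> borel_measurable (G (s n k))"
      by (rule Sm, rule Vm)
    have Hm: "H \<in> borel_measurable (G (s n k))" unfolding H_def[abs_def] by measurable
    have "integrable M (S e n k)"
      by (rule integrable_of_square[OF measurable_G_M[OF Sm s_pos] S2])
    then have Hi: "integrable M H"
    proof (rule Bochner_Integration.integrable_bound)
      show "H \<in> borel_measurable M" by (rule measurable_G_M[OF Hm s_pos])
      have "norm (H \<omega>) \<le> norm (S e n k \<omega>)" for \<omega>
        by (simp add: H_def indicator_def min_def)
      then show "AE \<omega> in M. norm (H \<omega>) \<le> norm (S e n k \<omega>)" by simp
    qed
    have "0 \<le> (\<integral>\<omega>. H \<omega> * U n k \<omega> \<partial>M)"
      unfolding U_def by (rule drift_diff[OF f s_pos s_less Hm _ Hi]) (auto simp: H_def min_def indicator_def)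
    also have "(\<lambda>\<omega>. H \<omega> * U n k \<omega>) = (\<lambda>\<omega>. - (min (\<Sum>j<k. W e n j \<omega>) 0 * W e n k \<omega>))"
      by (intro ext) (auto simp: H_def S_def W_def u_def)
    finally show ?thesis by simp
  qed
  have est: "integrable M (\<lambda>\<omega>. (min (S e n k \<omega>) 0)\<^sup>2)"
    "(\<integral>\<omega>. (min (S e n k \<omega>) 0)\<^sup>2 \<partial>M) \<le> (\<Sum>j<k. \<integral>\<omega>. (W e n j \<omega>)\<^sup>2 \<partial>M)" for e n k
    unfolding S_def
    by (rule negative_part_estimate[where W = "W e n", OF Wmeas W2 drift]; assumption)+

  define good where "good e n = {\<omega>\<in>space M. V n (m n) \<omega> \<le> e}" for e n
  have goodm[measurable]: "good e n \<in> sets M" for e n unfolding good_def by measurable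
  define bad where "bad e n = space M - good e n" for e n
  have badm[measurable]: "bad e n \<in> sets M" for e n unfolding bad_def by measurable

  have V_mono: "V n i \<omega> \<le> V n k \<omega>" if "i \<le> k" for n i k \<omega>
    unfolding V_def using that by (intro sum_mono2) auto

  have sum_W2: "(\<Sum>j<m n. \<integral>\<omega>. (W e n j \<omega>)\<^sup>2 \<partial>M) \<le>
      4 * e + 2 * c\<^sup>2 * prob (bad e n) + (2 / e) * (24 * ((w $ 1)^4 + (w $ 2)^4) * ((q - p) * h n))"
    if e: "0 < e" for e n
  proof -
    \<comment> \<open>A common bound for the squared increments: at most \<open>e\<close> on the
      good event; on the bad one at most \<open>2 * c\<^sup>2\<close> plus twice a Brownian square,
      itself at most \<open>e + (B n i \<omega>)^4 / e\<close>. Brownian increments are unbounded,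
      and it is the fourth moments that make their share vanish as the grid is refined.\<close>
    define R where "R \<omega> = 3 * e + 2 * c\<^sup>2 * indicator (bad e n) \<omega> + (2 / e) * (\<Sum>j<m n. (B n j \<omega>)^4)" for \<omega>
    have ind: "integrable M (\<lambda>\<omega>. indicator (bad e n) \<omega> :: real)"
      by (rule integrable_const_bound[of _ 1]) (auto simp: indicator_def)
    have Ri: "integrable M R"
      unfolding R_def using Bm(3) ind
      by (intro Bochner_Integration.integrable_add integrable_mult_right Bochner_Integration.integrable_sum) auto
    have R0: "0 \<le> R \<omega>" for \<omega>
      unfolding R_def using e by (intro add_nonneg_nonneg mult_nonneg_nonneg sum_nonneg) auto
    have uR: "(u n i \<omega>)\<^sup>2 \<le> R \<omega>" if "i < m n" "\<omega> \<in> space M" for i \<omega>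
    proof (cases "\<omega> \<in> good e n")
      case True
      have "(u n i \<omega>)\<^sup>2 \<le> V n (m n) \<omega>"
        unfolding V_def using that(1) by (intro member_le_sum) auto
      also have "\<dots> \<le> e" using True by (simp add: good_def)
      also have "\<dots> \<le> R \<omega>"
        unfolding R_def using e by (simp add: add_nonneg_nonneg sum_nonneg)
      finally show ?thesis .
    next
      case False
      have "(u n i \<omega>)\<^sup>2 \<le> (U n i \<omega>)\<^sup>2" by (simp add: u_def indicator_def)
      also have "\<dots> \<le> 2 * (\<Delta> n i \<omega>)\<^sup>2 + 2 * (B n i \<omega>)\<^sup>2"
        using sum_squares_bound[of "\<Delta> n i \<omega>" "- B n i \<omega>"] unfolding UB by (simp add: power2_diff)
      also have "(\<Delta> n i \<omega>)\<^sup>2 \<le> c\<^sup>2"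
        by (rule \<Delta>2[OF that(2)])
      also have "(B n i \<omega>)\<^sup>2 \<le> e + (\<Sum>j<m n. (B n j \<omega>)^4) / e"
      proof -
        have "e * (B n i \<omega>)\<^sup>2 \<le> e\<^sup>2 + ((B n i \<omega>)\<^sup>2)\<^sup>2"
        proof -
          have "2 * (e * (B n i \<omega>)\<^sup>2) \<le> e\<^sup>2 + ((B n i \<omega>)\<^sup>2)\<^sup>2"
            using sum_squares_bound[of e "(B n i \<omega>)\<^sup>2"] by (simp only: mult.assoc)
          moreover have "0 \<le> e * (B n i \<omega>)\<^sup>2" using e by simp
          ultimately show ?thesis by linarith
        qed
        also have "((B n i \<omega>)\<^sup>2)\<^sup>2 \<le> (\<Sum>j<m n. (B n j \<omega>)^4)"
          using member_le_sum[of i "{..<m n}" "\<lambda>j. (B n j \<omega>)^4"] that(1) by simp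
        finally show ?thesis using e by (simp add: field_simps power2_eq_square)
      qed
      finally have "(u n i \<omega>)\<^sup>2 \<le> 2 * c\<^sup>2 + 2 * (e + (\<Sum>j<m n. (B n j \<omega>)^4) / e)" by simp
      then show ?thesis using False that(2) e by (simp add: R_def bad_def)
    qed
    have "(\<Sum>j<m n. \<integral>\<omega>. (W e n j \<omega>)\<^sup>2 \<partial>M) = (\<integral>\<omega>. (\<Sum>j<m n. (W e n j \<omega>)\<^sup>2) \<partial>M)"
      using W2 by simp
    also have "\<dots> \<le> (\<integral>\<omega>. e + R \<omega> \<partial>M)"
    proof (rule integral_mono)
      show "integrable M (\<lambda>\<omega>. \<Sum>j<m n. (W e n j \<omega>)\<^sup>2)" using W2 by simp
      show "integrable M (\<lambda>\<omega>. e + R \<omega>)" using Ri by simp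
      show "(\<Sum>j<m n. (W e n j \<omega>)\<^sup>2) \<le> e + R \<omega>" if "\<omega> \<in> space M" for \<omega>
        unfolding W_def using e
        by (intro indicator_sum_square_stopped[of "\<lambda>j. V n j \<omega>" "\<lambda>j. u n j \<omega>" "m n"])
          (auto simp: V_def R0 intro!: uR that)
    qed
    also have "\<dots> = 4 * e + 2 * c\<^sup>2 * prob (bad e n) + (2 / e) * (\<Sum>j<m n. \<integral>\<omega>. (B n j \<omega>)^4 \<partial>M)"
    proof -
      have 1: "integrable M (\<lambda>\<omega>. 4 * e + 2 * c\<^sup>2 * indicator (bad e n) \<omega>)" using ind by simp
      have 2: "integrable M (\<lambda>\<omega>. (2 / e) * (\<Sum>j<m n. (B n j \<omega>)^4))"
        using Bm(3) by (intro integrable_mult_right Bochner_Integration.integrable_sum) auto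
      have "(\<integral>\<omega>. e + R \<omega> \<partial>M) =
          (\<integral>\<omega>. (4 * e + 2 * c\<^sup>2 * indicator (bad e n) \<omega>) + (2 / e) * (\<Sum>j<m n. (B n j \<omega>)^4) \<partial>M)"
        by (rule Bochner_Integration.integral_cong) (simp_all add: R_def)
      also have "\<dots> = (\<integral>\<omega>. 4 * e + 2 * c\<^sup>2 * indicator (bad e n) \<omega> \<partial>M) +
          (\<integral>\<omega>. (2 / e) * (\<Sum>j<m n. (B n j \<omega>)^4) \<partial>M)"
        by (rule Bochner_Integration.integral_add[OF 1 2])
      also have "(\<integral>\<omega>. 4 * e + 2 * c\<^sup>2 * indicator (bad e n) \<omega> \<partial>M) = 4 * e + 2 * c\<^sup>2 * prob (bad e n)"
        using ind by (simp add: prob_space)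
      also have "(\<integral>\<omega>. (2 / e) * (\<Sum>j<m n. (B n j \<omega>)^4) \<partial>M) =
          (2 / e) * (\<Sum>j<m n. \<integral>\<omega>. (B n j \<omega>)^4 \<partial>M)"
        using Bm(3) by simp
      finally show ?thesis .
    qed
    also have "\<dots> \<le> 4 * e + 2 * c\<^sup>2 * prob (bad e n) +
        (2 / e) * (\<Sum>j<m n. 24 * ((w $ 1)^4 + (w $ 2)^4) * (h n)\<^sup>2)"
      using e Bm(4) by (intro add_left_mono mult_left_mono sum_mono) auto
    also have "(\<Sum>j<m n. 24 * ((w $ 1)^4 + (w $ 2)^4) * (h n)\<^sup>2) = 24 * ((w $ 1)^4 + (w $ 2)^4) * ((q - p) * h n)"
    proof -
      have "real (m n) * h n = q - p" using sm[of n] by (simp add: s_eq)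
      then have 1: "real (m n) * (h n)\<^sup>2 = (q - p) * h n" by (simp add: power2_eq_square)
      have "(\<Sum>j<m n. k * (h n)\<^sup>2) = k * (real (m n) * (h n)\<^sup>2)" for k
        by (simp add: mult.left_commute)
      then show ?thesis unfolding 1 .
    qed
    finally show ?thesis .
  qed

  have YB: "U n j \<omega> = w \<bullet> (Y (s n (Suc j)) \<omega> - Y (s n j) \<omega>)"
    if w: "\<omega> \<in> D n (Suc j)" for n j \<omega>
  proof -
    have sp: "\<omega> \<in> space M" and K': "\<And>t. t \<in> {p..s n (Suc j)} \<Longrightarrow> \<omega> t \<in> K"
      using w by (auto simp: D_def stay_def)
    have ps: "p \<le> s n j" using s_mono[of 0 j n] s0 by simp
    have "integral {s n j..s n (Suc j)} (\<lambda>u. laplacian f (\<omega> u)) = integral {s n j..s n (Suc j)} (\<lambda>u. 0)"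
      by (rule integral_cong) (use K' ps lin in auto)
    moreover have "f (\<omega> (s n j)) = w \<bullet> \<omega> (s n j)" "f (\<omega> (s n (Suc j))) = w \<bullet> \<omega> (s n (Suc j))"
      using K' ps s_less[of n j] lin by auto
    ultimately show ?thesis
      using decomposition[OF sp s_pos, of n j] decomposition[OF sp s_pos, of n "Suc j"]
      unfolding UB \<Delta>_eq[OF sp] B_def by (simp add: inner_add_right inner_diff_right)
  qed
  have D_mono: "D n (Suc j) \<subseteq> D n j" for n j
    using s_less[of n j] by (auto simp: D_def stay_def)

  define Q where "Q n \<omega> = (\<Sum>j<m n. (norm (Y (s n (Suc j)) \<omega> - Y (s n j) \<omega>))\<^sup>2)" for n \<omega>
  \<comment> \<open>Before leaving \<open>K\<close> the squares are controlled by the energy of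
    \<open>Y\<close>; only the single leaving step can add to this, by at most
    \<open>\<eta>\<^sup>2\<close>.\<close>
  have V_le: "V n k \<omega> \<le> (norm w)\<^sup>2 * (\<Sum>j<k. (norm (Y (s n (Suc j)) \<omega> - Y (s n j) \<omega>))\<^sup>2) +
      (if \<omega> \<in> D n k then 0 else \<eta>\<^sup>2)" if "\<And>j. j < k \<Longrightarrow> \<bar>U n j \<omega>\<bar> \<le> \<eta>" for n k \<omega> \<eta>
    using that
  proof (induction k)
    case 0 then show ?case by (simp add: V_def)
  next
    case (Suc k)
    have IH: "V n k \<omega> \<le> (norm w)\<^sup>2 * (\<Sum>j<k. (norm (Y (s n (Suc j)) \<omega> - Y (s n j) \<omega>))\<^sup>2) +
      (if \<omega> \<in> D n k then 0 else \<eta>\<^sup>2)" using Suc by simp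
    have VS: "V n (Suc k) \<omega> = V n k \<omega> + (u n k \<omega>)\<^sup>2" by (simp add: V_def)
    let ?A = "(norm w)\<^sup>2 * (\<Sum>j<k. (norm (Y (s n (Suc j)) \<omega> - Y (s n j) \<omega>))\<^sup>2)"
    have sumS: "(norm w)\<^sup>2 * (\<Sum>j<Suc k. (norm (Y (s n (Suc j)) \<omega> - Y (s n j) \<omega>))\<^sup>2) =
        ?A + (norm w)\<^sup>2 * (norm (Y (s n (Suc k)) \<omega> - Y (s n k) \<omega>))\<^sup>2"
      by (simp add: distrib_left)
    have nn: "0 \<le> (norm w)\<^sup>2 * (norm (Y (s n (Suc k)) \<omega> - Y (s n k) \<omega>))\<^sup>2" by simp
    consider "\<omega> \<in> D n (Suc k)" | "\<omega> \<in> D n k" "\<omega> \<notin> D n (Suc k)" | "\<omega> \<notin> D n k" "\<omega> \<notin> D n (Suc k)"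
      using D_mono by blast
    then show ?case
    proof cases
      case 1
      have "\<bar>U n k \<omega>\<bar> \<le> \<bar>norm w * norm (Y (s n (Suc k)) \<omega> - Y (s n k) \<omega>)\<bar>"
        unfolding YB[OF 1] using Cauchy_Schwarz_ineq2[of w "Y (s n (Suc k)) \<omega> - Y (s n k) \<omega>"] by simp
      then have "(U n k \<omega>)\<^sup>2 \<le> (norm w)\<^sup>2 * (norm (Y (s n (Suc k)) \<omega> - Y (s n k) \<omega>))\<^sup>2"
        using abs_le_square_iff by (metis power_mult_distrib)
      moreover have "\<omega> \<in> D n k" using 1 D_mono by blast
      then have "V n k \<omega> \<le> ?A" "u n k \<omega> = U n k \<omega>" using IH by (simp_all add: u_def)
      ultimately show ?thesis unfolding VS sumS if_P[OF 1] by simp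
    next
      case 2
      have "(u n k \<omega>)\<^sup>2 \<le> \<eta>\<^sup>2"
        using 2 abs_le_square_iff[of "U n k \<omega>" \<eta>] Suc.prems[of k] by (simp add: u_def)
      moreover have "V n k \<omega> \<le> ?A" using IH 2 by simp
      ultimately show ?thesis using nn unfolding VS sumS if_not_P[OF 2(2)] by linarith
    next
      case 3
      have "V n k \<omega> \<le> ?A + \<eta>\<^sup>2" "(u n k \<omega>)\<^sup>2 = 0" using IH 3 by (simp_all add: u_def)
      then show ?thesis using nn unfolding VS sumS if_not_P[OF 3(2)] by linarith
    qed
  qed

  \<comment> \<open>Controls the leaving step:
    \<open>f (\<omega> t) - w \<bullet> X t \<omega>\<close> is uniformly continuous on the compact
    time interval, so the largest \<open>U\<close> tends to zero almost surely.\<close>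
  have jump: "(\<lambda>n. prob {\<omega>\<in>space M. \<exists>j<m n. \<eta> < \<bar>U n j \<omega>\<bar>}) \<longlonglongrightarrow> 0" if \<eta>: "0 < \<eta>" for \<eta>
  proof (rule prob_tendsto_0_of_AE)
    show "{\<omega>\<in>space M. \<exists>j<m n. \<eta> < \<bar>U n j \<omega>\<bar>} \<in> events" for n by measurable
    show "AE \<omega> in M. \<forall>\<^sub>F n in sequentially. \<omega> \<notin> {\<omega>\<in>space M. \<exists>j<m n. \<eta> < \<bar>U n j \<omega>\<bar>}"
      using X_continuous AE_space
    proof eventually_elim
      case (elim \<omega>)
      have "continuous_on {p..q} (\<lambda>t. f (\<omega> t))"
        by (intro continuous_on_compose2[OF test_fun_continuous(1)[OF f]] path_continuous_on_Icc[OF path[OF elim(2)] p])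
      then have "continuous_on {p..q} (\<lambda>t. f (\<omega> t) - w \<bullet> X t \<omega>)"
        using elim(1) p by (intro continuous_intros) (auto intro: continuous_on_subset)
      then have "uniformly_continuous_on {p..q} (\<lambda>t. f (\<omega> t) - w \<bullet> X t \<omega>)"
        by (intro compact_uniformly_continuous) auto
      then obtain d where d: "0 < d" "\<And>t t'. t \<in> {p..q} \<Longrightarrow> t' \<in> {p..q} \<Longrightarrow> dist t' t < d \<Longrightarrow>
          dist (f (\<omega> t') - w \<bullet> X t' \<omega>) (f (\<omega> t) - w \<bullet> X t \<omega>) < \<eta> / 2"
        using \<eta> unfolding uniformly_continuous_on_def by (metis half_gt_zero)
      have "\<forall>\<^sub>F n in sequentially. h n < d" using order_tendstoD(2)[OF h0 d(1)] .
      moreover have "\<forall>\<^sub>F n in sequentially. C * h n < \<eta>"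
        using tendsto_mult_left[OF h0, of C] \<eta> by (intro order_tendstoD(2)) simp_all
      ultimately show ?case
      proof eventually_elim
        case (elim n)
        have "\<bar>U n j \<omega>\<bar> \<le> \<eta>" if j: "j < m n" for j
        proof -
          have "s n j \<in> {p..q}" "s n (Suc j) \<in> {p..q}"
            using s_mono[of 0 j n] s_mono[of 0 "Suc j" n] s_mono[of j "m n" n] s_mono[of "Suc j" "m n" n] j s0 sm by auto
          from d(2)[OF this] have "\<bar>(f (\<omega> (s n (Suc j))) - w \<bullet> X (s n (Suc j)) \<omega>) - (f (\<omega> (s n j)) - w \<bullet> X (s n j) \<omega>)\<bar> < \<eta> / 2"
            using s_diff[of n j] h[of n] elim(1) by (simp add: dist_real_def)
          then show ?thesis
            using \<Delta>_int[OF \<open>\<omega> \<in> space M\<close>, of n j] elim(2)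
            unfolding UB \<Delta>_eq[OF \<open>\<omega> \<in> space M\<close>] B_def inner_diff_right by linarith
        qed
        then show ?case by fastforce
      qed
    qed
  qed

  have energy: "(\<lambda>n. prob {\<omega>\<in>space M. \<epsilon> < \<bar>Q n \<omega>\<bar>}) \<longlonglongrightarrow> 0" if \<epsilon>: "0 < \<epsilon>" for \<epsilon>
  proof -
    \<comment> \<open>Zero energy concerns partitions that start at time 0. The grid is continued to
      the left down to 0, and \<open>Q\<close> is part of the resulting sum.\<close>
    define t where "t n i = real i * h n" for n i
    define l where "l n = b * Suc n" for n
    have hS: "real (x * Suc n) * h n = real x / N0" for x n
      by (simp only: h_def grid_step_def of_nat_mult) (simp del: of_nat_Suc)
    have tq: "t n (l n) = q" for n unfolding t_def l_def hS q_def ..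
    have part: "is_partition q (l n) (t n)" for n
      using tq h[of n] by (simp add: is_partition_def) (simp add: t_def)
    have "mesh (l n) (t n) = h n" for n
    proof -
      have "(\<lambda>i. \<bar>t n (Suc i) - t n i\<bar>) ` {..<l n} = {h n}"
        using h[of n] ab by (auto simp: t_def l_def algebra_simps image_def intro!: exI[of _ 0])
      then show ?thesis by (simp add: mesh_def)
    qed
    then have "(\<lambda>n. mesh (l n) (t n)) \<longlonglongrightarrow> 0" using h0 by simp
    moreover have "0 < q" using ab N0 by (simp add: q_def)
    ultimately have E: "tendsto_in_prob M (\<lambda>n \<omega>. \<Sum>i<l n. (norm (Y (t n (Suc i)) \<omega> - Y (t n i) \<omega>))\<^sup>2) 0"
      using zero_energy part unfolding zero_energy_def by blast
    have ts: "t n (a * Suc n + j) = s n j" for n j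
      unfolding t_def s_eq p_def of_nat_add distrib_right hS ..
    have QE: "Q n \<omega> \<le> (\<Sum>i<l n. (norm (Y (t n (Suc i)) \<omega> - Y (t n i) \<omega>))\<^sup>2)" for n \<omega>
    proof -
      have "Q n \<omega> = (\<Sum>i\<in>(\<lambda>j. a * Suc n + j) ` {..<m n}. (norm (Y (t n (Suc i)) \<omega> - Y (t n i) \<omega>))\<^sup>2)"
        unfolding Q_def by (subst sum.reindex) (auto simp: ts[symmetric] simp del: mult_Suc_right)
      also have "\<dots> \<le> (\<Sum>i<l n. (norm (Y (t n (Suc i)) \<omega> - Y (t n i) \<omega>))\<^sup>2)"
      proof (rule sum_mono2)
        have "a * Suc n + m n = l n" using ab by (simp add: m_def l_def flip: distrib_right add_mult_distrib)
        then show "(\<lambda>j. a * Suc n + j) ` {..<m n} \<subseteq> {..<l n}" by auto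
      qed auto
      finally show ?thesis .
    qed
    have Ym: "Y (t n i) \<in> borel_measurable M" for n i
      using h[of n] by (intro measurable_G_M[OF Y_measurable]) (auto simp: t_def)
    show ?thesis
    proof (rule tendsto_sandwich[of "\<lambda>_. 0"])
      show "(\<lambda>n. prob {\<omega>\<in>space M. \<epsilon> < \<bar>(\<Sum>i<l n. (norm (Y (t n (Suc i)) \<omega> - Y (t n i) \<omega>))\<^sup>2) - 0\<bar>}) \<longlonglongrightarrow> 0"
        using E \<epsilon> unfolding tendsto_in_prob_def by blast
      show "\<forall>\<^sub>F n in sequentially. prob {\<omega>\<in>space M. \<epsilon> < \<bar>Q n \<omega>\<bar>} \<le>
          prob {\<omega>\<in>space M. \<epsilon> < \<bar>(\<Sum>i<l n. (norm (Y (t n (Suc i)) \<omega> - Y (t n i) \<omega>))\<^sup>2) - 0\<bar>}"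
      proof (intro always_eventually allI finite_measure_mono subsetI)
        fix n \<omega> assume "\<omega> \<in> {\<omega>\<in>space M. \<epsilon> < \<bar>Q n \<omega>\<bar>}"
        moreover have "0 \<le> Q n \<omega>" by (simp add: Q_def sum_nonneg)
        ultimately show "\<omega> \<in> {\<omega>\<in>space M. \<epsilon> < \<bar>(\<Sum>i<l n. (norm (Y (t n (Suc i)) \<omega> - Y (t n i) \<omega>))\<^sup>2) - 0\<bar>}"
          using QE[of n \<omega>] by auto
      next
        note [measurable] = Ym
        show "{\<omega>\<in>space M. \<epsilon> < \<bar>(\<Sum>i<l n. (norm (Y (t n (Suc i)) \<omega> - Y (t n i) \<omega>))\<^sup>2) - 0\<bar>} \<in> events" for n
          by measurable
      qed
    qed auto
  qed

  have bad0: "(\<lambda>n. prob (bad e n)) \<longlonglongrightarrow> 0" if e: "0 < e" for e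
  proof -
    \<comment> \<open>Chosen so that the energy of \<open>Y\<close> and the leaving step contribute
      at most \<open>e / 2\<close> each; the summand 1 covers \<open>w = 0\<close>.\<close>
    define \<epsilon> where "\<epsilon> = e / (2 * ((norm w)\<^sup>2 + 1))"
    define \<eta> where "\<eta> = sqrt (e / 2)"
    have w1: "0 < (norm w)\<^sup>2 + 1" by (simp add: add_nonneg_pos)
    have \<epsilon>: "0 < \<epsilon>" and \<eta>: "0 < \<eta>" using e w1 by (simp_all add: \<epsilon>_def \<eta>_def)
    have Ym: "Y (s n i) \<in> borel_measurable M" for n i
      using s_pos by (intro measurable_G_M[OF Y_measurable]) auto
    have [measurable]: "Q n \<in> borel_measurable M" for n
      unfolding Q_def using Ym by measurable
    have sub: "bad e n \<subseteq> {\<omega>\<in>space M. \<epsilon> < \<bar>Q n \<omega>\<bar>} \<union> {\<omega>\<in>space M. \<exists>j<m n. \<eta> < \<bar>U n j \<omega>\<bar>}" for n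
    proof
      fix \<omega> assume \<omega>: "\<omega> \<in> bad e n"
      show "\<omega> \<in> {\<omega>\<in>space M. \<epsilon> < \<bar>Q n \<omega>\<bar>} \<union> {\<omega>\<in>space M. \<exists>j<m n. \<eta> < \<bar>U n j \<omega>\<bar>}"
      proof (rule ccontr)
        assume "\<not> ?thesis"
        moreover have "\<omega> \<in> space M" using \<omega> by (simp add: bad_def)
        ultimately have Q0: "\<not> \<epsilon> < \<bar>Q n \<omega>\<bar>" and U0: "\<not> (\<exists>j<m n. \<eta> < \<bar>U n j \<omega>\<bar>)" by blast+
        have Q': "Q n \<omega> \<le> \<epsilon>" using Q0 by linarith
        have U': "\<bar>U n j \<omega>\<bar> \<le> \<eta>" if "j < m n" for j
          using U0 that linorder_not_less by blast
        have "V n (m n) \<omega> \<le> (norm w)\<^sup>2 * Q n \<omega> + (if \<omega> \<in> D n (m n) then 0 else \<eta>\<^sup>2)"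
          unfolding Q_def by (rule V_le[OF U'])
        also have "\<dots> \<le> (norm w)\<^sup>2 * \<epsilon> + e / 2"
          using mult_left_mono[OF Q', of "(norm w)\<^sup>2"] e by (auto simp: \<eta>_def)
        also have "(norm w)\<^sup>2 * \<epsilon> \<le> ((norm w)\<^sup>2 + 1) * \<epsilon>" using \<epsilon> by (simp add: distrib_right)
        also have "((norm w)\<^sup>2 + 1) * \<epsilon> = e / 2"
        proof -
          have "k * (e / (2 * k)) = e / 2" if "0 < k" for k :: real using that by simp
          then show ?thesis unfolding \<epsilon>_def using w1 .
        qed
        finally have "V n (m n) \<omega> \<le> e" by simp
        then show False using \<omega> by (auto simp: bad_def good_def)
      qed
    qed
    show ?thesis
    proof (rule tendsto_sandwich[of "\<lambda>_. 0"])
      show "(\<lambda>n. prob {\<omega>\<in>space M. \<epsilon> < \<bar>Q n \<omega>\<bar>} + prob {\<omega>\<in>space M. \<exists>j<m n. \<eta> < \<bar>U n j \<omega>\<bar>}) \<longlonglongrightarrow> 0"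
        using tendsto_add[OF energy[OF \<epsilon>] jump[OF \<eta>]] by simp
      show "\<forall>\<^sub>F n in sequentially. prob (bad e n) \<le>
          prob {\<omega>\<in>space M. \<epsilon> < \<bar>Q n \<omega>\<bar>} + prob {\<omega>\<in>space M. \<exists>j<m n. \<eta> < \<bar>U n j \<omega>\<bar>}"
        by (intro always_eventually allI order_trans[OF finite_measure_mono[OF sub] measure_Un_le]) measurable
    qed auto
  qed

  \<comment> \<open>Chebyshev's inequality for the stopped sum, which on good paths that stay in
    \<open>K\<close> equals \<open>w \<bullet> (Y q \<omega> - Y p \<omega>)\<close>. Refining the
    grid removes all of the bound but \<open>4 * e\<close>.\<close>
  have null: "prob {\<omega>\<in>stay K p q. w \<bullet> (Y q \<omega> - Y p \<omega>) < - \<eta>} \<le> 4 * e / \<eta>\<^sup>2"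
    if \<eta>: "0 < \<eta>" and e: "0 < e" for \<eta> e
  proof -
    have q: "0 \<le> q" by (simp add: q_def)
    have [measurable]: "Y p \<in> borel_measurable M" "Y q \<in> borel_measurable M"
      using measurable_G_M[OF Y_measurable] p q by auto
    have [measurable]: "stay K p q \<in> sets M" using sets_G_M[OF stay_measurable[OF K p q] q] .
    define E where "E = {\<omega>\<in>stay K p q. w \<bullet> (Y q \<omega> - Y p \<omega>) < - \<eta>}"
    have "E = stay K p q \<inter> {\<omega>\<in>space M. w \<bullet> (Y q \<omega> - Y p \<omega>) < - \<eta>}"
      by (auto simp: E_def stay_def)
    then have Em: "E \<in> events" by simp
    have ESm: "(\<lambda>\<omega>. (min (S e n (m n) \<omega>) 0)\<^sup>2) \<in> borel_measurable M" for n
      using measurable_G_M[OF Sm s_pos] by measurable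
    define bound where "bound n = prob (bad e n) + (4 * e + 2 * c\<^sup>2 * prob (bad e n) +
      (2 / e) * (24 * ((w $ 1)^4 + (w $ 2)^4) * ((q - p) * h n))) / \<eta>\<^sup>2" for n
    have E_le: "prob E \<le> bound n" for n
    proof -
      define E2 where "E2 = {\<omega>\<in>space M. \<eta>\<^sup>2 \<le> (min (S e n (m n) \<omega>) 0)\<^sup>2}"
      have E2m: "E2 \<in> events" unfolding E2_def using ESm by measurable
      have "E \<subseteq> bad e n \<union> E2"
      proof
        fix \<omega> assume \<omega>: "\<omega> \<in> E"
        then have sp: "\<omega> \<in> space M" by (auto simp: E_def stay_def)
        show "\<omega> \<in> bad e n \<union> E2"
        proof (cases "\<omega> \<in> good e n")
          case True
          have DD: "\<omega> \<in> D n j" if "j \<le> m n" for j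
            using \<omega> s_mono[OF that, of n] sm[of n] by (auto simp: E_def D_def stay_def)
          have "W e n j \<omega> = w \<bullet> (Y (s n (Suc j)) \<omega> - Y (s n j) \<omega>)" if "j < m n" for j
          proof -
            have "V n j \<omega> \<le> e" using V_mono[of j "m n" n \<omega>] True that by (auto simp: good_def)
            then show ?thesis using DD[of j] DD[of "Suc j"] that YB[of \<omega> n j] by (simp add: W_def u_def)
          qed
          then have "S e n (m n) \<omega> = (\<Sum>j<m n. w \<bullet> Y (s n (Suc j)) \<omega> - w \<bullet> Y (s n j) \<omega>)"
            unfolding S_def by (intro sum.cong) (auto simp: inner_diff_right)
          also have "\<dots> = w \<bullet> (Y q \<omega> - Y p \<omega>)"
            by (subst sum_lessThan_telescope) (simp add: sm s0 inner_diff_right)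
          finally have "S e n (m n) \<omega> < - \<eta>" using \<omega> by (simp add: E_def)
          then have "\<bar>\<eta>\<bar> \<le> \<bar>min (S e n (m n) \<omega>) 0\<bar>" using \<eta> by (simp add: min_def)
          then have "\<eta>\<^sup>2 \<le> (min (S e n (m n) \<omega>) 0)\<^sup>2" by (rule abs_le_square_iff[THEN iffD1])
          then show ?thesis using sp by (simp add: E2_def)
        next
          case False then show ?thesis using sp by (simp add: bad_def)
        qed
      qed
      then have "prob E \<le> prob (bad e n) + prob E2"
        using E2m by (intro order_trans[OF finite_measure_mono measure_Un_le]) auto
      also have "prob E2 \<le> (\<integral>\<omega>. (min (S e n (m n) \<omega>) 0)\<^sup>2 \<partial>M) / \<eta>\<^sup>2"
        unfolding E2_def using \<eta> est(1) by (intro integral_Markov_inequality_measure[of _ _ "{}"]) auto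
      also have "\<dots> \<le> (4 * e + 2 * c\<^sup>2 * prob (bad e n) +
          (2 / e) * (24 * ((w $ 1)^4 + (w $ 2)^4) * ((q - p) * h n))) / \<eta>\<^sup>2"
        by (intro divide_right_mono order_trans[OF est(2) sum_W2[OF e]]) simp
      finally show ?thesis by (simp add: bound_def)
    qed
    have "bound \<longlonglongrightarrow> 0 + (4 * e + 2 * c\<^sup>2 * 0 + (2 / e) * (24 * ((w $ 1)^4 + (w $ 2)^4) * ((q - p) * 0))) / \<eta>\<^sup>2"
      unfolding bound_def[abs_def] using bad0[OF e] h0 \<eta> by (intro tendsto_intros) auto
    then have "bound \<longlonglongrightarrow> 4 * e / \<eta>\<^sup>2" by simp
    then have "prob E \<le> 4 * e / \<eta>\<^sup>2"
      by (rule LIMSEQ_le_const) (use E_le in blast)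
    then show ?thesis unfolding E_def .
  qed

  have "AE \<omega> in M. \<not> (\<omega> \<in> stay K p q \<and> w \<bullet> (Y q \<omega> - Y p \<omega>) < - (1 / Suc k))" for k
  proof (rule AE_not_of_small_sets)
    fix \<epsilon> :: real assume \<epsilon>: "0 < \<epsilon>"
    \<comment> \<open>With these values the bound \<open>4 * e / \<eta>\<^sup>2\<close> becomes
      \<open>\<epsilon>\<close>.\<close>
    let ?\<eta> = "1 / real (Suc k)" and ?e = "\<epsilon> * (1 / real (Suc k))\<^sup>2 / 4"
    have q: "0 \<le> q" by (simp add: q_def)
    have [measurable]: "Y p \<in> borel_measurable M" "Y q \<in> borel_measurable M"
      using measurable_G_M[OF Y_measurable] p q by auto
    have [measurable]: "stay K p q \<in> sets M" using sets_G_M[OF stay_measurable[OF K p q] q] .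
    have "{\<omega>\<in>stay K p q. w \<bullet> (Y q \<omega> - Y p \<omega>) < - ?\<eta>} = stay K p q \<inter> {\<omega>\<in>space M. w \<bullet> (Y q \<omega> - Y p \<omega>) < - ?\<eta>}"
      by (auto simp: stay_def)
    then have "{\<omega>\<in>stay K p q. w \<bullet> (Y q \<omega> - Y p \<omega>) < - ?\<eta>} \<in> events" by simp
    moreover have "prob {\<omega>\<in>stay K p q. w \<bullet> (Y q \<omega> - Y p \<omega>) < - ?\<eta>} \<le> \<epsilon>"
      using null[of ?\<eta> ?e] \<epsilon> by simp
    ultimately show "\<exists>L\<in>events. prob L \<le> \<epsilon> \<and>
        (\<forall>\<omega>\<in>space M. \<omega> \<in> stay K p q \<and> w \<bullet> (Y q \<omega> - Y p \<omega>) < - ?\<eta> \<longrightarrow> \<omega> \<in> L)"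
      by (intro bexI[of _ "{\<omega>\<in>stay K p q. w \<bullet> (Y q \<omega> - Y p \<omega>) < - ?\<eta>}"]) auto
  qed
  then have "AE \<omega> in M. \<forall>k. \<not> (\<omega> \<in> stay K p q \<and> w \<bullet> (Y q \<omega> - Y p \<omega>) < - (1 / real (Suc k)))"
    unfolding AE_all_countable by blast
  then show ?thesis
    using AE_space
  proof eventually_elim
    case (elim \<omega>)
    show ?case
    proof (intro impI)
      assume "\<forall>t\<in>{real a / N0..real b / N0}. \<omega> t \<in> K"
      then have "\<omega> \<in> stay K p q" using elim(2) by (simp add: stay_def p_def q_def)
      then have "- (1 / real (Suc k)) \<le> w \<bullet> (Y q \<omega> - Y p \<omega>)" for k
        using elim(1) by (auto simp: not_less)
      then have "- (w \<bullet> (Y q \<omega> - Y p \<omega>)) \<le> inverse (real (Suc k))" for k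
        by (metis inverse_eq_divide minus_le_iff)
      then have "- (w \<bullet> (Y q \<omega> - Y p \<omega>)) \<le> 0"
        by (intro LIMSEQ_le_const[OF LIMSEQ_inverse_real_of_nat]) auto
      then show "0 \<le> w \<bullet> (Y (real b / N0) \<omega> - Y (real a / N0) \<omega>)" by (simp add: p_def q_def)
    qed
  qed
qed

end


text \<open>\<open>\<tau>\<close> is the infimum of the times below \<open>\<beta>\<close>, not the
  first time at \<open>\<beta>\<close>: the path has to be strictly below the level immediately
  afterwards, so that the next grid point notices the exit.\<close>

lemma first_passage_below:
  fixes \<phi> :: "real \<Rightarrow> real"
  assumes c: "continuous_on {p..r} \<phi>" and pr: "p \<le> r" and "\<beta> < \<phi> p" "\<phi> r < \<beta>"
  obtains \<tau> where "p \<le> \<tau>" "\<tau> \<le> r" "\<phi> \<tau> = \<beta>" "\<And>t. p \<le> t \<Longrightarrow> t \<le> \<tau> \<Longrightarrow> \<beta> \<le> \<phi> t"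
    "\<And>v. \<tau> < v \<Longrightarrow> \<exists>t\<in>{\<tau><..<v}. t \<le> r \<and> \<phi> t < \<beta>"
proof -
  define A where "A = {t\<in>{p..r}. \<phi> t < \<beta>}"
  define \<tau> where "\<tau> = Inf A"
  have rA: "r \<in> A" using assms by (simp add: A_def)
  have bdd: "bdd_below A" by (auto simp: A_def bdd_below_def)
  have p\<tau>: "p \<le> \<tau>" unfolding \<tau>_def using rA by (intro cInf_greatest) (auto simp: A_def)
  have \<tau>r: "\<tau> \<le> r" unfolding \<tau>_def using rA bdd by (rule cInf_lower)
  have before: "\<beta> \<le> \<phi> t" if "p \<le> t" "t < \<tau>" for t
  proof (rule ccontr)
    assume "\<not> \<beta> \<le> \<phi> t"
    then have "t \<in> A" using that \<tau>r by (simp add: A_def)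
    then show False using cInf_lower[OF _ bdd] that(2) unfolding \<tau>_def by fastforce
  qed
  have after: "\<exists>t\<in>A. \<tau> \<le> t \<and> t < v" if "\<tau> < v" for v
  proof -
    obtain t where "t \<in> A" "t < v"
      using cInf_lessD[of A v] \<open>\<tau> < v\<close> rA unfolding \<tau>_def by blast
    moreover have "\<tau> \<le> t" unfolding \<tau>_def using \<open>t \<in> A\<close> bdd by (rule cInf_lower)
    ultimately show ?thesis by blast
  qed
  have near: "\<exists>d>0. \<forall>t\<in>{p..r}. dist t \<tau> < d \<longrightarrow> dist (\<phi> t) (\<phi> \<tau>) < e" if "0 < e" for e
    using c p\<tau> \<tau>r that unfolding continuous_on_iff by (metis atLeastAtMost_iff)
  have ge: "\<beta> \<le> \<phi> \<tau>"
  proof (rule ccontr)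
    assume "\<not> \<beta> \<le> \<phi> \<tau>"
    then have e: "0 < \<beta> - \<phi> \<tau>" by simp
    obtain d where d: "0 < d" "\<forall>t\<in>{p..r}. dist t \<tau> < d \<longrightarrow> dist (\<phi> t) (\<phi> \<tau>) < \<beta> - \<phi> \<tau>"
      using near[OF e] by blast
    have "p < \<tau>" using p\<tau> assms(3) e by (cases "p = \<tau>") auto
    define t where "t = max p (\<tau> - d / 2)"
    have "p \<le> t" "t < \<tau>" "t \<in> {p..r}" "dist t \<tau> < d"
      using \<open>p < \<tau>\<close> d(1) \<tau>r by (auto simp: t_def dist_real_def)
    then have "dist (\<phi> t) (\<phi> \<tau>) < \<beta> - \<phi> \<tau>" "\<beta> \<le> \<phi> t" using d(2) before by auto
    then show False by (simp add: dist_real_def)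
  qed
  have le: "\<phi> \<tau> \<le> \<beta>"
  proof (rule ccontr)
    assume "\<not> \<phi> \<tau> \<le> \<beta>"
    then have e: "0 < \<phi> \<tau> - \<beta>" by simp
    obtain d where d: "0 < d" "\<forall>t\<in>{p..r}. dist t \<tau> < d \<longrightarrow> dist (\<phi> t) (\<phi> \<tau>) < \<phi> \<tau> - \<beta>"
      using near[OF e] by blast
    obtain t where t: "t \<in> A" "\<tau> \<le> t" "t < \<tau> + d" using after[of "\<tau> + d"] d(1) by auto
    then have "dist (\<phi> t) (\<phi> \<tau>) < \<phi> \<tau> - \<beta>" using d(2) by (auto simp: A_def dist_real_def)
    moreover have "\<phi> t < \<beta>" using t(1) by (simp add: A_def)
    ultimately show False unfolding dist_real_def by linarith
  qed
  show thesis
  proof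
    show "\<phi> \<tau> = \<beta>" using ge le by simp
    show "\<beta> \<le> \<phi> t" if "p \<le> t" "t \<le> \<tau>" for t
      using that before ge by (cases "t = \<tau>") auto
    show "\<exists>t\<in>{\<tau><..<v}. t \<le> r \<and> \<phi> t < \<beta>" if "\<tau> < v" for v
    proof -
      obtain t where t: "t \<in> A" "\<tau> \<le> t" "t < v" using after[OF \<open>\<tau> < v\<close>] by blast
      then have "t \<noteq> \<tau>" using ge by (auto simp: A_def)
      then show ?thesis using t by (intro bexI[of _ t]) (auto simp: A_def)
    qed
  qed (fact p\<tau> \<tau>r)+
qed

section \<open>Exit estimates and visits to the corner\<close>

context reflected_process begin

text \<open>
  Optional stopping at the exit time of \<open>K\<close>, again by discretisation: a path that leaves \<open>K\<close> where
  \<open>f\<close> is small has to be compensated by the paths where \<open>f\<close> is large.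
\<close>

lemma exit_estimate:
  assumes f: "test_fun \<xi> \<theta>1 \<theta>2 f" and K: "closed K" "closed K1" "K1 \<subseteq> K"
    and lap: "\<And>x. x \<in> K \<Longrightarrow> laplacian f x = 0" and low: "\<And>x. x \<in> K1 \<Longrightarrow> c0 \<le> f x"
    and up: "\<And>x. x \<in> wedge \<xi> \<Longrightarrow> f x \<le> cm" and c: "c0 \<le> cm" "\<beta> < c0"
    and ab: "(a::nat) < b" and N0: "0 < (N0::nat)"
  defines "p \<equiv> real a / N0" and "q \<equiv> real b / N0"
  shows "\<exists>L\<in>events. prob L \<le> (cm - c0 + 1) / (c0 - \<beta>) \<and> (\<forall>\<omega>\<in>space M. \<omega> p \<in> K1 \<and>
    (\<exists>\<tau>. p \<le> \<tau> \<and> \<tau> < q \<and> (\<forall>t\<in>{p..\<tau>}. \<omega> t \<in> K) \<and> f (\<omega> \<tau>) < \<beta> \<and>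
      (\<forall>v>\<tau>. \<exists>t\<in>{\<tau><..<v}. \<omega> t \<notin> K)) \<longrightarrow> \<omega> \<in> L)"
proof -
  define h where "h = grid_step N0"
  define m where "m n = (b - a) * Suc n" for n
  define s where "s = grid N0 a"
  have s_eq: "s n j = p + real j * h n" for n j by (simp add: s_def grid_def h_def p_def)
  have h: "0 < h n" for n unfolding h_def by (rule grid_step_pos[OF N0])
  have h0: "h \<longlonglongrightarrow> 0" unfolding h_def by (rule grid_step_tendsto)
  have p: "0 \<le> p" by (simp add: p_def)
  have s0: "s n 0 = p" for n by (simp add: s_eq)
  have sm: "s n (m n) = q" for n unfolding s_def m_def q_def by (rule grid_end[OF ab])
  have s_pos: "0 \<le> s n j" for n j using p h[of n] by (simp add: s_eq)
  have s_less: "s n j < s n (Suc j)" for n j using h[of n] by (simp add: s_eq algebra_simps)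
  have s_diff: "s n (Suc j) - s n j = h n" for n j by (simp add: s_eq algebra_simps)
  have s_mono: "i \<le> j \<Longrightarrow> s n i \<le> s n j" for n i j using h[of n] by (simp add: s_eq)
  define D where "D n j = stay K p (s n j)" for n j
  define A where "A = stay K1 p p"
  define \<Delta> where "\<Delta> n j \<omega> = compensated f (s n (Suc j)) \<omega> - compensated f (s n j) \<omega>" for n j \<omega>
  \<comment> \<open>The compensated process, stopped at the first grid point by which the path has
    left \<open>K\<close>.\<close>
  define F where "F n k \<omega> = (\<Sum>j<k. indicator (D n j) \<omega> * \<Delta> n j \<omega>)" for n k \<omega>
  have D: "D n j \<in> sets (G (s n j))" for n j
    unfolding D_def by (rule stay_measurable[OF K(1) p s_pos])
  have Dm[measurable]: "D n j \<in> sets M" for n j using sets_G_M[OF D s_pos] .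
  have A: "A \<in> sets (G p)" unfolding A_def by (rule stay_measurable[OF K(2) p p])
  then have Am[measurable]: "A \<in> sets M" using sets_G_M p by blast
  have As: "A \<in> sets (G (s n j))" for n j
    using A G_mono[OF p, of "s n j"] s_mono[of 0 j n] s0 by auto
  have \<Delta>m[measurable]: "\<Delta> n j \<in> borel_measurable M" for n j
    using s_pos unfolding \<Delta>_def by (intro borel_measurable_diff measurable_G_M[OF compensated_measurable[OF f]]) auto
  have Fm[measurable]: "F n k \<in> borel_measurable M" for n k unfolding F_def by measurable
  obtain C where C: "0 \<le> C" "\<And>x. x \<in> wedge \<xi> \<Longrightarrow> \<bar>laplacian f x\<bar> \<le> C"
    using test_fun_continuous(3)[OF f] by blast
  have path: "\<omega> \<in> path_space \<xi>" if "\<omega> \<in> space M" for \<omega> using that space_M by simp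
  have in_wedge: "\<omega> t \<in> wedge \<xi>" if "\<omega> \<in> space M" "0 \<le> t" for \<omega> t
    using path_continuous_on_Icc(2)[OF path[OF that(1)] that(2), of t] by auto
  have \<Delta>_eq: "\<Delta> n j \<omega> = f (\<omega> (s n (Suc j))) - f (\<omega> (s n j)) - 1/2 * integral {s n j..s n (Suc j)} (\<lambda>u. laplacian f (\<omega> u))"
    and \<Delta>_int: "\<bar>integral {s n j..s n (Suc j)} (\<lambda>u. laplacian f (\<omega> u))\<bar> \<le> C * h n"
    if "\<omega> \<in> space M" for n j \<omega>
    using compensated_diff[OF f path[OF that] s_pos less_imp_le[OF s_less]]
      compensator_bound[OF f path[OF that] s_pos less_imp_le[OF s_less] C(2), of n j]
    unfolding s_diff \<Delta>_def by auto
  have \<Delta>_D: "\<Delta> n j \<omega> = f (\<omega> (s n (Suc j))) - f (\<omega> (s n j))" if w: "\<omega> \<in> D n (Suc j)" for n j \<omega>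
  proof -
    have sp: "\<omega> \<in> space M" and K': "\<And>t. t \<in> {p..s n (Suc j)} \<Longrightarrow> \<omega> t \<in> K"
      using w by (auto simp: D_def stay_def)
    have ps: "p \<le> s n j" using s_mono[of 0 j n] s0 by simp
    have "integral {s n j..s n (Suc j)} (\<lambda>u. laplacian f (\<omega> u)) = integral {s n j..s n (Suc j)} (\<lambda>u. 0)"
      by (rule integral_cong) (use K' ps lap in auto)
    then show ?thesis unfolding \<Delta>_eq[OF sp] by simp
  qed
  have D_mono: "D n (Suc j) \<subseteq> D n j" for n j
    using s_less[of n j] by (auto simp: D_def stay_def)
  have F_Suc: "F n (Suc k) \<omega> = F n k \<omega> + indicator (D n k) \<omega> * \<Delta> n k \<omega>" for n k \<omega>
    by (simp add: F_def)
  \<comment> \<open>While the path stays in \<open>K\<close> the sum telescopes. In the leaving step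
    only the upper bound on \<open>f\<close> is available, and the compensator adds at most
    \<open>C * h n / 2\<close>.\<close>
  have F_claim: "(\<omega> \<in> D n k \<longrightarrow> F n k \<omega> = f (\<omega> (s n k)) - f (\<omega> p)) \<and>
      (\<omega> \<notin> D n k \<longrightarrow> F n k \<omega> \<le> cm - f (\<omega> p) + C * h n / 2)" if "\<omega> \<in> space M" "\<omega> p \<in> K" for n k \<omega>
  proof (induction k)
    case 0
    have "\<omega> \<in> D n 0" using that by (simp add: D_def stay_def s0)
    then show ?case by (simp add: F_def s0)
  next
    case (Suc k)
    consider "\<omega> \<in> D n (Suc k)" "\<omega> \<in> D n k" | "\<omega> \<in> D n k" "\<omega> \<notin> D n (Suc k)" | "\<omega> \<notin> D n k" "\<omega> \<notin> D n (Suc k)"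
      using D_mono by blast
    then show ?case
    proof cases
      case 1 then show ?thesis using Suc \<Delta>_D[of \<omega> n k] by (simp add: F_Suc)
    next
      case 2
      have "F n (Suc k) \<omega> = f (\<omega> (s n k)) - f (\<omega> p) + \<Delta> n k \<omega>" using 2 Suc by (simp add: F_Suc)
      then show ?thesis
        using up[OF in_wedge[OF that(1) s_pos], of n "Suc k"] \<Delta>_int[OF that(1), of n k] 2
        unfolding \<Delta>_eq[OF that(1)] by simp
    next
      case 3 then show ?thesis using Suc by (simp add: F_Suc)
    qed
  qed
  have F_up: "F n (m n) \<omega> \<le> cm - c0 + C * h n / 2" if "\<omega> \<in> A" for n \<omega>
  proof -
    have sp: "\<omega> \<in> space M" "\<omega> p \<in> K1" "\<omega> p \<in> K" using that K(3) by (auto simp: A_def stay_def)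
    have Ch: "0 \<le> C * h n" using C(1) h[of n] by simp
    have "F n (m n) \<omega> \<le> cm - f (\<omega> p) + C * h n / 2"
    proof (cases "\<omega> \<in> D n (m n)")
      case True
      then have "F n (m n) \<omega> = f (\<omega> (s n (m n))) - f (\<omega> p)" using F_claim[OF sp(1,3)] by blast
      then show ?thesis using up[OF in_wedge[OF sp(1) s_pos], of n "m n"] Ch by linarith
    qed (use F_claim[OF sp(1,3)] in blast)
    then show ?thesis using low[OF sp(2)] by linarith
  qed
  have Fi: "integrable M (\<lambda>\<omega>. indicator A \<omega> * (indicator (D n j) \<omega> * \<Delta> n j \<omega>))" for n j
  proof -
    obtain B where B: "\<And>\<omega>. \<omega> \<in> space M \<Longrightarrow> \<bar>\<Delta> n j \<omega>\<bar> \<le> B"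
      using compensated_diff_bounded[OF f s_pos less_imp_le[OF s_less], of n j] unfolding \<Delta>_def by blast
    show ?thesis
    proof (rule integrable_const_bound[of _ "\<bar>B\<bar>"])
      have "norm (indicator A \<omega> * (indicator (D n j) \<omega> * \<Delta> n j \<omega>)) \<le> \<bar>B\<bar>" if "\<omega> \<in> space M" for \<omega>
      proof -
        have "norm (indicator A \<omega> * (indicator (D n j) \<omega> * \<Delta> n j \<omega>)) \<le> \<bar>\<Delta> n j \<omega>\<bar>"
          by (simp add: indicator_def)
        also have "\<dots> \<le> \<bar>B\<bar>" using B[OF that] by linarith
        finally show ?thesis .
      qed
      then show "AE \<omega> in M. norm (indicator A \<omega> * (indicator (D n j) \<omega> * \<Delta> n j \<omega>)) \<le> \<bar>B\<bar>"
        by (rule AE_I2)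
    qed measurable
  qed
  have F_pos: "0 \<le> (\<integral>\<omega>. indicator A \<omega> * F n k \<omega> \<partial>M)" for n k
  proof -
    have "0 \<le> (\<integral>\<omega>. indicator A \<omega> * (indicator (D n j) \<omega> * \<Delta> n j \<omega>) \<partial>M)" for j
    proof -
      have "A \<inter> D n j \<in> sets (G (s n j))" using As D by blast
      then have m: "(indicator (A \<inter> D n j) :: path \<Rightarrow> real) \<in> borel_measurable (G (s n j))" by simp
      have i: "integrable M (indicator (A \<inter> D n j) :: path \<Rightarrow> real)"
        by (rule integrable_const_bound[of _ 1]) (auto simp: indicator_def)
      have "0 \<le> (\<integral>\<omega>. indicator (A \<inter> D n j) \<omega> * \<Delta> n j \<omega> \<partial>M)"
        unfolding \<Delta>_def by (rule compensated_drift[OF f s_pos less_imp_le[OF s_less] m _ i]) simp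
      then show ?thesis by (simp add: indicator_inter_arith mult.assoc)
    qed
    then have "0 \<le> (\<Sum>j<k. \<integral>\<omega>. indicator A \<omega> * (indicator (D n j) \<omega> * \<Delta> n j \<omega>) \<partial>M)"
      by (rule sum_nonneg)
    also have "\<dots> = (\<integral>\<omega>. (\<Sum>j<k. indicator A \<omega> * (indicator (D n j) \<omega> * \<Delta> n j \<omega>)) \<partial>M)"
      by (rule Bochner_Integration.integral_sum[symmetric]) (rule Fi)
    also have "\<dots> = (\<integral>\<omega>. indicator A \<omega> * F n k \<omega> \<partial>M)"
      by (simp only: F_def sum_distrib_left)
    finally show ?thesis .
  qed
  have Fint: "integrable M (\<lambda>\<omega>. indicator A \<omega> * F n k \<omega>)" for n k
    unfolding F_def sum_distrib_left using Fi by (intro Bochner_Integration.integrable_sum) auto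
  define B where "B n = {\<omega>\<in>space M. \<omega> \<in> A \<and> F n (m n) \<omega> \<le> \<beta> - c0}" for n
  have Bm[measurable]: "B n \<in> events" for n unfolding B_def by measurable
  have "\<forall>\<^sub>F n in sequentially. C * h n < 2"
    using order_tendstoD(2)[OF tendsto_mult_left[OF h0, of C], of 2] by simp
  then obtain n0 where n0: "\<And>n. n0 \<le> n \<Longrightarrow> C * h n < 2"
    by (auto simp: eventually_sequentially)
  \<comment> \<open>From \<open>n0\<close> on the compensator error is below 1, whence the summand
    1. The integral of \<open>F\<close> over \<open>A\<close> is nonnegative, while its integrand is
    at most \<open>cm - c0 + 1\<close>, and by \<open>c0 - \<beta>\<close> less on
    \<open>B n\<close>.\<close>
  have "prob (B n) \<le> (cm - c0 + 1) / (c0 - \<beta>)" if "n0 \<le> n" for n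
  proof -
    have iB: "integrable M (\<lambda>\<omega>. indicator (B n) \<omega> :: real)"
      by (rule integrable_const_bound[of _ 1]) (auto simp: indicator_def)
    have "0 \<le> (\<integral>\<omega>. indicator A \<omega> * F n (m n) \<omega> \<partial>M)" by (rule F_pos)
    also have "\<dots> \<le> (\<integral>\<omega>. (cm - c0 + 1) - (c0 - \<beta>) * indicator (B n) \<omega> \<partial>M)"
    proof (rule integral_mono)
      show "integrable M (\<lambda>\<omega>. (cm - c0 + 1) - (c0 - \<beta>) * indicator (B n) \<omega>)" using iB by simp
      show "integrable M (\<lambda>\<omega>. indicator A \<omega> * F n (m n) \<omega>)" by (rule Fint)
      fix \<omega> assume \<omega>: "\<omega> \<in> space M"
      show "indicator A \<omega> * F n (m n) \<omega> \<le> (cm - c0 + 1) - (c0 - \<beta>) * indicator (B n) \<omega>"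
      proof (cases "\<omega> \<in> A")
        case True
        then show ?thesis
          using F_up[OF True, of n] n0[OF that] c \<omega> by (cases "\<omega> \<in> B n") (auto simp: B_def)
      next
        case False then show ?thesis using c by (simp add: B_def)
      qed
    qed
    also have "\<dots> = (cm - c0 + 1) - (c0 - \<beta>) * prob (B n)" using iB by (simp add: prob_space)
    finally show ?thesis using c(2) by (simp add: field_simps)
  qed
  from prob_liminf_le[OF Bm this] obtain L where L: "L \<in> events" "prob L \<le> (cm - c0 + 1) / (c0 - \<beta>) \<and>
    (\<forall>\<omega>\<in>space M. (\<forall>\<^sub>F n in sequentially. \<omega> \<in> B n) \<longrightarrow> \<omega> \<in> L)" by (rule bexE)
  have ev_B: "\<forall>\<^sub>F n in sequentially. \<omega> \<in> B n"
    if sp: "\<omega> \<in> space M" and p1: "\<omega> p \<in> K1" and \<tau>: "p \<le> \<tau>" "\<tau> < q" "\<forall>t\<in>{p..\<tau>}. \<omega> t \<in> K" "f (\<omega> \<tau>) < \<beta>"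
      "\<forall>v>\<tau>. \<exists>t\<in>{\<tau><..<v}. \<omega> t \<notin> K" for \<omega> \<tau>
  proof -
    have A': "\<omega> \<in> A" using sp p1 by (simp add: A_def stay_def)
    have pK: "\<omega> p \<in> K" using p1 K(3) by blast
    define g where "g = \<beta> - f (\<omega> \<tau>)"
    have g: "0 < g" using \<tau>(4) by (simp add: g_def)
    have "continuous_on {p..q} (\<lambda>t. f (\<omega> t))"
      by (intro continuous_on_compose2[OF test_fun_continuous(1)[OF f]] path_continuous_on_Icc[OF path[OF sp] p])
    moreover have "\<tau> \<in> {p..q}" using \<tau> by simp
    ultimately obtain d where d: "0 < d" "\<And>t. t \<in> {p..q} \<Longrightarrow> dist t \<tau> < d \<Longrightarrow> dist (f (\<omega> t)) (f (\<omega> \<tau>)) < g / 2"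
      using g unfolding continuous_on_iff by (metis half_gt_zero)
    have "\<forall>\<^sub>F n in sequentially. h n < d" using order_tendstoD(2)[OF h0 d(1)] .
    moreover have "\<forall>\<^sub>F n in sequentially. C * h n < g"
      using order_tendstoD(2)[OF tendsto_mult_left[OF h0, of C], of g] g by simp
    ultimately show ?thesis
    proof eventually_elim
      case (elim n)
      \<comment> \<open>The exit time lies in the step that ends at index \<open>k\<close>. Since
        the path leaves \<open>K\<close> immediately after \<open>\<tau>\<close>, the sum stops
        there, at a value of \<open>f\<close> close to \<open>f (\<omega> \<tau>)\<close>.\<close>
      define k where "k = (LEAST k. \<tau> < s n k)"
      have ex: "\<tau> < s n (m n)" using \<tau>(2) sm by simp
      have k: "\<tau> < s n k" unfolding k_def by (rule LeastI[of _ "m n"]) (rule ex)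
      have km: "k \<le> m n" unfolding k_def by (rule Least_le) (rule ex)
      have k0: "k \<noteq> 0" using k \<tau>(1) s0[of n] by (metis not_less)
      then obtain l where l: "k = Suc l" using not0_implies_Suc by blast
      have lt: "s n j \<le> \<tau>" if "j < k" for j
        using not_less_Least[of j "\<lambda>k. \<tau> < s n k"] that by (simp add: k_def)
      have inD: "\<omega> \<in> D n j" if "j < k" for j
        using lt[OF that] \<tau>(3) sp by (auto simp: D_def stay_def)
      have notD: "\<omega> \<notin> D n j" if "k \<le> j" for j
      proof -
        have "\<tau> < s n j" using k s_mono[OF that, of n] by simp
        then obtain t where "t \<in> {\<tau><..<s n j}" "\<omega> t \<notin> K" using \<tau>(5) by blast
        then show ?thesis using \<tau>(1) by (auto simp: D_def stay_def)
      qed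
      have "F n (m n) \<omega> = (\<Sum>j\<in>{..<k}. indicator (D n j) \<omega> * \<Delta> n j \<omega>)"
        unfolding F_def using km notD by (intro sum.mono_neutral_right) auto
      also have "\<dots> = F n l \<omega> + \<Delta> n l \<omega>" using inD[of l] by (simp add: l F_def)
      also have "F n l \<omega> = f (\<omega> (s n l)) - f (\<omega> p)"
        using F_claim[OF sp pK, of n l] inD[of l] l by simp
      finally have "F n (m n) \<omega> = f (\<omega> (s n k)) - f (\<omega> p) - 1/2 * integral {s n l..s n (Suc l)} (\<lambda>u. laplacian f (\<omega> u))"
        unfolding \<Delta>_eq[OF sp] l by simp
      moreover have "dist (f (\<omega> (s n k))) (f (\<omega> \<tau>)) < g / 2"
      proof (rule d(2))
        show "s n k \<in> {p..q}" using k \<tau>(1) s_mono[OF km, of n] sm by auto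
        show "dist (s n k) \<tau> < d"
          using k lt[of l] l s_diff[of n l] elim(1) by (simp add: dist_real_def)
      qed
      ultimately have "F n (m n) \<omega> \<le> \<beta> - f (\<omega> p)"
        using abs_le_D2[OF \<Delta>_int[OF sp, of n l]] elim(2) abs_ge_self[of "f (\<omega> (s n k)) - f (\<omega> \<tau>)"]
        unfolding dist_real_def g_def by argo
      then show ?case using A' low[OF p1] sp by (simp add: B_def)
    qed
  qed
  have "\<omega> \<in> L" if "\<omega> \<in> space M" "\<omega> p \<in> K1 \<and> (\<exists>\<tau>. p \<le> \<tau> \<and> \<tau> < q \<and> (\<forall>t\<in>{p..\<tau>}. \<omega> t \<in> K) \<and>
    f (\<omega> \<tau>) < \<beta> \<and> (\<forall>v>\<tau>. \<exists>t\<in>{\<tau><..<v}. \<omega> t \<notin> K))" for \<omega>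
    using that(2)
    by (elim conjE exE) (rule L(2)[THEN conjunct2, rule_format, OF that(1) ev_B[OF that(1)]]; assumption)
  then show ?thesis using L by blast
qed

text \<open>The test functions are bounded above uniformly in the lower level and in the angular
  margin, while approaching the corner means passing below every level. The margins tend to zero; a
  path that avoids the cut-off side is captured by all small margins, because its angle attains a
  maximum on a compact time interval.\<close>

lemma corner_not_reached_aux:
  assumes cs: "(\<sigma> = 1 \<and> c = tan \<theta>1) \<or> (\<sigma> = - 1 \<and> c = - tan \<theta>2)"
    and ab: "(a::nat) < b" and N0: "0 < (N0::nat)"
  defines "p \<equiv> real a / N0" and "q \<equiv> real b / N0"
  shows "AE \<omega> in M. \<not> (\<exists>u\<in>{p<..q}. \<omega> u = 0 \<and> - real k \<le> log_potential \<xi> c (\<omega> p) \<and>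
    (\<forall>t\<in>{p..<u}. \<omega> t \<noteq> 0 \<and> \<sigma> * angle \<xi> (\<omega> t) < \<xi> / 2 \<and> log_potential \<xi> c (\<omega> t) \<le> real k))"
proof (rule AE_not_of_small_sets)
  fix \<epsilon> :: real assume \<epsilon>: "0 < \<epsilon>"
  have p: "0 \<le> p" by (simp add: p_def)
  \<comment> \<open>Solves \<open>(2 * k + 3) / (- k - (\<beta> + 1)) = \<epsilon>\<close>, the
    bound of \<open>exit_estimate\<close> with upper bound \<open>k + 2\<close>, starting level
    \<open>- k\<close> and exit level \<open>\<beta> + 1\<close>. The exit level lies one above
    \<open>\<beta>\<close> because the potential equals \<open>\<beta>\<close> at the passage and a
    strict inequality is required.\<close>
  define \<beta> where "\<beta> = - real k - 1 - (2 * real k + 3) / \<epsilon>"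
  have \<beta>: "\<beta> + 1 < - real k" using \<epsilon> by (simp add: \<beta>_def add_nonneg_pos)
  \<comment> \<open>Then \<open>3 * \<delta> j\<close> is \<open>\<xi> / Suc j\<close>, which tends
    to zero, and \<open>2 * \<delta> j < \<xi>\<close> for every \<open>j\<close>.\<close>
  define \<delta> where "\<delta> j = \<xi> / (3 * real (Suc j))" for j
  have \<delta>: "0 < \<delta> j" "2 * \<delta> j < \<xi>" for j
    using wedge_angle(1) by (simp_all add: \<delta>_def field_simps add_pos_nonneg)
  define f where "f j = log_cutoff \<xi> c \<sigma> \<beta> (real k) (\<delta> j)" for j
  define K where "K j = log_region \<xi> c \<sigma> \<beta> (real k) (\<delta> j)" for j
  define K1 where "K1 j = log_region \<xi> c \<sigma> (- real k) (real k) (\<delta> j)" for j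
  have K1K: "K1 j \<subseteq> K j" for j
  proof
    fix x assume x: "x \<in> K1 j"
    have "exp (\<beta> - \<bar>c\<bar> * (pi / 2)) \<le> exp (- real k - \<bar>c\<bar> * (pi / 2))" using \<beta> by simp
    moreover have "exp (- real k - \<bar>c\<bar> * (pi / 2)) \<le> norm x"
      using x unfolding K1_def log_region_def by blast
    ultimately have "exp (\<beta> - \<bar>c\<bar> * (pi / 2)) \<le> norm x" by (rule order_trans)
    then show "x \<in> K j" using x \<beta> by (auto simp: K1_def K_def log_region_def)
  qed
  have K: "closed (K j)" "closed (K1 j)" for j
    unfolding K_def K1_def by (intro closed_log_region[OF wedge_angle])+
  have f: "test_fun \<xi> \<theta>1 \<theta>2 (f j)" for j
    unfolding f_def by (rule test_fun_log_cutoff[OF wedge_angle \<delta> cs])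
  have lap: "laplacian (f j) x = 0" "f j x = log_potential \<xi> c x" if "x \<in> K j" for j x
    using log_cutoff_log_region[OF wedge_angle \<delta>(1)] that by (auto simp: K_def f_def)
  have low: "- real k \<le> f j x" if "x \<in> K1 j" for j x
  proof -
    have "x \<in> K j" using K1K that by blast
    then show ?thesis using lap(2)[of x j] that by (simp add: K1_def log_region_def)
  qed
  have up: "f j x \<le> real k + 2" for j x
    unfolding f_def by (rule log_cutoff_le) simp
  have "\<exists>L\<in>events. prob L \<le> ((real k + 2) - (- real k) + 1) / (- real k - (\<beta> + 1)) \<and> (\<forall>\<omega>\<in>space M. \<omega> p \<in> K1 j \<and>
    (\<exists>\<tau>. p \<le> \<tau> \<and> \<tau> < q \<and> (\<forall>t\<in>{p..\<tau>}. \<omega> t \<in> K j) \<and> f j (\<omega> \<tau>) < \<beta> + 1 \<and>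
      (\<forall>v>\<tau>. \<exists>t\<in>{\<tau><..<v}. \<omega> t \<notin> K j)) \<longrightarrow> \<omega> \<in> L)" for j
    unfolding p_def q_def
    by (rule exit_estimate[OF f K K1K lap(1) low up _ \<beta> ab N0]) auto
  then obtain L where L: "\<And>j. L j \<in> events" "\<And>j. prob (L j) \<le> ((real k + 2) - (- real k) + 1) / (- real k - (\<beta> + 1))"
    "\<And>j \<omega>. \<omega> \<in> space M \<Longrightarrow> \<omega> p \<in> K1 j \<Longrightarrow>
    (\<exists>\<tau>. p \<le> \<tau> \<and> \<tau> < q \<and> (\<forall>t\<in>{p..\<tau>}. \<omega> t \<in> K j) \<and> f j (\<omega> \<tau>) < \<beta> + 1 \<and>
      (\<forall>v>\<tau>. \<exists>t\<in>{\<tau><..<v}. \<omega> t \<notin> K j)) \<Longrightarrow> \<omega> \<in> L j" by metis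
  have "((real k + 2) - (- real k) + 1) / (- real k - (\<beta> + 1)) = \<epsilon>"
    using \<epsilon> by (simp add: \<beta>_def field_simps)
  with L(2) have "prob (L j) \<le> \<epsilon>" for j by simp
  from prob_liminf_le[OF L(1) this] obtain L' where L': "L' \<in> events" "prob L' \<le> \<epsilon> \<and>
    (\<forall>\<omega>\<in>space M. (\<forall>\<^sub>F j in sequentially. \<omega> \<in> L j) \<longrightarrow> \<omega> \<in> L')" by (rule bexE)
  have "\<forall>\<^sub>F j in sequentially. \<omega> \<in> L j"
    if sp: "\<omega> \<in> space M" and u: "p < u" "u \<le> q" "\<omega> u = 0" and kp: "- real k \<le> log_potential \<xi> c (\<omega> p)"
      and before: "\<And>t. p \<le> t \<Longrightarrow> t < u \<Longrightarrow> \<omega> t \<noteq> 0 \<and> \<sigma> * angle \<xi> (\<omega> t) < \<xi> / 2 \<and> log_potential \<xi> c (\<omega> t) \<le> real k"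
    for \<omega> u
  proof -
    have path: "\<omega> \<in> path_space \<xi>" using sp space_M by simp
    have wd: "\<omega> t \<in> wedge \<xi>" if "p \<le> t" for t
      using path_continuous_on_Icc(2)[OF path, of t t] that p by auto
    have bis: "0 < bisector \<xi> \<bullet> \<omega> t" if "p \<le> t" "t < u" for t
      using wedge_bisector_pos[OF wd wedge_angle] before that by auto
    have "continuous_on {p..u} \<omega>" by (rule path_continuous_on_Icc(1)[OF path p])
    then obtain d where d: "0 < d" "\<And>t. t \<in> {p..u} \<Longrightarrow> dist t u < d \<Longrightarrow> dist (\<omega> t) (\<omega> u) < exp (\<beta> - 1 - \<bar>c\<bar> * (pi / 2))"
      using u(1) unfolding continuous_on_iff by (metis atLeastAtMost_iff exp_gt_zero less_imp_le order_refl)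
    \<comment> \<open>A time shortly before \<open>u\<close>: the potential is already below
      \<open>\<beta>\<close>, and up to this time the path stays in the half-plane where potential
      and angle are continuous.\<close>
    define r where "r = max p (u - d / 2)"
    have r: "p \<le> r" "r < u" using u(1) d(1) by (auto simp: r_def)
    have "dist r u < d" using r d(1) by (auto simp: r_def dist_real_def)
    then have nr: "norm (\<omega> r) < exp (\<beta> - 1 - \<bar>c\<bar> * (pi / 2))"
      using d(2)[of r] r u(3) by simp
    moreover have "0 < norm (\<omega> r)" using before[OF r] by simp
    ultimately have "ln (norm (\<omega> r)) < \<beta> - 1 - \<bar>c\<bar> * (pi / 2)"
      by (metis exp_less_cancel_iff exp_ln)
    then have \<phi>r: "log_potential \<xi> c (\<omega> r) < \<beta>"
      using log_potential_bounds[OF bis[OF r], of c] by linarith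
    have cr: "continuous_on {p..r} \<omega>" by (rule path_continuous_on_Icc(1)[OF path p])
    have img: "\<omega> ` {p..r} \<subseteq> {x. 0 < bisector \<xi> \<bullet> x}" using bis r by auto
    have c\<phi>: "continuous_on {p..r} (\<lambda>t. log_potential \<xi> c (\<omega> t))"
      by (rule continuous_on_compose2[OF continuous_on_log_potential cr img])
    have "\<beta> < log_potential \<xi> c (\<omega> p)" using kp \<beta> by linarith
    from first_passage_below[OF c\<phi> r(1) this \<phi>r]
    obtain \<tau> where \<tau>: "p \<le> \<tau>" "\<tau> \<le> r" "log_potential \<xi> c (\<omega> \<tau>) = \<beta>"
      "\<And>t. p \<le> t \<Longrightarrow> t \<le> \<tau> \<Longrightarrow> \<beta> \<le> log_potential \<xi> c (\<omega> t)"
      "\<And>v. \<tau> < v \<Longrightarrow> \<exists>t\<in>{\<tau><..<v}. t \<le> r \<and> log_potential \<xi> c (\<omega> t) < \<beta>" by blast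
    have "continuous_on {p..r} (\<lambda>t. \<sigma> * angle \<xi> (\<omega> t))"
      by (intro continuous_intros continuous_on_compose2[OF continuous_on_angle cr img])
    then obtain x where x: "x \<in> {p..r}" "\<And>t. t \<in> {p..r} \<Longrightarrow> \<sigma> * angle \<xi> (\<omega> t) \<le> \<sigma> * angle \<xi> (\<omega> x)"
      using continuous_attains_sup[of "{p..r}" "\<lambda>t. \<sigma> * angle \<xi> (\<omega> t)"] r(1) by auto
    have gap: "0 < \<xi> / 2 - \<sigma> * angle \<xi> (\<omega> x)" using before[of x] x(1) r by auto
    have "(\<lambda>j. \<xi> * inverse (real (Suc j))) \<longlonglongrightarrow> \<xi> * 0"
      by (intro tendsto_mult tendsto_const LIMSEQ_inverse_real_of_nat)
    from order_tendstoD(2)[OF this, of "\<xi> / 2 - \<sigma> * angle \<xi> (\<omega> x)"] gap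
    have "\<forall>\<^sub>F j in sequentially. \<xi> * inverse (real (Suc j)) < \<xi> / 2 - \<sigma> * angle \<xi> (\<omega> x)"
      by simp
    then show ?thesis
    proof eventually_elim
      case (elim j)
      have "3 * (x / (3 * y)) = x * inverse y" for x y :: real
        by (cases "y = 0") (simp_all add: field_simps)
      then have "3 * \<delta> j = \<xi> * inverse (real (Suc j))" unfolding \<delta>_def .
      then have ang: "\<sigma> * angle \<xi> (\<omega> t) \<le> \<xi> / 2 - 3 * \<delta> j" if "p \<le> t" "t \<le> r" for t
        using x(2)[of t] elim that by simp
      have inK: "\<omega> t \<in> K j" if "p \<le> t" "t \<le> \<tau>" for t
        using that \<tau>(2) r before[of t] ang[of t] \<tau>(4)[of t]
        by (simp add: K_def log_region_iff[OF wedge_angle wd[OF that(1)]])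
      show ?case
      proof (rule L(3)[OF sp])
        show "\<omega> p \<in> K1 j"
          using r before[of p] ang[of p] kp u(1)
          by (simp add: K1_def log_region_iff[OF wedge_angle wd[OF order_refl]])
        show "\<exists>\<tau>. p \<le> \<tau> \<and> \<tau> < q \<and> (\<forall>t\<in>{p..\<tau>}. \<omega> t \<in> K j) \<and> f j (\<omega> \<tau>) < \<beta> + 1 \<and>
            (\<forall>v>\<tau>. \<exists>t\<in>{\<tau><..<v}. \<omega> t \<notin> K j)"
        proof (intro exI[of _ \<tau>] conjI allI impI ballI)
          show "p \<le> \<tau>" "\<tau> < q" using \<tau> r u by auto
          show "\<omega> t \<in> K j" if "t \<in> {p..\<tau>}" for t using inK that by simp
          show "f j (\<omega> \<tau>) < \<beta> + 1" using lap(2)[OF inK[OF \<tau>(1) order_refl]] \<tau>(3) by simp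
          fix v assume "\<tau> < v"
          then obtain t where "t \<in> {\<tau><..<v}" "t \<le> r" "log_potential \<xi> c (\<omega> t) < \<beta>" using \<tau>(5) by blast
          then show "\<exists>t\<in>{\<tau><..<v}. \<omega> t \<notin> K j"
            by (intro bexI[of _ t]) (auto simp: K_def log_region_def)
        qed
      qed
    qed
  qed
  then show "\<exists>L\<in>events. prob L \<le> \<epsilon> \<and> (\<forall>\<omega>\<in>space M. (\<exists>u\<in>{p<..q}. \<omega> u = 0 \<and> - real k \<le> log_potential \<xi> c (\<omega> p) \<and>
    (\<forall>t\<in>{p..<u}. \<omega> t \<noteq> 0 \<and> \<sigma> * angle \<xi> (\<omega> t) < \<xi> / 2 \<and> log_potential \<xi> c (\<omega> t) \<le> real k)) \<longrightarrow> \<omega> \<in> L)"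
    using L' by (intro bexI[of _ L'] conjI ballI impI) (auto simp: Ball_def)
qed

text \<open>Countably many parameters suffice: a rational \<open>p\<close>, a rational bound for
  \<open>u\<close>, and an integer bound for the potential, which exists because the path is bounded
  on \<open>{p..u}\<close> and the potential is finite at time \<open>p\<close>.\<close>

lemma corner_not_reached:
  assumes cs: "(\<sigma> = 1 \<and> c = tan \<theta>1) \<or> (\<sigma> = - 1 \<and> c = - tan \<theta>2)"
  shows "AE \<omega> in M. \<forall>p u. p \<in> \<rat> \<longrightarrow> 0 \<le> p \<longrightarrow> p < u \<longrightarrow> \<omega> u = 0 \<longrightarrow> (\<forall>t\<in>{p..<u}. \<omega> t \<noteq> 0) \<longrightarrow>
    (\<exists>t\<in>{p..<u}. \<xi> / 2 \<le> \<sigma> * angle \<xi> (\<omega> t))"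
proof -
  have "AE \<omega> in M. \<forall>a b N0 k. a < b \<longrightarrow> 0 < N0 \<longrightarrow>
    \<not> (\<exists>u\<in>{real a / real N0<..real b / real N0}. \<omega> u = 0 \<and> - real k \<le> log_potential \<xi> c (\<omega> (real a / real N0)) \<and>
    (\<forall>t\<in>{real a / real N0..<u}. \<omega> t \<noteq> 0 \<and> \<sigma> * angle \<xi> (\<omega> t) < \<xi> / 2 \<and> log_potential \<xi> c (\<omega> t) \<le> real k))"
    unfolding AE_all_countable
  proof (intro allI)
    fix a b N0 k :: nat
    show "AE \<omega> in M. a < b \<longrightarrow> 0 < N0 \<longrightarrow>
      \<not> (\<exists>u\<in>{real a / real N0<..real b / real N0}. \<omega> u = 0 \<and> - real k \<le> log_potential \<xi> c (\<omega> (real a / real N0)) \<and>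
      (\<forall>t\<in>{real a / real N0..<u}. \<omega> t \<noteq> 0 \<and> \<sigma> * angle \<xi> (\<omega> t) < \<xi> / 2 \<and> log_potential \<xi> c (\<omega> t) \<le> real k))"
      using corner_not_reached_aux[OF cs, of a b N0 k] by (cases "a < b \<and> 0 < N0") auto
  qed
  then show ?thesis
    using AE_space
  proof eventually_elim
    case (elim \<omega>)
    show ?case
    proof (intro allI impI, rule ccontr)
      fix p u assume p: "p \<in> \<rat>" "0 \<le> p" and u: "p < u" "\<omega> u = 0" and nz: "\<forall>t\<in>{p..<u}. \<omega> t \<noteq> 0"
        and no: "\<not> (\<exists>t\<in>{p..<u}. \<xi> / 2 \<le> \<sigma> * angle \<xi> (\<omega> t))"
      obtain a N0 :: nat where N0: "0 < N0" and pa: "p = real a / real N0"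
        using Rats_abs_nat_div_natE[OF p(1)] p(2) by (metis abs_of_nonneg gr0I)
      obtain b where b: "real N0 * u \<le> real b" using real_arch_simple by blast
      then have ub: "u \<le> real b / real N0" using N0 by (simp add: field_simps)
      have "real a < real b" using ub u(1) N0 unfolding pa by (metis divide_less_cancel less_le_trans of_nat_0_less_iff order.asym)
      then have ab: "a < b" by simp
      have path: "\<omega> \<in> path_space \<xi>" using elim(2) space_M by simp
      have "compact (\<omega> ` {p..u})"
        by (intro compact_continuous_image path_continuous_on_Icc(1)[OF path p(2)]) auto
      then obtain R where R: "0 < R" "\<And>t. t \<in> {p..u} \<Longrightarrow> norm (\<omega> t) \<le> R"
        using compact_imp_bounded bounded_pos by (metis imageI)
      have wd: "\<omega> t \<in> wedge \<xi>" if "p \<le> t" for t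
        using path_continuous_on_Icc(2)[OF path, of t t] that p by auto
      have bis: "0 < bisector \<xi> \<bullet> \<omega> t" if "t \<in> {p..<u}" for t
        using wedge_bisector_pos[OF wd wedge_angle] nz that by auto
      obtain k :: nat where k: "max (ln R + \<bar>c\<bar> * (pi / 2)) (- log_potential \<xi> c (\<omega> p)) \<le> real k"
        using real_arch_simple by blast
      have "log_potential \<xi> c (\<omega> t) \<le> real k" if "t \<in> {p..<u}" for t
      proof -
        have "ln (norm (\<omega> t)) \<le> ln R"
          using nz that R by (subst ln_le_cancel_iff) auto
        then show ?thesis using log_potential_bounds[OF bis[OF that], of c] k by linarith
      qed
      then have "\<exists>u\<in>{real a / real N0<..real b / real N0}. \<omega> u = 0 \<and> - real k \<le> log_potential \<xi> c (\<omega> (real a / real N0)) \<and>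
          (\<forall>t\<in>{real a / real N0..<u}. \<omega> t \<noteq> 0 \<and> \<sigma> * angle \<xi> (\<omega> t) < \<xi> / 2 \<and> log_potential \<xi> c (\<omega> t) \<le> real k)"
        using u ub nz no k unfolding pa by (intro bexI[of _ u]) auto
      then show False using elim(1) ab N0 by blast
    qed
  qed
qed

lemma sides_hit_before_corner:
  "AE \<omega> in M. \<forall>p u. p \<in> \<rat> \<longrightarrow> 0 \<le> p \<longrightarrow> p < u \<longrightarrow> \<omega> u = 0 \<longrightarrow> (\<forall>t\<in>{p..<u}. \<omega> t \<noteq> 0) \<longrightarrow>
    (\<exists>t\<in>{p..<u}. \<omega> t \<in> side1) \<and> (\<exists>t\<in>{p..<u}. \<omega> t \<in> side2 \<xi>)"
  using corner_not_reached[OF disjI1[OF conjI[OF refl refl]]]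
    corner_not_reached[OF disjI2[OF conjI[OF refl refl]]] AE_space
proof eventually_elim
  case (elim \<omega>)
  show ?case
  proof (intro allI impI)
    fix p u assume p: "p \<in> \<rat>" "0 \<le> p" and u: "p < u" "\<omega> u = 0" and nz: "\<forall>t\<in>{p..<u}. \<omega> t \<noteq> 0"
    have path: "\<omega> \<in> path_space \<xi>" using elim(3) space_M by simp
    have wd: "\<omega> t \<in> wedge \<xi>" if "p \<le> t" for t
      using path_continuous_on_Icc(2)[OF path, of t t] that p by auto
    obtain t where t: "t \<in> {p..<u}" "\<xi> / 2 \<le> 1 * angle \<xi> (\<omega> t)" using elim(1) p u nz by blast
    then have "\<omega> t \<in> side2 \<xi>"
      using wedge_angle_le(1)[OF wd[of t] wedge_angle] nz by (intro wedge_angle_le(3)[OF wd wedge_angle]) auto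
    moreover obtain t' where t': "t' \<in> {p..<u}" "\<xi> / 2 \<le> - 1 * angle \<xi> (\<omega> t')" using elim(2) p u nz by blast
    then have "\<omega> t' \<in> side1"
      using wedge_angle_le(1)[OF wd[of t'] wedge_angle] nz by (intro wedge_angle_le(2)[OF wd wedge_angle]) auto
    ultimately show "(\<exists>t\<in>{p..<u}. \<omega> t \<in> side1) \<and> (\<exists>t\<in>{p..<u}. \<omega> t \<in> side2 \<xi>)"
      using t(1) t'(1) by blast
  qed
qed

end


section \<open>From local increments to the extended Skorokhod problem\<close>

lemma cone_ray: "cone (ray v)"
proof -
  have "c * a \<ge> 0" if "0 \<le> c" "0 \<le> a" for c a :: real using that by simp
  then show ?thesis unfolding cone_def ray_def by (auto simp: scaleR_scaleR)
qed

lemma cone_UN: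
  assumes "\<And>u. cone (D u)"
  shows "cone (\<Union>u\<in>A. D u)"
  unfolding cone_def
proof (intro ballI allI impI)
  fix x and c :: real assume "x \<in> (\<Union>u\<in>A. D u)" "0 \<le> c"
  then obtain u where "u \<in> A" "x \<in> D u" by blast
  then show "c *\<^sub>R x \<in> (\<Union>u\<in>A. D u)" using mem_cone[OF assms _ \<open>0 \<le> c\<close>] by blast
qed

lemma cone_refl_cone: "cone V \<Longrightarrow> cone (refl_cone \<xi> \<theta>1 \<theta>2 V z)"
  by (simp add: refl_cone_def cone_ray) (simp add: cone_def)

lemma zero_in_ray: "0 \<in> ray v"
  by (auto simp: ray_def intro: exI[of _ 0])

lemma zero_in_refl_cone: "cone V \<Longrightarrow> V \<noteq> {} \<Longrightarrow> 0 \<in> refl_cone \<xi> \<theta>1 \<theta>2 V z"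
  by (simp add: refl_cone_def zero_in_ray cone_contains_0)

lemma countable_subcover:
  fixes K :: "real^2 \<Rightarrow> (real^2) set"
  assumes "\<And>x. x \<in> R \<Longrightarrow> x \<in> interior (K x)"
  obtains T where "countable T" "T \<subseteq> R" "\<And>y. y \<in> R \<Longrightarrow> \<exists>x\<in>T. y \<in> interior (K x)"
proof -
  obtain F where F: "F \<subseteq> (\<lambda>x. interior (K x)) ` R" "countable F" "\<Union>F = \<Union>((\<lambda>x. interior (K x)) ` R)"
    by (rule Lindelof[of "(\<lambda>x. interior (K x)) ` R"]) auto
  then obtain T where T: "countable T" "T \<subseteq> R" "F = (\<lambda>x. interior (K x)) ` T"
    using countable_subset_image[of F "\<lambda>x. interior (K x)" R] by auto
  have "\<exists>x\<in>T. y \<in> interior (K x)" if "y \<in> R" for y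
  proof -
    have "y \<in> \<Union>F" unfolding F(3) using assms[OF that] that by blast
    then show ?thesis by (auto simp: T(3))
  qed
  then show thesis using that T by blast
qed

text \<open>Countability allows the exceptional null sets to be united. Lindelof's theorem is
  applied separately to the points with each of the three possible cones, so that the centre of a
  covering set has the same cone as the point it covers.\<close>

lemma countable_linear_cover:
  assumes \<xi>: "0 < \<xi>" "\<xi> < pi"
  obtains T :: "(real^2) set" and K W where "countable T" "\<And>x. x \<in> T \<Longrightarrow> closed (K x)" "\<And>x. x \<in> T \<Longrightarrow> finite (W x)"
    "\<And>x w. x \<in> T \<Longrightarrow> w \<in> W x \<Longrightarrow> locally_linear_test \<xi> \<theta>1 \<theta>2 (K x) w"
    "\<And>y. y \<noteq> 0 \<Longrightarrow> \<exists>x\<in>T. y \<in> interior (K x) \<and>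
      (\<forall>v. (\<forall>w\<in>W x. 0 \<le> w \<bullet> v) \<longrightarrow> v \<in> refl_cone \<xi> \<theta>1 \<theta>2 V y)"
proof -
  define Q where "Q x k \<longleftrightarrow> closed (fst k) \<and> x \<in> interior (fst k) \<and> finite (snd k) \<and>
    (\<forall>w\<in>snd k. locally_linear_test \<xi> \<theta>1 \<theta>2 (fst k) w) \<and>
    (\<forall>y. (\<forall>w\<in>snd k. 0 \<le> w \<bullet> y) \<longrightarrow> y \<in> refl_cone \<xi> \<theta>1 \<theta>2 V x)" for x k
  have "\<exists>k. x \<noteq> 0 \<longrightarrow> Q x k" for x
  proof (cases "x = 0")
    case False
    obtain K W where "closed K \<and> x \<in> interior K \<and> finite W \<and> (\<forall>w\<in>W. locally_linear_test \<xi> \<theta>1 \<theta>2 K w) \<and>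
      (\<forall>y. (\<forall>w\<in>W. 0 \<le> w \<bullet> y) \<longrightarrow> y \<in> refl_cone \<xi> \<theta>1 \<theta>2 V x)"
      using locally_linear_cover[OF \<xi> False, of \<theta>1 \<theta>2 V] by (elim exE)
    then have "Q x (K, W)" unfolding Q_def fst_conv snd_conv .
    then show ?thesis by (intro exI impI)
  qed simp
  then have "\<exists>k. \<forall>x. x \<noteq> 0 \<longrightarrow> Q x (k x)" by (intro choice allI)
  then obtain k where k: "\<forall>x. x \<noteq> 0 \<longrightarrow> Q x (k x)" by (rule exE)
  define K W where "K x = fst (k x)" and "W x = snd (k x)" for x
  have KW: "closed (K x)" "x \<in> interior (K x)" "finite (W x)"
    "\<forall>w\<in>W x. locally_linear_test \<xi> \<theta>1 \<theta>2 (K x) w"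
    "(\<forall>w\<in>W x. 0 \<le> w \<bullet> v) \<Longrightarrow> v \<in> refl_cone \<xi> \<theta>1 \<theta>2 V x" if "x \<noteq> 0" for x v
    using k[rule_format, OF that] unfolding Q_def K_def W_def by (elim conjE; assumption | blast)+
  define R where "R D = {x. x \<noteq> 0 \<and> refl_cone \<xi> \<theta>1 \<theta>2 V x = D}" for D
  have "\<exists>T. countable T \<and> T \<subseteq> R D \<and> (\<forall>y\<in>R D. \<exists>x\<in>T. y \<in> interior (K x))" for D
    by (rule countable_subcover[of "R D" K]) (auto simp: R_def intro: KW(2))
  then have "\<exists>T. \<forall>D. countable (T D) \<and> T D \<subseteq> R D \<and> (\<forall>y\<in>R D. \<exists>x\<in>T D. y \<in> interior (K x))"
    by (intro choice allI)
  then obtain T where T0: "\<forall>D. countable (T D) \<and> T D \<subseteq> R D \<and> (\<forall>y\<in>R D. \<exists>x\<in>T D. y \<in> interior (K x))"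
    by (rule exE)
  have T: "countable (T D)" "T D \<subseteq> R D" "y \<in> R D \<Longrightarrow> \<exists>x\<in>T D. y \<in> interior (K x)" for D y
    using T0[rule_format, of D] by simp_all
  define C where "C = {ray (refl1 \<theta>1), ray (refl2 \<xi> \<theta>2), {0}}"
  have nz: "x \<noteq> 0" if "x \<in> (\<Union>D\<in>C. T D)" for x using that T(2) by (auto simp: R_def)
  show thesis
  proof (rule that[of "\<Union>D\<in>C. T D" K W])
    show "countable (\<Union>D\<in>C. T D)" using T(1) by (simp add: C_def)
    show "\<exists>x\<in>\<Union>D\<in>C. T D. y \<in> interior (K x) \<and>
      (\<forall>v. (\<forall>w\<in>W x. 0 \<le> w \<bullet> v) \<longrightarrow> v \<in> refl_cone \<xi> \<theta>1 \<theta>2 V y)" if "y \<noteq> 0" for y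
    proof -
      define D where "D = refl_cone \<xi> \<theta>1 \<theta>2 V y"
      have "D \<in> C" using that by (simp add: D_def refl_cone_def C_def)
      moreover obtain x where x: "x \<in> T D" "y \<in> interior (K x)" using T(3)[of y D] \<open>y \<noteq> 0\<close> by (auto simp: R_def D_def)
      moreover have "x \<noteq> 0" "refl_cone \<xi> \<theta>1 \<theta>2 V x = D" using x(1) T(2)[of D] by (auto simp: R_def)
      ultimately show ?thesis using KW(5)[of x] by (intro bexI[of _ x]) (auto simp: D_def)
    qed
  qed (use KW nz in blast)+
qed

text \<open>Both endpoints are approximated by rational times, using continuity. These are taken
  inside the interval, so that they inherit whatever holds along the path on
  \<open>{a..b}\<close>.\<close>

lemma increment_in_closure:
  fixes y :: "real \<Rightarrow> real^2"
  assumes c: "continuous_on {a..b} y" and ab: "a < b"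
  shows "y b - y a \<in> closure {y q - y p | p q. p \<in> \<rat> \<and> q \<in> \<rat> \<and> a < p \<and> p < q \<and> q < b}"
  unfolding closure_approachable
proof (intro allI impI)
  fix e :: real assume e: "0 < e"
  have ab': "a \<in> {a..b}" "b \<in> {a..b}" using ab by auto
  obtain d1 where d1: "0 < d1" "\<And>t. t \<in> {a..b} \<Longrightarrow> dist t a < d1 \<Longrightarrow> dist (y t) (y a) < e / 2"
    using c ab'(1) e unfolding continuous_on_iff by (metis half_gt_zero)
  obtain d2 where d2: "0 < d2" "\<And>t. t \<in> {a..b} \<Longrightarrow> dist t b < d2 \<Longrightarrow> dist (y t) (y b) < e / 2"
    using c ab'(2) e unfolding continuous_on_iff by (metis half_gt_zero)
  obtain p where p: "p \<in> \<rat>" "a < p" "p < min ((a + b) / 2) (a + d1)"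
    using Rats_dense_in_real[of a "min ((a + b) / 2) (a + d1)"] ab d1(1) by auto
  obtain q where q: "q \<in> \<rat>" "max ((a + b) / 2) (b - d2) < q" "q < b"
    using Rats_dense_in_real[of "max ((a + b) / 2) (b - d2)" b] ab d2(1) by auto
  have "dist (y p) (y a) < e / 2" by (rule d1(2)) (use p q ab in \<open>auto simp: dist_real_def\<close>)
  moreover have "dist (y q) (y b) < e / 2" by (rule d2(2)) (use p q ab in \<open>auto simp: dist_real_def\<close>)
  moreover have "dist (y q - y p) (y b - y a) \<le> dist (y q) (y b) + dist (y p) (y a)"
  proof -
    have "(y q - y p) - (y b - y a) = (y q - y b) - (y p - y a)" by (simp add: algebra_simps)
    then show ?thesis unfolding dist_norm using norm_triangle_ineq4[of "y q - y b" "y p - y a"] by metis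
  qed
  ultimately have "dist (y q - y p) (y b - y a) < e" by linarith
  moreover have "p < q" using p q by auto
  ultimately show "\<exists>v\<in>{y q - y p | p q. p \<in> \<rat> \<and> q \<in> \<rat> \<and> a < p \<and> p < q \<and> q < b}. dist v (y b - y a) < e"
    using p q by blast
qed

lemma cadlag_continuous:
  assumes "continuous_on {0..} f"
  shows "cadlag f" "0 < t \<Longrightarrow> left_limit f t = f t"
proof -
  have "(f \<longlongrightarrow> f t) (at_right t)" if "0 \<le> t" for t
    using assms that unfolding continuous_on_def
    by (auto intro: tendsto_within_subset[of _ _ _ "{0..}"])
  moreover have left: "(f \<longlongrightarrow> f t) (at_left t)" if "0 < t" for t
  proof -
    have "(f \<longlongrightarrow> f t) (at t within {0..})" using assms that unfolding continuous_on_def by auto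
    then have "(f \<longlongrightarrow> f t) (at t within {0<..})" by (rule tendsto_within_subset) auto
    then have "(f \<longlongrightarrow> f t) (at t)" using at_within_open[of t "{0<..}"] that by simp
    then show ?thesis unfolding filterlim_at_split by (rule conjunct1)
  qed
  ultimately show "cadlag f" unfolding cadlag_def by blast
  show "left_limit f t = f t" if "0 < t"
    using that tendsto_Lim[OF _ left[OF that]] by (simp add: left_limit_def)
qed

text \<open>The deterministic part: all almost sure facts enter as hypotheses on one path. An
  interval with a corner visit has the whole plane as its hull; otherwise the increment is assembled
  from short ones.\<close>

lemma path_solves_ESP:
  fixes \<omega> x y :: path
  assumes \<xi>: "0 < \<xi>" "\<xi> < pi" and V: "cone V" "V \<noteq> {}"
    and hull: "closure (convex hull (V \<union> ray (refl1 \<theta>1) \<union> ray (refl2 \<xi> \<theta>2))) = UNIV"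
    and path: "\<omega> \<in> path_space \<xi>" and x: "continuous_on {0..} x" and y: "continuous_on {0..} y" "y 0 = 0"
    and sum: "\<And>t. 0 \<le> t \<Longrightarrow> \<omega> t = x t + y t"
    and cover: "\<And>v. v \<noteq> 0 \<Longrightarrow> \<exists>k\<in>T. v \<in> interior (K k) \<and>
      (\<forall>u. (\<forall>w\<in>W k. 0 \<le> w \<bullet> u) \<longrightarrow> u \<in> refl_cone \<xi> \<theta>1 \<theta>2 V v)"
    and push: "\<And>k w p q. k \<in> T \<Longrightarrow> w \<in> W k \<Longrightarrow> p \<in> \<rat> \<Longrightarrow> q \<in> \<rat> \<Longrightarrow> 0 \<le> p \<Longrightarrow> p < q \<Longrightarrow>
      (\<forall>t\<in>{p..q}. \<omega> t \<in> K k) \<Longrightarrow> 0 \<le> w \<bullet> (y q - y p)"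
    and nonzero: "\<And>a b. 0 \<le> a \<Longrightarrow> a < b \<Longrightarrow> \<exists>t\<in>{a..b}. \<omega> t \<noteq> 0"
    and sides: "\<And>p u. p \<in> \<rat> \<Longrightarrow> 0 \<le> p \<Longrightarrow> p < u \<Longrightarrow> \<omega> u = 0 \<Longrightarrow> (\<forall>t\<in>{p..<u}. \<omega> t \<noteq> 0) \<Longrightarrow>
      (\<exists>t\<in>{p..<u}. \<omega> t \<in> side1) \<and> (\<exists>t\<in>{p..<u}. \<omega> t \<in> side2 \<xi>)"
  shows "solves_ESP (wedge \<xi>) (refl_cone \<xi> \<theta>1 \<theta>2 V) x \<omega> y"
proof -
  let ?d = "refl_cone \<xi> \<theta>1 \<theta>2 V"
  have c\<omega>: "continuous_on {0..} \<omega>" using path by (simp add: path_space_def)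
  have wd: "\<omega> t \<in> wedge \<xi>" if "0 \<le> t" for t using path that by (auto simp: path_space_def)
  have local: "\<exists>d>0. \<forall>a b. 0 \<le> a \<and> a \<le> u \<and> u \<le> b \<and> b - a < d \<longrightarrow> y b - y a \<in> ?d (\<omega> u)"
    if u: "0 \<le> u" "\<omega> u \<noteq> 0" for u
  proof -
    obtain k where k: "k \<in> T" "\<omega> u \<in> interior (K k)"
      "\<And>v. \<forall>w\<in>W k. 0 \<le> w \<bullet> v \<Longrightarrow> v \<in> ?d (\<omega> u)"
      using cover[OF u(2)] by blast
    obtain e where e: "0 < e" "ball (\<omega> u) e \<subseteq> interior (K k)"
      using k(2) openE[OF open_interior] by blast
    obtain d where d: "0 < d" "\<And>t. t \<in> {0..} \<Longrightarrow> dist t u < d \<Longrightarrow> dist (\<omega> t) (\<omega> u) < e"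
      using c\<omega> u(1) e(1) unfolding continuous_on_iff by (metis atLeast_iff)
    have "y b - y a \<in> ?d (\<omega> u)" if ab: "0 \<le> a" "a \<le> u" "u \<le> b" "b - a < d" for a b
    proof (rule k(3), rule ballI)
      fix w assume w: "w \<in> W k"
      show "0 \<le> w \<bullet> (y b - y a)"
      proof (cases "a = b")
        case False
        have inK: "\<omega> t \<in> K k" if "t \<in> {a..b}" for t
        proof -
          have "dist (\<omega> t) (\<omega> u) < e" by (rule d(2)) (use ab that in \<open>auto simp: dist_real_def\<close>)
          then have "\<omega> t \<in> interior (K k)" using e(2) by (auto simp: dist_commute)
          then show ?thesis using interior_subset by blast
        qed
        have "y b - y a \<in> closure {y q - y p | p q. p \<in> \<rat> \<and> q \<in> \<rat> \<and> a < p \<and> p < q \<and> q < b}"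
          using False ab by (intro increment_in_closure continuous_on_subset[OF y(1)]) auto
        also have "\<dots> \<subseteq> {v. 0 \<le> w \<bullet> v}"
        proof (rule closure_minimal)
          show "{y q - y p | p q. p \<in> \<rat> \<and> q \<in> \<rat> \<and> a < p \<and> p < q \<and> q < b} \<subseteq> {v. 0 \<le> w \<bullet> v}"
          proof clarify
            fix p q assume pq: "p \<in> \<rat>" "q \<in> \<rat>" "a < p" "p < q" "q < b"
            show "0 \<le> w \<bullet> (y q - y p)"
              by (rule push[OF k(1) w pq(1,2) _ pq(4)]) (use pq ab inK in auto)
          qed
        qed (intro closed_Collect_le continuous_intros)
        finally show ?thesis by simp
      qed simp
    qed
    then show ?thesis using d(1) by blast
  qed
  have incr: "y t - y s \<in> closure (convex hull (\<Union>u\<in>{s<..t}. ?d (\<omega> u)))" if st: "0 \<le> s" "s < t" for s t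
  proof (cases "\<exists>u\<in>{s<..t}. \<omega> u = 0")
    case True
    then obtain u where u: "s < u" "u \<le> t" "\<omega> u = 0" by auto
    \<comment> \<open>The middle third keeps \<open>v\<close> strictly between \<open>s\<close> and
      \<open>u\<close>.\<close>
    obtain v where v: "v \<in> {(2 * s + u) / 3..(s + 2 * u) / 3}" "\<omega> v \<noteq> 0"
      using nonzero[of "(2 * s + u) / 3" "(s + 2 * u) / 3"] st u by auto
    have vsu: "s < v" "v < u" using v(1) u by auto
    have nv: "0 < norm (\<omega> v)" using v(2) by simp
    have "v \<in> {0..}" using vsu st by simp
    with nv obtain d where d: "0 < d" "\<And>r. r \<in> {0..} \<Longrightarrow> dist r v < d \<Longrightarrow> dist (\<omega> r) (\<omega> v) < norm (\<omega> v)"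
      using c\<omega> unfolding continuous_on_iff by blast
    \<comment> \<open>Moves to a rational time, for which the statement on the sides is
      available.\<close>
    obtain p where p: "p \<in> \<rat>" "v < p" "p < min u (v + d)"
      using Rats_dense_in_real[of v "min u (v + d)"] vsu d(1) by auto
    have "dist (\<omega> p) (\<omega> v) < norm (\<omega> v)" by (rule d(2)) (use p vsu st in \<open>auto simp: dist_real_def\<close>)
    then have p0: "\<omega> p \<noteq> 0" by auto
    have pu: "s < p" "p < u" "0 \<le> p" using p vsu st by auto
    \<comment> \<open>The first zero after \<open>p\<close> ends an excursion, so both sides are
      visited between \<open>p\<close> and that time.\<close>
    define Z where "Z = {p..u} \<inter> \<omega> -` {0}"
    have "closed Z" unfolding Z_def
      by (intro continuous_closed_preimage continuous_on_subset[OF c\<omega>]) (use pu in auto)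
    then have cZ: "compact Z" unfolding Z_def
      by (metis Int_assoc compact_Icc compact_Int_closed inf.idem)
    have "u \<in> Z" using u pu by (simp add: Z_def)
    then have "Z \<noteq> {}" by blast
    from compact_attains_inf[OF cZ this] obtain u' where u': "u' \<in> Z" "\<forall>r\<in>Z. u' \<le> r"
      by (rule bexE)
    have u'0: "\<omega> u' = 0" "p \<le> u'" "u' \<le> u" using u'(1) by (auto simp: Z_def)
    have pu': "p < u'" using u'0 p0 by (cases "p = u'") auto
    have nz: "\<forall>r\<in>{p..<u'}. \<omega> r \<noteq> 0"
      using u'(2) u'0 by (force simp: Z_def)
    obtain t1 t2 where t12: "t1 \<in> {p..<u'}" "\<omega> t1 \<in> side1" "t2 \<in> {p..<u'}" "\<omega> t2 \<in> side2 \<xi>"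
      using sides[OF p(1) pu(3) pu' u'0(1) nz] by blast
    have "?d (\<omega> u') = V" by (simp add: u'0 refl_cone_def)
    moreover have "?d (\<omega> t1) = ray (refl1 \<theta>1)" using nz t12 by (simp add: refl_cone_def)
    moreover have "?d (\<omega> t2) = ray (refl2 \<xi> \<theta>2)"
      using nz t12 sides_disjoint[OF _ t12(4) \<xi>] by (auto simp: refl_cone_def)
    moreover have "u' \<in> {s<..t}" "t1 \<in> {s<..t}" "t2 \<in> {s<..t}" using t12 u'0 pu u by auto
    ultimately have "V \<union> ray (refl1 \<theta>1) \<union> ray (refl2 \<xi> \<theta>2) \<subseteq> (\<Union>u\<in>{s<..t}. ?d (\<omega> u))" by blast
    then have "UNIV \<subseteq> closure (convex hull (\<Union>u\<in>{s<..t}. ?d (\<omega> u)))"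
      unfolding hull[symmetric] by (intro closure_mono hull_mono)
    then show ?thesis by blast
  next
    case False
    define C where "C = closure (convex hull (\<Union>u\<in>{s<..t}. ?d (\<omega> u)))"
    have "cone (\<Union>u\<in>{s<..t}. ?d (\<omega> u))"
      by (intro cone_UN cone_refl_cone V(1))
    then have coneC: "cone C" unfolding C_def by (intro cone_closure cone_convex_hull)
    have convC: "convex C" unfolding C_def by (intro convex_closure convex_convex_hull)
    have addC: "v1 + v2 \<in> C" if "v1 \<in> C" "v2 \<in> C" for v1 v2
    proof -
      have "2 *\<^sub>R ((1/2) *\<^sub>R v1 + (1/2) *\<^sub>R v2) \<in> C"
        using that convC coneC by (intro mem_cone[OF coneC] convexD) auto
      then show ?thesis by (simp add: scaleR_add_right)
    qed
    have dC: "?d (\<omega> u) \<subseteq> C" if "u \<in> {s<..t}" for u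
    proof -
      have "?d (\<omega> u) \<subseteq> (\<Union>u\<in>{s<..t}. ?d (\<omega> u))" using that by blast
      also have "\<dots> \<subseteq> convex hull (\<Union>u\<in>{s<..t}. ?d (\<omega> u))" by (rule hull_subset)
      also have "\<dots> \<subseteq> C" unfolding C_def by (rule closure_subset)
      finally show ?thesis .
    qed
    \<comment> \<open>The cones are collected over \<open>{s<..t}\<close>, and the path may be at
      the corner at time \<open>s\<close>. Increments are therefore taken from \<open>s' > s\<close>
      first, and \<open>s\<close> is reached by right continuity.\<close>
    have from_right: "y t - y s' \<in> C" if s': "s < s'" "s' \<le> t" for s'
    proof -
      have "s < s' \<and> t \<le> t \<longrightarrow> y t - y s' \<in> C"
      \<comment> \<open>Bisection: a relation on intervals that is additive, and holds for all short
        intervals around each point, holds for the whole interval.\<close>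
      proof (rule Bolzano[where P = "\<lambda>a b. s < a \<and> b \<le> t \<longrightarrow> y b - y a \<in> C"])
        show "s' \<le> t" by (rule s'(2))
        show "s < a \<and> c \<le> t \<longrightarrow> y c - y a \<in> C"
          if "s < a \<and> b \<le> t \<longrightarrow> y b - y a \<in> C" "s < b \<and> c \<le> t \<longrightarrow> y c - y b \<in> C" "a \<le> b" "b \<le> c" for a b c
        proof
          assume "s < a \<and> c \<le> t"
          then have "y b - y a \<in> C" "y c - y b \<in> C" using that by auto
          from addC[OF this] show "y c - y a \<in> C" by simp
        qed
        show "\<exists>d>0. \<forall>a b. a \<le> u \<and> u \<le> b \<and> b - a < d \<longrightarrow> s < a \<and> b \<le> t \<longrightarrow> y b - y a \<in> C"
          if "s' \<le> u" "u \<le> t" for u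
        proof -
          have u: "u \<in> {s<..t}" "0 \<le> u" "\<omega> u \<noteq> 0" using that s' st False by auto
          obtain d where "0 < d" "\<And>a b. 0 \<le> a \<Longrightarrow> a \<le> u \<Longrightarrow> u \<le> b \<Longrightarrow> b - a < d \<Longrightarrow> y b - y a \<in> ?d (\<omega> u)"
            using local[OF u(2,3)] by blast
          then show ?thesis using dC[OF u(1)] st(1) by (intro exI[of _ d]) force
        qed
      qed
      then show ?thesis using s' by simp
    qed
    have "(y \<longlongrightarrow> y s) (at_right s)"
      using cadlag_continuous(1)[OF y(1)] st(1) by (simp add: cadlag_def)
    then have "((\<lambda>r. y t - y r) \<longlongrightarrow> y t - y s) (at_right s)" by (intro tendsto_intros)
    moreover have "\<forall>\<^sub>F r in at_right s. y t - y r \<in> C"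
      using eventually_at_right_less[of s] eventually_at_right[of s t "\<lambda>r. r \<le> t"] st(2)
      by (auto simp: eventually_at_right[OF st(2)] intro!: exI[of _ t] from_right)
    moreover have "closed C" by (simp add: C_def)
    ultimately have "y t - y s \<in> C"
      by (intro Lim_in_closed_set[of C _ "at_right s"]) (auto simp: trivial_limit_at_right_real)
    then show ?thesis by (simp add: C_def)
  qed
  have jump: "y t - left_limit y t \<in> closure (convex hull (?d (\<omega> t)))" if "0 \<le> t" for t
  proof -
    have "left_limit y t = y t"
      using that y(2) cadlag_continuous(2)[OF y(1)] by (cases "t = 0") (auto simp: left_limit_def)
    moreover have "0 \<in> closure (convex hull (?d (\<omega> t)))"
      using zero_in_refl_cone[OF V] hull_subset closure_subset by (metis (no_types, lifting) subsetD)
    ultimately show ?thesis by simp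
  qed
  show ?thesis
    unfolding solves_ESP_def
    using cadlag_continuous(1)[OF x] cadlag_continuous(1)[OF y(1)] cadlag_continuous(1)[OF c\<omega>]
      wd[of 0] sum[of 0] y(2) sum wd incr jump by auto
qed

section \<open>Almost sure statements for all times at once\<close>

context reflected_process begin

lemma linear_push:
  assumes "closed K" "locally_linear_test \<xi> \<theta>1 \<theta>2 K w"
  shows "AE \<omega> in M. \<forall>p q. p \<in> \<rat> \<longrightarrow> q \<in> \<rat> \<longrightarrow> 0 \<le> p \<longrightarrow> p < q \<longrightarrow> (\<forall>t\<in>{p..q}. \<omega> t \<in> K) \<longrightarrow>
    0 \<le> w \<bullet> (Y q \<omega> - Y p \<omega>)"
proof -
  obtain f where f: "test_fun \<xi> \<theta>1 \<theta>2 f" "\<And>x. x \<in> K \<Longrightarrow> f x = w \<bullet> x \<and> laplacian f x = 0"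
    using assms(2) by (auto simp: locally_linear_test_def)
  have "AE \<omega> in M. \<forall>a b N0. a < b \<longrightarrow> 0 < N0 \<longrightarrow> (\<forall>t\<in>{real a / real N0..real b / real N0}. \<omega> t \<in> K) \<longrightarrow>
    0 \<le> w \<bullet> (Y (real b / real N0) \<omega> - Y (real a / real N0) \<omega>)"
    unfolding AE_all_countable
  proof (intro allI)
    fix a b N0 :: nat
    show "AE \<omega> in M. a < b \<longrightarrow> 0 < N0 \<longrightarrow> (\<forall>t\<in>{real a / real N0..real b / real N0}. \<omega> t \<in> K) \<longrightarrow>
      0 \<le> w \<bullet> (Y (real b / real N0) \<omega> - Y (real a / real N0) \<omega>)"
      using linear_drift[OF assms(1) f, of a b N0] by (cases "a < b \<and> 0 < N0") auto
  qed
  then show ?thesis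
  proof eventually_elim
    case (elim \<omega>)
    show ?case
    proof (intro allI impI)
      fix p q :: real assume pq: "p \<in> \<rat>" "q \<in> \<rat>" "0 \<le> p" "p < q" and stay: "\<forall>t\<in>{p..q}. \<omega> t \<in> K"
      obtain a m :: nat where a: "m \<noteq> 0" "p = real a / real m"
        using Rats_abs_nat_div_natE[OF pq(1)] pq(3) by (metis abs_of_nonneg)
      obtain b n :: nat where b: "n \<noteq> 0" "q = real b / real n"
        using Rats_abs_nat_div_natE[OF pq(2)] pq(3,4) by (metis abs_of_nonneg less_imp_le order_trans)
      \<comment> \<open>A common denominator puts both times on one lattice.\<close>
      have p': "p = real (a * n) / real (m * n)" and q': "q = real (b * m) / real (m * n)"
        using a b by (simp_all add: field_simps)
      have "0 < m * n" using a b by simp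
      moreover have "a * n < b * m"
        using pq(4) \<open>0 < m * n\<close> unfolding p' q' by (simp add: divide_less_cancel del: of_nat_mult)
      ultimately show "0 \<le> w \<bullet> (Y q \<omega> - Y p \<omega>)" using elim stay unfolding p' q' by blast
    qed
  qed
qed

lemma AE_solves_ESP:
  assumes V: "cone V" "V \<noteq> {}"
    and hull: "closure (convex hull (V \<union> ray (refl1 \<theta>1) \<union> ray (refl2 \<xi> \<theta>2))) = UNIV"
    and Y0: "AE \<omega> in M. Y 0 \<omega> = 0"
  shows "AE \<omega> in M. solves_ESP (wedge \<xi>) (refl_cone \<xi> \<theta>1 \<theta>2 V) (\<lambda>t. X t \<omega>) \<omega> (\<lambda>t. Y t \<omega>)"
proof -
  obtain T :: "(real^2) set" and K W where T: "countable T" "\<And>x. x \<in> T \<Longrightarrow> closed (K x)" "\<And>x. x \<in> T \<Longrightarrow> finite (W x)"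
    "\<And>x w. x \<in> T \<Longrightarrow> w \<in> W x \<Longrightarrow> locally_linear_test \<xi> \<theta>1 \<theta>2 (K x) w"
    and cover: "\<And>y. y \<noteq> 0 \<Longrightarrow> \<exists>x\<in>T. y \<in> interior (K x) \<and>
      (\<forall>v. (\<forall>w\<in>W x. 0 \<le> w \<bullet> v) \<longrightarrow> v \<in> refl_cone \<xi> \<theta>1 \<theta>2 V y)"
    by (rule countable_linear_cover[OF wedge_angle]; rule that; assumption)
  have "AE \<omega> in M. \<forall>k\<in>T. \<forall>w\<in>W k. \<forall>p q. p \<in> \<rat> \<longrightarrow> q \<in> \<rat> \<longrightarrow> 0 \<le> p \<longrightarrow> p < q \<longrightarrow>
      (\<forall>t\<in>{p..q}. \<omega> t \<in> K k) \<longrightarrow> 0 \<le> w \<bullet> (Y q \<omega> - Y p \<omega>)"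
    by (intro AE_ball_countable' T(1) countable_finite T(3) linear_push T(2,4))
  then show ?thesis
    using X_continuous Y_continuous Y0 no_zero_interval sides_hit_before_corner AE_space
  proof eventually_elim
    case (elim \<omega>)
    show ?case
    proof (rule path_solves_ESP[OF wedge_angle V hull _ elim(2,3,4) _ cover])
      show "\<omega> \<in> path_space \<xi>" using elim(7) space_M by simp
      show "\<omega> t = X t \<omega> + Y t \<omega>" if "0 \<le> t" for t by (rule decomposition[OF elim(7) that])
    qed (use elim(1,5,6) in blast)+
  qed
qed

end


section \<open>The canonical path space\<close>

lemma coord_generators: "{(\<lambda>\<omega>. \<omega> s) -` B \<inter> path_space \<xi> | s B. s \<in> I \<and> B \<in> sets borel} \<subseteq> Pow (path_space \<xi>)"
  by auto

lemma space_coord_algebra [simp]: "space (coord_algebra \<xi> I) = path_space \<xi>"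
  by (simp add: coord_algebra_def space_measure_of_conv)

lemma sets_coord_algebra:
  "sets (coord_algebra \<xi> I) = sigma_sets (path_space \<xi>) {(\<lambda>\<omega>. \<omega> s) -` B \<inter> path_space \<xi> | s B. s \<in> I \<and> B \<in> sets borel}"
  by (simp add: coord_algebra_def sets_measure_of[OF coord_generators])

lemma sets_coord_algebra_mono: "I \<subseteq> J \<Longrightarrow> sets (coord_algebra \<xi> I) \<subseteq> sets (coord_algebra \<xi> J)"
  unfolding sets_coord_algebra by (rule sigma_sets_mono') blast

lemma measurable_coordinate:
  assumes "s \<in> I"
  shows "(\<lambda>\<omega>. \<omega> s) \<in> borel_measurable (coord_algebra \<xi> I)"
proof (rule measurableI)
  fix B :: "(real^2) set" assume "B \<in> sets borel"
  then show "(\<lambda>\<omega>. \<omega> s) -` B \<inter> space (coord_algebra \<xi> I) \<in> sets (coord_algebra \<xi> I)"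
    unfolding sets_coord_algebra space_coord_algebra using assms by (intro sigma_sets.Basic) blast
qed simp

lemma initial_laws_space: "\<mu> \<in> initial_laws \<xi> \<Longrightarrow> space \<mu> = wedge \<xi>"
  using sets_eq_imp_space_eq[of \<mu> "restrict_space borel (wedge \<xi>)"]
  by (simp add: initial_laws_def space_restrict_space)

lemma return_initial_law: "z \<in> wedge \<xi> \<Longrightarrow> return (restrict_space borel (wedge \<xi>)) z \<in> initial_laws \<xi>"
  by (auto simp: initial_laws_def space_restrict_space intro!: prob_space_return)

text \<open>Sets that agree with a member of \<open>F\<close> up to a null set form a sigma-algebra
  that contains both families of generators.\<close>

lemma null_sets_augmentation:
  assumes "sets F \<subseteq> sets N" "space F = \<Omega>" "space N = \<Omega>" and A: "A \<in> sigma_sets \<Omega> (sets F \<union> null_sets (completion N))"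
  shows "\<exists>A'\<in>sets F. AE \<omega> in N. \<omega> \<in> A \<longleftrightarrow> \<omega> \<in> A'"
  using A
proof induction
  case (Basic A)
  then show ?case
  proof
    assume "A \<in> sets F" then show ?thesis by (intro bexI[of _ A]) auto
  next
    assume "A \<in> null_sets (completion N)"
    then obtain N' where N': "N' \<in> null_sets N" "A \<subseteq> N'" by (auto simp: null_sets_completion_iff2)
    then have "AE \<omega> in N. \<omega> \<notin> N'" using AE_not_in by blast
    then have "AE \<omega> in N. \<omega> \<in> A \<longleftrightarrow> \<omega> \<in> {}" by eventually_elim (use N' in auto)
    then show ?thesis by (intro bexI[of _ "{}"]) auto
  qed
next
  case Empty
  then show ?case by (intro bexI[of _ "{}"]) auto
next
  case (Compl A)
  then obtain A' where A': "A' \<in> sets F" "AE \<omega> in N. \<omega> \<in> A \<longleftrightarrow> \<omega> \<in> A'" by blast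
  have "AE \<omega> in N. \<omega> \<in> \<Omega> - A \<longleftrightarrow> \<omega> \<in> \<Omega> - A'" using A'(2) by eventually_elim auto
  moreover have "\<Omega> - A' \<in> sets F" using A'(1) assms(2) sets.compl_sets by blast
  ultimately show ?case by blast
next
  case (Union A)
  then have "\<forall>i::nat. \<exists>A'. A' \<in> sets F \<and> (AE \<omega> in N. \<omega> \<in> A i \<longleftrightarrow> \<omega> \<in> A')" by blast
  then obtain A' where A': "\<And>i. A' i \<in> sets F" "\<And>i. AE \<omega> in N. \<omega> \<in> A i \<longleftrightarrow> \<omega> \<in> A' i"
    using choice[of "\<lambda>i A'. A' \<in> sets F \<and> (AE \<omega> in N. \<omega> \<in> A i \<longleftrightarrow> \<omega> \<in> A')"] by auto
  have "AE \<omega> in N. \<forall>i. \<omega> \<in> A i \<longleftrightarrow> \<omega> \<in> A' i" unfolding AE_all_countable using A'(2) by blast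
  then have "AE \<omega> in N. \<omega> \<in> (\<Union>i. A i) \<longleftrightarrow> \<omega> \<in> (\<Union>i. A' i)" by eventually_elim auto
  moreover have "(\<Union>i. A' i) \<in> sets F" using A'(1) by auto
  ultimately show ?case by blast
qed

text \<open>
  A kernel that fails to be measurable makes every mixture \<open>bind \<mu> P\<close> the null measure, because
  \<^const>\<open>distr\<close> of a function that is not measurable is no measure.
\<close>

lemma emeasure_bind_nonmeasurable:
  assumes \<mu>: "prob_space \<mu>" and P: "\<And>x. x \<in> space \<mu> \<Longrightarrow> P x \<in> space (subprob_algebra N)"
    and nm: "P \<notin> measurable \<mu> (subprob_algebra N)"
  shows "emeasure (bind \<mu> P) A = 0"
proof (cases "A \<in> sets N")
  case True
  interpret prob_space \<mu> by fact
  have ne: "space \<mu> \<noteq> {}" by (rule not_empty)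
  \<comment> \<open>\<open>bind\<close> takes its target algebra from a chosen point of the
    space.\<close>
  define x0 where "x0 = (SOME x. x \<in> space \<mu>)"
  have x0: "x0 \<in> space \<mu>" unfolding x0_def using ne by (simp add: some_in_eq)
  have S: "subprob_algebra (P x0) = subprob_algebra N"
    using P[OF x0] by (intro subprob_algebra_cong) (simp add: space_subprob_algebra)
  let ?S = "subprob_algebra N"
  define D where "D = distr \<mu> ?S P"
  obtain B where B: "B \<in> sets ?S" "P -` B \<inter> space \<mu> \<notin> sets \<mu>"
    using nm P by (auto simp: measurable_def)
  let ?g = "\<lambda>A. emeasure \<mu> (P -` A \<inter> space \<mu>)"
  \<comment> \<open>\<open>B\<close> and its complement both have non-measurable preimages, so both
    get the value 0 while the whole space gets 1: the set function is not additive.\<close>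
  have "\<not> measure_space (space ?S) (sigma_sets (space ?S) (sets ?S)) ?g"
  proof
    assume "measure_space (space ?S) (sigma_sets (space ?S) (sets ?S)) ?g"
    then have ms: "positive (sets ?S) ?g" "countably_additive (sets ?S) ?g"
      by (simp_all add: measure_space_def sets.sigma_sets_eq)
    have add: "additive (sets ?S) ?g"
      by (rule sets.countably_additive_additive[OF ms])
    have compl: "space ?S - B \<in> sets ?S" using B(1) by auto
    have disj: "B \<inter> (space ?S - B) = {}" by blast
    have sum: "?g (B \<union> (space ?S - B)) = ?g B + ?g (space ?S - B)"
      by (rule additiveD[OF add disj B(1) compl])
    have un: "B \<union> (space ?S - B) = space ?S" using sets.sets_into_space[OF B(1)] by blast
    have all: "P -` space ?S \<inter> space \<mu> = space \<mu>" using P by auto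
    have "P -` (space ?S - B) \<inter> space \<mu> \<notin> sets \<mu>"
    proof
      assume "P -` (space ?S - B) \<inter> space \<mu> \<in> sets \<mu>"
      then have "space \<mu> - (P -` (space ?S - B) \<inter> space \<mu>) \<in> sets \<mu>" by auto
      moreover have "space \<mu> - (P -` (space ?S - B) \<inter> space \<mu>) = P -` B \<inter> space \<mu>" using P by auto
      ultimately show False using B(2) by simp
    qed
    then show False
      using sum B(2) unfolding un all by (simp add: emeasure_notin_sets emeasure_space_1)
  qed
  then have D0: "emeasure D C = 0" for C
    unfolding D_def distr_def emeasure_measure_of_conv by auto
  have "emeasure (bind \<mu> P) A = emeasure (join D) A"
    using ne S by (simp add: bind_nonempty D_def x0_def)
  also have "\<dots> = (\<integral>\<^sup>+ M'. emeasure M' A \<partial>D)"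
    by (rule emeasure_join[OF _ True]) (simp add: D_def)
  also have "\<dots> = (\<integral>\<^sup>+ M'. 0 \<partial>D)"
  proof (rule nn_integral_cong_AE)
    have "space D \<in> null_sets D" using D0 by (simp add: null_sets_def)
    then show "AE M' in D. emeasure M' A = 0" by (rule AE_I') auto
  qed
  finally show ?thesis by simp
next
  case False
  have "sets (bind \<mu> P) = sets N"
    using P prob_space.not_empty[OF \<mu>] by (intro sets_bind) (auto simp: space_subprob_algebra)
  then show ?thesis using False by (simp add: emeasure_notin_sets)
qed

lemma emeasure_pos_of_density:
  fixes D :: "'a \<Rightarrow> 'b::euclidean_space"
  assumes D: "distributed M lborel D g" and g: "\<And>x. g x \<noteq> 0" and U: "open U" "U \<noteq> {}"
  shows "emeasure M {\<omega>\<in>space M. D \<omega> \<in> U} \<noteq> 0"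
proof
  assume 0: "emeasure M {\<omega>\<in>space M. D \<omega> \<in> U} = 0"
  have [measurable]: "U \<in> sets borel" using U by simp
  have "emeasure M {\<omega>\<in>space M. D \<omega> \<in> U} = (\<integral>\<^sup>+x. g x * indicator U x \<partial>lborel)"
    using distributed_emeasure[OF D, of U] by (simp add: vimage_def Int_def conj_commute)
  moreover have "(\<lambda>x. g x * indicator U x) \<in> borel_measurable lborel"
    using distributed_borel_measurable[OF D] by measurable
  ultimately have "AE x in lborel. g x * indicator U x = 0"
    using 0 by (simp add: nn_integral_0_iff_AE)
  then have "AE x in lborel. x \<notin> U" by eventually_elim (use g in \<open>auto simp: indicator_def\<close>)
  then have "U \<in> null_sets lborel" by (subst (asm) AE_iff_null_sets[symmetric]) auto
  then have "negligible U" by (simp add: negligible_iff_null_sets null_sets_completionI)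
  then show False using open_not_negligible[OF U] by simp
qed

lemma gaussian_density_nonzero:
  assumes "0 < \<sigma>"
  shows "ennreal (\<Prod>i\<in>UNIV. normal_density 0 \<sigma> ((x::real^'n) $ i)) \<noteq> 0"
proof -
  have "0 < (\<Prod>i\<in>UNIV. normal_density 0 \<sigma> (x $ i))"
    using assms by (intro prod_pos) (simp add: normal_density_pos)
  then show ?thesis by (simp add: ennreal_eq_0_iff not_le)
qed

section \<open>The law and the filtration for one starting point\<close>

locale canonical_process =
  fixes \<xi> \<theta>1 \<theta>2 :: real and P :: "real^2 \<Rightarrow> path measure" and X Y :: "real \<Rightarrow> path \<Rightarrow> real^2" and z :: "real^2"
  assumes wedge_angle: "0 < \<xi>" "\<xi> < pi"
    and family: "reflected_BM_family \<xi> \<theta>1 \<theta>2 P"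
    and decomp: "zero_energy_decomposition \<xi> P X Y"
    and z: "z \<in> wedge \<xi>"
begin

abbreviation "M \<equiv> univ_law \<xi> P z"
abbreviation "G \<equiv> univ_filtration \<xi> P"

lemma P_prob: "x \<in> wedge \<xi> \<Longrightarrow> prob_space (P x)"
  and P_space: "x \<in> wedge \<xi> \<Longrightarrow> space (P x) = path_space \<xi>"
  and P_sets: "x \<in> wedge \<xi> \<Longrightarrow> sets (P x) = sets (coord_algebra \<xi> {0..})"
  using family by (auto simp: reflected_BM_family_def)

lemma P_subprob: "x \<in> wedge \<xi> \<Longrightarrow> P x \<in> space (subprob_algebra (coord_algebra \<xi> {0..}))"
  using P_prob P_sets by (simp add: space_subprob_algebra prob_space_imp_subprob_space)

lemma BM: "std_brownian_motion M G z X"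
  and Y_cont: "continuous_process M Y" and Y_adapted: "adapted G Y"
  and Y_0: "AE \<omega> in M. Y 0 \<omega> = 0" and Y_energy: "zero_energy M Y"
  using decomp z by (auto simp: zero_energy_decomposition_def)

lemma sets_bind_law:
  assumes "\<mu> \<in> initial_laws \<xi>"
  shows "sets (bind \<mu> P) = sets (coord_algebra \<xi> {0..})" "space (bind \<mu> P) = path_space \<xi>"
proof -
  have "space \<mu> \<noteq> {}" using initial_laws_space[OF assms] z by auto
  then show s: "sets (bind \<mu> P) = sets (coord_algebra \<xi> {0..})"
    using P_sets initial_laws_space[OF assms] by (intro sets_bind) auto
  show "space (bind \<mu> P) = path_space \<xi>" using sets_eq_imp_space_eq[OF s] by simp
qed

lemma univ_algebra_generators:
  "(\<Inter>\<mu>\<in>initial_laws \<xi>. sets (completion (bind \<mu> P))) \<subseteq> Pow (path_space \<xi>)"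
proof -
  have "sets (completion (bind (return (restrict_space borel (wedge \<xi>)) z) P)) \<subseteq> Pow (path_space \<xi>)"
    using sets.space_closed[of "completion (bind (return (restrict_space borel (wedge \<xi>)) z) P)"]
      sets_bind_law(2)[OF return_initial_law[OF z]] by simp
  then show ?thesis using return_initial_law[OF z] by blast
qed

lemma coord_sub_univ: "sets (coord_algebra \<xi> {0..}) \<subseteq> sets (univ_algebra \<xi> P)"
proof -
  have "sets (coord_algebra \<xi> {0..}) \<subseteq> (\<Inter>\<mu>\<in>initial_laws \<xi>. sets (completion (bind \<mu> P)))"
    using sets_bind_law(1) by blast
  then show ?thesis
    unfolding univ_algebra_def sets_measure_of[OF univ_algebra_generators] by (auto intro: sigma_sets.Basic)
qed

lemma space_M: "space M = path_space \<xi>"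
  by (simp add: univ_law_def space_restr_to_subalg P_space[OF z])

lemma increments:
  assumes "0 \<le> s" "s < t"
  shows "distributed M lborel (\<lambda>\<omega>. X t \<omega> - X s \<omega>) (\<lambda>x. ennreal (\<Prod>i\<in>UNIV. normal_density 0 (sqrt (t - s)) (x $ i)))"
    and "prob_space.indep_set M (sets (G s)) (sets (vimage_algebra (space M) (\<lambda>\<omega>. X t \<omega> - X s \<omega>) borel))"
  using BM assms by (auto simp: std_brownian_motion_def)

text \<open>At this point the universal algebra is not known to lie in the completion of
  \<open>P z\<close>, so the restriction might be degenerate; the default value 0 is carried
  along.\<close>

lemma emeasure_M_conv:
  "emeasure M A = (if A \<in> sets (univ_algebra \<xi> P) \<and>
     measure_space (path_space \<xi>) (sets (univ_algebra \<xi> P)) (emeasure (completion (P z)))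
   then emeasure (completion (P z)) A else 0)"
proof -
  have sp: "space (univ_algebra \<xi> P) = path_space \<xi>" by (simp add: univ_algebra_def space_measure_of_conv)
  have "sigma_sets (path_space \<xi>) (sets (univ_algebra \<xi> P)) = sets (univ_algebra \<xi> P)"
    using sets.sigma_sets_eq[of "univ_algebra \<xi> P"] sp by simp
  then show ?thesis
    by (simp add: univ_law_def restr_to_subalg_def emeasure_measure_of_conv P_space[OF z])
qed

text \<open>A null measure carries no Gaussian increment. This excludes the default value, so that
  \<open>M\<close> is a genuine restriction.\<close>

lemma emeasure_M_space: "emeasure M (space M) \<noteq> 0"
  using emeasure_pos_of_density[OF increments(1)[of 0 1] gaussian_density_nonzero open_UNIV] by simp

lemma emeasure_M: "A \<in> sets (univ_algebra \<xi> P) \<Longrightarrow> emeasure M A = emeasure (completion (P z)) A"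
  using emeasure_M_space unfolding emeasure_M_conv by (auto split: if_splits)

lemma emeasure_M_coord: "A \<in> sets (coord_algebra \<xi> {0..}) \<Longrightarrow> emeasure M A = emeasure (P z) A"
  using coord_sub_univ P_sets[OF z] by (subst emeasure_M) auto

lemma sets_M: "sets M = sets (univ_algebra \<xi> P)"
proof -
  have "space (univ_algebra \<xi> P) = path_space \<xi>" by (simp add: univ_algebra_def space_measure_of_conv)
  then show ?thesis
    using sets.sigma_sets_eq[of "univ_algebra \<xi> P"] sets.space_closed[of "univ_algebra \<xi> P"]
    by (simp add: univ_law_def restr_to_subalg_def P_space[OF z] sets_measure_of)
qed

lemma prob_space_M: "prob_space M"
proof
  have "path_space \<xi> \<in> sets (coord_algebra \<xi> {0..})" using sets.top[of "coord_algebra \<xi> {0..}"] by simp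
  then show "emeasure M (space M) = 1"
    using emeasure_M_coord prob_space.emeasure_space_1[OF P_prob[OF z]] P_space[OF z] space_M by simp
qed

sublocale prob_space M by (rule prob_space_M)

lemma measurable_id_M: "(\<lambda>\<omega>. \<omega>) \<in> measurable M (P z)"
proof (rule measurableI)
  fix A assume "A \<in> sets (P z)"
  then have "A \<in> sets M" using P_sets[OF z] coord_sub_univ sets_M by blast
  then show "(\<lambda>\<omega>. \<omega>) -` A \<inter> space M \<in> sets M" by auto
qed (simp add: space_M P_space[OF z])

text \<open>\<open>M\<close> agrees with \<open>P z\<close> on the coordinate sigma-algebra;
  expressed as an image under the identity, this transfers integrals and almost sure
  statements.\<close>

lemma distr_M: "distr M (P z) (\<lambda>\<omega>. \<omega>) = P z"
proof (rule measure_eqI)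
  fix A assume A: "A \<in> sets (distr M (P z) (\<lambda>\<omega>. \<omega>))"
  then have A': "A \<in> sets (coord_algebra \<xi> {0..})" using P_sets[OF z] by simp
  then have "A \<subseteq> space M" using sets.sets_into_space[OF A'] space_M by simp
  then show "emeasure (distr M (P z) (\<lambda>\<omega>. \<omega>)) A = emeasure (P z) A"
    using A by (simp add: emeasure_distr[OF measurable_id_M] emeasure_M_coord[OF A'] Int_absorb2)
qed simp

lemma AE_M_of_P:
  assumes "AE \<omega> in P z. Q \<omega>"
  shows "AE \<omega> in M. Q \<omega>"
  using AE_distrD[OF measurable_id_M, of Q] assms unfolding distr_M by blast

lemma integral_M_of_P:
  fixes h :: "path \<Rightarrow> real"
  assumes "h \<in> borel_measurable (P z)"
  shows "(\<integral>\<omega>. h \<omega> \<partial>M) = (\<integral>\<omega>. h \<omega> \<partial>P z)"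
  using integral_distr[OF measurable_id_M assms] unfolding distr_M by simp

lemma univ_filtration_generators:
  "(\<Inter>\<mu>\<in>initial_laws \<xi>. sigma_sets (path_space \<xi>)
       (sets (coord_algebra \<xi> {0..t}) \<union> null_sets (completion (bind \<mu> P)))) \<subseteq> Pow (path_space \<xi>)"
proof -
  define \<mu> where "\<mu> = return (restrict_space borel (wedge \<xi>)) z"
  have \<mu>: "\<mu> \<in> initial_laws \<xi>" unfolding \<mu>_def by (rule return_initial_law[OF z])
  have "null_sets (completion (bind \<mu> P)) \<subseteq> Pow (path_space \<xi>)"
    using sets.space_closed[of "completion (bind \<mu> P)"] sets_bind_law(2)[OF \<mu>] by (auto simp: null_sets_def)
  moreover have "sets (coord_algebra \<xi> {0..t}) \<subseteq> Pow (path_space \<xi>)"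
    using sets.space_closed[of "coord_algebra \<xi> {0..t}"] by simp
  ultimately have gen: "sets (coord_algebra \<xi> {0..t}) \<union> null_sets (completion (bind \<mu> P)) \<subseteq> Pow (path_space \<xi>)"
    by (rule Un_least[rotated])
  show ?thesis
  proof (intro subsetI PowI)
    fix A \<omega>
    assume "A \<in> (\<Inter>\<mu>\<in>initial_laws \<xi>. sigma_sets (path_space \<xi>)
       (sets (coord_algebra \<xi> {0..t}) \<union> null_sets (completion (bind \<mu> P))))"
    then have "A \<in> sigma_sets (path_space \<xi>)
       (sets (coord_algebra \<xi> {0..t}) \<union> null_sets (completion (bind \<mu> P)))"
      using \<mu> by (rule INT_D)
    moreover assume "\<omega> \<in> A"
    ultimately show "\<omega> \<in> path_space \<xi>" using sigma_sets_into_sp[OF gen] by blast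
  qed
qed

lemma space_G: "space (G t) = path_space \<xi>"
  by (simp add: univ_filtration_def space_measure_of_conv)

lemma sets_G:
  "sets (G t) = sigma_sets (path_space \<xi>) (\<Inter>\<mu>\<in>initial_laws \<xi>. sigma_sets (path_space \<xi>)
       (sets (coord_algebra \<xi> {0..t}) \<union> null_sets (completion (bind \<mu> P))))"
  unfolding univ_filtration_def by (rule sets_measure_of[OF univ_filtration_generators])

lemma coord_sub_G: "sets (coord_algebra \<xi> {0..t}) \<subseteq> sets (G t)"
  unfolding sets_G by (auto intro!: sigma_sets.Basic)

lemma sets_G_mono: "s \<le> t \<Longrightarrow> sets (G s) \<subseteq> sets (G t)"
  unfolding sets_G using sets_coord_algebra_mono[of "{0..s}" "{0..t}" \<xi>]
  by (intro sigma_sets_mono' INT_anti_mono subset_refl Un_mono) auto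

lemma subalgebra_G: "0 \<le> t \<Longrightarrow> subalgebra M (G t)"
  using indep_setD_ev1[OF increments(2)[of t "t + 1"]] by (auto simp: subalgebra_def space_M space_G)

text \<open>Otherwise the event that an increment lies in a half-plane belongs to \<open>G 0\<close>
  and is independent of itself, although both it and the event of the opposite half-plane have
  positive probability.\<close>

lemma kernel_measurable: "P \<in> measurable (restrict_space borel (wedge \<xi>)) (subprob_algebra (coord_algebra \<xi> {0..}))"
proof (rule ccontr)
  assume nm: "\<not> ?thesis"
  have Pow: "A \<in> sets (G 0)" if "A \<subseteq> path_space \<xi>" for A
    unfolding sets_G
  proof (intro sigma_sets.Basic INT_I UnI2)
    fix \<mu> assume \<mu>: "\<mu> \<in> initial_laws \<xi>"
    then have \<mu>': "prob_space \<mu>" "sets \<mu> = sets (restrict_space borel (wedge \<xi>))" by (auto simp: initial_laws_def)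
    have "P \<notin> measurable \<mu> (subprob_algebra (coord_algebra \<xi> {0..}))"
      using nm measurable_cong_sets[OF \<mu>'(2) refl] by blast
    then have "emeasure (bind \<mu> P) B = 0" for B
      using P_subprob initial_laws_space[OF \<mu>] by (intro emeasure_bind_nonmeasurable[OF \<mu>'(1)]) auto
    then have "path_space \<xi> \<in> null_sets (bind \<mu> P)"
      using sets.top[of "bind \<mu> P"] sets_bind_law(2)[OF \<mu>] by (simp add: null_sets_def)
    then show "A \<in> null_sets (completion (bind \<mu> P))" using that by (auto simp: null_sets_completion_iff2)
  qed
  define D where "D \<omega> = X 1 \<omega> - X 0 \<omega>" for \<omega>
  define U where "U = {x::real^2. 0 < x $ 1}"
  have "open U" unfolding U_def by (intro open_Collect_less continuous_intros)
  define A where "A = D -` U \<inter> space M"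
  have "A \<in> sets (G 0)" by (rule Pow) (auto simp: A_def space_M)
  moreover have "A \<in> sets (vimage_algebra (space M) D borel)"
    unfolding A_def by (rule in_vimage_algebra) (simp add: \<open>open U\<close>)
  ultimately have "prob (A \<inter> A) = prob A * prob A"
    using indep_setD[OF increments(2)[of 0 1, OF order_refl zero_less_one], of A A] unfolding D_def by blast
  then have "prob A = 0 \<or> prob A = 1" by simp
  moreover have Dm: "D \<in> borel_measurable M"
    using distributed_measurable[OF increments(1)[of 0 1]] by (simp add: D_def[abs_def])
  then have Aev: "A \<in> events" unfolding A_def using \<open>open U\<close> by (intro measurable_sets) auto
  moreover have "emeasure M {\<omega>\<in>space M. D \<omega> \<in> U} \<noteq> 0"
    unfolding D_def
    by (rule emeasure_pos_of_density[OF increments(1) gaussian_density_nonzero \<open>open U\<close>])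
      (auto simp: U_def intro!: exI[of _ "vec 1"])
  then have "prob A \<noteq> 0" by (simp add: A_def emeasure_eq_measure vimage_def Int_def conj_commute)
  moreover have "prob A \<noteq> 1"
  proof
    assume "prob A = 1"
    then have "prob (space M - A) = 0" using prob_compl[OF Aev] by simp
    define U' where "U' = {x::real^2. x $ 1 < 0}"
    have U': "open U'" unfolding U'_def by (intro open_Collect_less continuous_intros)
    have "emeasure M {\<omega>\<in>space M. D \<omega> \<in> U'} \<noteq> 0"
      unfolding D_def
      by (rule emeasure_pos_of_density[OF increments(1) gaussian_density_nonzero U'])
        (auto simp: U'_def intro!: exI[of _ "vec (-1)"])
    moreover have "emeasure M {\<omega>\<in>space M. D \<omega> \<in> U'} \<le> emeasure M (space M - A)"
      using Aev by (intro emeasure_mono) (auto simp: A_def U_def U'_def)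
    ultimately show False using \<open>prob (space M - A) = 0\<close> by (simp add: emeasure_eq_measure)
  qed
  ultimately show False by simp
qed

text \<open>With a measurable kernel the mixture for the point mass at \<open>z\<close> is
  \<open>P z\<close>, so \<open>G t\<close> lies in the augmentation of the coordinate algebra by
  \<open>P z\<close>-null sets.\<close>

lemma G_approx:
  assumes "A \<in> sets (G t)" "0 \<le> t"
  shows "\<exists>A'\<in>sets (coord_algebra \<xi> {0..t}). AE \<omega> in P z. \<omega> \<in> A \<longleftrightarrow> \<omega> \<in> A'"
proof -
  let ?\<mu> = "return (restrict_space borel (wedge \<xi>)) z"
  have "bind ?\<mu> P = P z"
    by (rule bind_return[OF kernel_measurable]) (simp add: space_restrict_space z)
  then have "(\<Inter>\<mu>\<in>initial_laws \<xi>. sigma_sets (path_space \<xi>)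
       (sets (coord_algebra \<xi> {0..t}) \<union> null_sets (completion (bind \<mu> P)))) \<subseteq>
     sigma_sets (path_space \<xi>) (sets (coord_algebra \<xi> {0..t}) \<union> null_sets (completion (P z)))"
    using INT_lower[OF return_initial_law[OF z], of "\<lambda>\<mu>. sigma_sets (path_space \<xi>)
       (sets (coord_algebra \<xi> {0..t}) \<union> null_sets (completion (bind \<mu> P)))"] by simp
  then have "A \<in> sigma_sets (path_space \<xi>) (sets (coord_algebra \<xi> {0..t}) \<union> null_sets (completion (P z)))"
    using assms(1) sigma_sets_mono[of _ "path_space \<xi>" "sets (coord_algebra \<xi> {0..t}) \<union> null_sets (completion (P z))"]
    unfolding sets_G by blast
  moreover have "sets (coord_algebra \<xi> {0..t}) \<subseteq> sets (P z)"
    unfolding P_sets[OF z] by (rule sets_coord_algebra_mono) auto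
  ultimately show ?thesis by (intro null_sets_augmentation[of _ "P z" "path_space \<xi>"]) (simp_all add: P_space[OF z])
qed

lemma compensated_submartingale:
  "test_fun \<xi> \<theta>1 \<theta>2 f \<Longrightarrow> submartingale (P z) (\<lambda>t. coord_algebra \<xi> {0..t}) (compensated f)"
  using family z by (simp add: reflected_BM_family_def compensated_def[abs_def])

lemma compensated_coord_measurable:
  "test_fun \<xi> \<theta>1 \<theta>2 f \<Longrightarrow> 0 \<le> t \<Longrightarrow> compensated f t \<in> borel_measurable (coord_algebra \<xi> {0..t})"
  "test_fun \<xi> \<theta>1 \<theta>2 f \<Longrightarrow> 0 \<le> t \<Longrightarrow> integrable (P z) (compensated f t)"
  using compensated_submartingale by (auto simp: submartingale_def)

lemma compensated_increment_coord:
  assumes f: "test_fun \<xi> \<theta>1 \<theta>2 f" and st: "0 \<le> s" "s \<le> t" and A: "A \<in> sets (coord_algebra \<xi> {0..s})"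
  shows "0 \<le> (\<integral>\<omega>. indicator A \<omega> * (compensated f t \<omega> - compensated f s \<omega>) \<partial>P z)"
proof -
  let ?F = "coord_algebra \<xi> {0..s}"
  interpret Pz: prob_space "P z" by (rule P_prob[OF z])
  have sub: "subalgebra (P z) ?F"
    using sets_coord_algebra_mono[of "{0..s}" "{0..}" \<xi>] by (auto simp: subalgebra_def P_space[OF z] P_sets[OF z])
  then interpret sigma_finite_subalgebra "P z" ?F
    by (intro finite_measure_subalgebra_is_sigma_finite finite_measure_subalgebra.intro
        finite_measure_subalgebra_axioms.intro Pz.finite_measure_axioms)
  have Am: "A \<in> sets (P z)" using A sub by (auto simp: subalgebra_def)
  have i: "integrable (P z) (compensated f t)" "integrable (P z) (compensated f s)"
    using compensated_coord_measurable(2)[OF f] st by auto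
  have ic: "integrable (P z) (real_cond_exp (P z) ?F (compensated f t))"
    by (rule real_cond_exp_int(1)[OF i(1)])
  have ind: "integrable (P z) (\<lambda>\<omega>. indicator A \<omega> * h \<omega>)" if "integrable (P z) h" for h :: "path \<Rightarrow> real"
    using integrable_mult_indicator[OF Am that] by simp
  have le: "AE \<omega> in P z. compensated f s \<omega> \<le> real_cond_exp (P z) ?F (compensated f t) \<omega>"
    using compensated_submartingale[OF f] st by (simp add: submartingale_def)
  have "(\<integral>\<omega>. indicator A \<omega> * compensated f s \<omega> \<partial>P z) \<le>
      (\<integral>\<omega>. indicator A \<omega> * real_cond_exp (P z) ?F (compensated f t) \<omega> \<partial>P z)"
  proof (rule integral_mono_AE[OF ind[OF i(2)] ind[OF ic]])
    show "AE \<omega> in P z. indicator A \<omega> * compensated f s \<omega> \<le> indicator A \<omega> * real_cond_exp (P z) ?F (compensated f t) \<omega>"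
      using le by eventually_elim (simp add: mult_left_mono)
  qed
  also have "\<dots> = (\<integral>\<omega>. indicator A \<omega> * compensated f t \<omega> \<partial>P z)"
    using real_cond_exp_intA[OF i(1) A] by (simp add: set_lebesgue_integral_def)
  finally show ?thesis
    using ind[OF i(1)] ind[OF i(2)] by (simp add: right_diff_distrib)
qed

lemma compensated_M_measurable: "test_fun \<xi> \<theta>1 \<theta>2 f \<Longrightarrow> 0 \<le> t \<Longrightarrow> compensated f t \<in> borel_measurable (G t)"
  using compensated_coord_measurable(1)[of f t]
  by (rule measurable_from_subalg[rotated]) (auto simp: subalgebra_def space_G coord_sub_G)

lemma compensated_increment_G:
  assumes f: "test_fun \<xi> \<theta>1 \<theta>2 f" and st: "0 \<le> s" "s \<le> t" and A: "A \<in> sets (G s)"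
  shows "0 \<le> (\<integral>\<omega>. indicator A \<omega> * (compensated f t \<omega> - compensated f s \<omega>) \<partial>M)"
proof -
  obtain A' where A': "A' \<in> sets (coord_algebra \<xi> {0..s})" "AE \<omega> in P z. \<omega> \<in> A \<longleftrightarrow> \<omega> \<in> A'"
    using G_approx[OF A st(1)] by blast
  have Am: "A \<in> sets M" using A subalgebra_G[OF st(1)] by (auto simp: subalgebra_def)
  have sub: "sets (coord_algebra \<xi> {0..r}) \<subseteq> sets (P z)" for r
    unfolding P_sets[OF z] by (rule sets_coord_algebra_mono) auto
  have cP: "compensated f r \<in> borel_measurable (P z)" if "0 \<le> r" for r
    using compensated_coord_measurable(2)[OF f that] by auto
  have cM: "compensated f r \<in> borel_measurable M" if "0 \<le> r" for r
    using measurable_from_subalg[OF subalgebra_G[OF that] compensated_M_measurable[OF f that]] .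
  have A'm: "A' \<in> sets (P z)" using A'(1) sub by blast
  then have A'M: "A' \<in> sets M" using P_sets[OF z] coord_sub_univ sets_M by blast
  have "AE \<omega> in M. \<omega> \<in> A \<longleftrightarrow> \<omega> \<in> A'" by (rule AE_M_of_P[OF A'(2)])
  then have "(\<integral>\<omega>. indicator A \<omega> * (compensated f t \<omega> - compensated f s \<omega>) \<partial>M) =
      (\<integral>\<omega>. indicator A' \<omega> * (compensated f t \<omega> - compensated f s \<omega>) \<partial>M)"
    using Am A'M cM st by (intro integral_cong_AE) (auto simp: indicator_def elim!: eventually_mono)
  also have "\<dots> = (\<integral>\<omega>. indicator A' \<omega> * (compensated f t \<omega> - compensated f s \<omega>) \<partial>P z)"
    using A'm cP st by (intro integral_M_of_P) auto
  finally show ?thesis using compensated_increment_coord[OF f st A'(1)] by simp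
qed

text \<open>The event that the conditional expectation of the increment is negative is itself an
  admissible test set. Hence this conditional expectation is nonnegative almost surely, and it may
  replace the increment under the weight.\<close>

lemma compensated_drift_M:
  assumes f: "test_fun \<xi> \<theta>1 \<theta>2 f" and st: "0 \<le> s" "s \<le> t"
    and H: "H \<in> borel_measurable (G s)" "\<And>\<omega>. 0 \<le> H \<omega>"
  shows "0 \<le> (\<integral>\<omega>. H \<omega> * (compensated f t \<omega> - compensated f s \<omega>) \<partial>M)"
\<comment> \<open>If the product is not integrable, its integral is 0 by convention.\<close>
proof (cases "integrable M (\<lambda>\<omega>. H \<omega> * (compensated f t \<omega> - compensated f s \<omega>))")
  case True
  let ?N = "\<lambda>\<omega>. compensated f t \<omega> - compensated f s \<omega>"
  interpret S: sigma_finite_subalgebra M "G s"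
    by (intro finite_measure_subalgebra_is_sigma_finite finite_measure_subalgebra.intro
        finite_measure_subalgebra_axioms.intro finite_measure_axioms subalgebra_G st(1))
  have cM: "compensated f r \<in> borel_measurable M" "integrable M (compensated f r)" if "0 \<le> r" for r
  proof -
    show "compensated f r \<in> borel_measurable M"
      using measurable_from_subalg[OF subalgebra_G[OF that] compensated_M_measurable[OF f that]] .
    have "integrable (distr M (P z) (\<lambda>\<omega>. \<omega>)) (compensated f r)"
      unfolding distr_M by (rule compensated_coord_measurable(2)[OF f that])
    then show "integrable M (compensated f r)" by (rule integrable_distr[OF measurable_id_M])
  qed
  have Ni: "integrable M ?N" using cM(2) st by auto
  define C where "C = real_cond_exp M (G s) ?N"
  have Cm[measurable]: "C \<in> borel_measurable (G s)" unfolding C_def by simp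
  have Ci: "integrable M C" unfolding C_def by (rule S.real_cond_exp_int(1)[OF Ni])
  define A where "A = {\<omega>\<in>space (G s). C \<omega> < 0}"
  have A: "A \<in> sets (G s)" unfolding A_def by measurable
  then have Am: "A \<in> sets M" using subalgebra_G[OF st(1)] by (auto simp: subalgebra_def)
  have iA: "integrable M (\<lambda>\<omega>. - (indicator A \<omega> * C \<omega>))"
    using integrable_mult_indicator[OF Am Ci] by simp
  have "0 \<le> (\<integral>\<omega>. indicator A \<omega> * ?N \<omega> \<partial>M)" by (rule compensated_increment_G[OF f st A])
  also have "\<dots> = (\<integral>\<omega>. indicator A \<omega> * C \<omega> \<partial>M)"
    using S.real_cond_exp_intA[OF Ni A] by (simp add: set_lebesgue_integral_def C_def)
  finally have "(\<integral>\<omega>. - (indicator A \<omega> * C \<omega>) \<partial>M) \<le> 0" by simp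
  moreover have nn: "AE \<omega> in M. 0 \<le> - (indicator A \<omega> * C \<omega>)"
    by (rule AE_I2) (simp add: A_def indicator_def)
  ultimately have "(\<integral>\<omega>. - (indicator A \<omega> * C \<omega>) \<partial>M) = 0"
    using integral_nonneg_AE[OF nn] by linarith
  then have "AE \<omega> in M. - (indicator A \<omega> * C \<omega>) = 0"
    using integral_nonneg_eq_0_iff_AE[OF iA nn] by blast
  then have "AE \<omega> in M. 0 \<le> C \<omega>"
    using AE_space
  proof eventually_elim
    case (elim \<omega>)
    then have "\<omega> \<notin> A" by (auto simp: A_def)
    then show ?case using elim(2) by (simp add: A_def space_G space_M not_less)
  qed
  then have "0 \<le> (\<integral>\<omega>. H \<omega> * C \<omega> \<partial>M)"
    by (intro integral_nonneg_AE) (auto elim!: eventually_mono intro: mult_nonneg_nonneg H(2))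
  also have "\<dots> = (\<integral>\<omega>. H \<omega> * ?N \<omega> \<partial>M)"
    unfolding C_def by (rule S.real_cond_exp_intg(2)[OF True H(1)]) (use Ni in auto)
  finally show ?thesis .
qed (simp add: not_integrable_integral_eq)

text \<open>A path that vanishes on an interval spends at least its length at the corner, and the
  occupation time has expectation zero. Rational endpoints leave countably many intervals.\<close>

lemma AE_no_zero_interval: "AE \<omega> in M. \<forall>a b. 0 \<le> a \<longrightarrow> a < b \<longrightarrow> (\<exists>t\<in>{a..b}. \<omega> t \<noteq> 0)"
proof -
  have "AE \<omega> in P z. \<not> (\<forall>t\<in>{a..b}. \<omega> t = 0)" if ab: "0 \<le> a" "a < b" for a b
  proof -
    define B where "B = {\<omega>\<in>path_space \<xi>. \<forall>t\<in>{a..b}. \<omega> t \<in> {0}}"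
    let ?Q = "{a..b} \<inter> (\<rat> \<union> {a, b})"
    have "B = {\<omega>\<in>space (P z). \<forall>t\<in>?Q. \<omega> t \<in> {0}}"
      unfolding B_def P_space[OF z] using closed_stay_iff[OF path_continuous_on_Icc(1)[OF _ ab(1)], of _ \<xi> "{0}" b]
      by (auto simp del: singleton_iff)
    also have "\<dots> \<in> sets (P z)"
    proof (rule sets.sets_Collect_countable_All')
      show "countable ?Q" by (intro countable_Int2 countable_Un countable_rat) auto
      fix t assume "t \<in> ?Q"
      then have "(\<lambda>\<omega>. \<omega> t) \<in> borel_measurable (P z)"
        using measurable_coordinate[of t "{0..}" \<xi>] ab(1) measurable_cong_sets[OF P_sets[OF z] refl] by auto
      then show "{\<omega>\<in>space (P z). \<omega> t \<in> {0}} \<in> sets (P z)" by measurable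
    qed
    finally have Bm: "B \<in> sets (P z)" .
    have "ennreal (b - a) * emeasure (P z) B = (\<integral>\<^sup>+\<omega>. ennreal (b - a) * indicator B \<omega> \<partial>P z)"
      using Bm by (simp add: nn_integral_cmult_indicator)
    also have "\<dots> \<le> (\<integral>\<^sup>+\<omega>. (\<integral>\<^sup>+t\<in>{0..}. indicator {0} (\<omega> t) \<partial>lborel) \<partial>P z)"
    proof (rule nn_integral_mono)
      fix \<omega>
      show "ennreal (b - a) * indicator B \<omega> \<le> (\<integral>\<^sup>+t\<in>{0..}. indicator {0} (\<omega> t) \<partial>lborel)"
      proof (cases "\<omega> \<in> B")
        case True
        have "ennreal (b - a) = (\<integral>\<^sup>+t. indicator {a..b} t \<partial>lborel)" using ab by simp
        also have "\<dots> \<le> (\<integral>\<^sup>+t\<in>{0..}. indicator {0} (\<omega> t) \<partial>lborel)"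
          using True ab by (intro nn_integral_mono) (auto simp: B_def indicator_def)
        finally show ?thesis using True by simp
      qed simp
    qed
    also have "\<dots> = 0" using family z by (simp add: reflected_BM_family_def)
    finally have "emeasure (P z) B = 0" using ab by (auto simp: ennreal_eq_0_iff)
    then have "B \<in> null_sets (P z)" using Bm by (simp add: null_sets_def)
    then have "AE \<omega> in P z. \<omega> \<notin> B" by (rule AE_not_in)
    then show ?thesis using AE_space by eventually_elim (auto simp: B_def P_space[OF z])
  qed
  then have "AE \<omega> in P z. \<forall>a\<in>\<rat>. \<forall>b\<in>\<rat>. 0 \<le> a \<longrightarrow> a < b \<longrightarrow> \<not> (\<forall>t\<in>{a..b}. \<omega> t = 0)"
    by (intro AE_ball_countable' countable_rat AE_impI) blast
  then have "AE \<omega> in M. \<forall>a\<in>\<rat>. \<forall>b\<in>\<rat>. 0 \<le> a \<longrightarrow> a < b \<longrightarrow> \<not> (\<forall>t\<in>{a..b}. \<omega> t = 0)"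
    by (rule AE_M_of_P)
  then show ?thesis
  proof eventually_elim
    case (elim \<omega>)
    show ?case
    proof (intro allI impI)
      fix a b :: real assume ab: "0 \<le> a" "a < b"
      obtain p where p: "p \<in> \<rat>" "a < p" "p < b" using Rats_dense_in_real[OF ab(2)] by blast
      obtain q where q: "q \<in> \<rat>" "p < q" "q < b" using Rats_dense_in_real[OF p(3)] by blast
      have "\<not> (\<forall>t\<in>{p..q}. \<omega> t = 0)" using elim p q ab by auto
      then show "\<exists>t\<in>{a..b}. \<omega> t \<noteq> 0" using p q by force
    qed
  qed
qed

lemma reflected_process: "reflected_process M \<xi> \<theta>1 \<theta>2 G X Y"
proof unfold_locales
  show "0 < \<xi>" "\<xi> < pi" by (fact wedge_angle)+
  show "space M = path_space \<xi>" by (rule space_M)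
  show "subalgebra M (G t)" if "0 \<le> t" for t using that by (rule subalgebra_G)
  show "sets (G s) \<subseteq> sets (G t)" if "0 \<le> s" "s \<le> t" for s t using that(2) by (rule sets_G_mono)
  show "(\<lambda>\<omega>. \<omega> t) \<in> borel_measurable (G t)" if "0 \<le> t" for t
    using that by (intro measurable_from_subalg[OF _ measurable_coordinate[of t "{0..t}" \<xi>]])
      (auto simp: subalgebra_def space_G coord_sub_G)
  show "X t \<in> borel_measurable (G t)" if "0 \<le> t" for t
    using BM that by (auto simp: std_brownian_motion_def adapted_def)
  show "Y t \<in> borel_measurable (G t)" if "0 \<le> t" for t
    using Y_adapted that by (auto simp: adapted_def)
  show "distributed M lborel (\<lambda>\<omega>. X t \<omega> - X s \<omega>) (\<lambda>x. ennreal (\<Prod>i\<in>UNIV. normal_density 0 (sqrt (t - s)) (x $ i)))"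
    and "indep_set (sets (G s)) (sets (vimage_algebra (space M) (\<lambda>\<omega>. X t \<omega> - X s \<omega>) borel))"
    if "0 \<le> s" "s < t" for s t using increments[OF that] by auto
  show "\<omega> t = X t \<omega> + Y t \<omega>" if "\<omega> \<in> space M" "0 \<le> t" for \<omega> t
    using decomp that by (simp add: zero_energy_decomposition_def space_M)
  show "AE \<omega> in M. continuous_on {0..} (\<lambda>t. X t \<omega>)"
    using BM by (simp add: std_brownian_motion_def continuous_process_def)
  show "AE \<omega> in M. continuous_on {0..} (\<lambda>t. Y t \<omega>)"
    using Y_cont by (simp add: continuous_process_def)
  show "zero_energy M Y" by (rule Y_energy)
  show "compensated f t \<in> borel_measurable (G t)" if "test_fun \<xi> \<theta>1 \<theta>2 f" "0 \<le> t" for f t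
    using that by (rule compensated_M_measurable)
  show "0 \<le> (\<integral>\<omega>. H \<omega> * (compensated f t \<omega> - compensated f s \<omega>) \<partial>M)"
    if "test_fun \<xi> \<theta>1 \<theta>2 f" "0 \<le> s" "s \<le> t" "H \<in> borel_measurable (G s)" "\<And>\<omega>. 0 \<le> H \<omega>" "integrable M H"
    for f s t H using that(1-5) by (rule compensated_drift_M)
  show "AE \<omega> in M. \<forall>a b. 0 \<le> a \<longrightarrow> a < b \<longrightarrow> (\<exists>t\<in>{a..b}. \<omega> t \<noteq> 0)" by (rule AE_no_zero_interval)
qed

section \<open>Necessity of the cone condition\<close>

lemma hull_of_solution:
  assumes \<alpha>: "\<xi> < \<theta>1 + \<theta>2" and \<theta>: "- pi/2 < \<theta>1" "\<theta>1 < pi/2" "- pi/2 < \<theta>2" "\<theta>2 < pi/2" and V: "cone V"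
    and sol: "AE \<omega> in M. \<exists>\<phi> \<eta>. solves_ESP (wedge \<xi>) (refl_cone \<xi> \<theta>1 \<theta>2 V) (\<lambda>t. X t \<omega>) \<phi> \<eta>"
  shows "closure (convex hull (V \<union> ray (refl1 \<theta>1) \<union> ray (refl2 \<xi> \<theta>2))) = UNIV"
proof (rule ccontr)
  let ?R = "V \<union> ray (refl1 \<theta>1) \<union> ray (refl2 \<xi> \<theta>2)"
  let ?C = "closure (convex hull ?R)"
  assume "?C \<noteq> UNIV"
  then obtain y where y: "y \<notin> ?C" by blast
  obtain a b where ab: "a \<bullet> y < b" "\<forall>x\<in>?C. b < a \<bullet> x"
    using separating_hyperplane_closed_point[of ?C y] y by (auto simp: convex_closure)
  have pos: "0 \<le> a \<bullet> x" if "x \<in> ?R" for x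
  proof (rule ccontr)
    assume neg: "\<not> 0 \<le> a \<bullet> x"
    \<comment> \<open>Scaling within the cone brings the inner product down to at most
      \<open>b\<close>; the maximum with 0 keeps the factor admissible when \<open>b\<close> is
      positive.\<close>
    define k where "k = max 0 (b / (a \<bullet> x))"
    have "k *\<^sub>R x \<in> ?R"
      using that V cone_ray[of "refl1 \<theta>1"] cone_ray[of "refl2 \<xi> \<theta>2"] mem_cone[of _ x k] by (auto simp: k_def)
    then have "b < a \<bullet> (k *\<^sub>R x)" using ab(2) hull_subset[of ?R convex] closure_subset by blast
    moreover have "k * (a \<bullet> x) \<le> b" using neg by (auto simp: k_def max_def field_simps)
    ultimately show False by simp
  qed
  have "0 \<in> ?C" using hull_subset[of ?R convex] closure_subset zero_in_ray by blast
  then have "b < 0" using ab(2) by fastforce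
  then have a0: "a \<noteq> 0" using ab(1) by auto
  have ray: "refl1 \<theta>1 \<in> ?R" "refl2 \<xi> \<theta>2 \<in> ?R" by (auto simp: ray_def intro: exI[of _ 1])
  have wedge_neg: "a \<bullet> x \<le> 0" if "x \<in> wedge \<xi>" for x
    by (rule inner_wedge_nonpos[OF wedge_angle(1) \<alpha> \<theta> pos[OF ray(1)] pos[OF ray(2)] that])
  have dpos: "refl_cone \<xi> \<theta>1 \<theta>2 V x \<subseteq> {v. 0 \<le> a \<bullet> v}" for x
    using pos by (auto simp: refl_cone_def)
  \<comment> \<open>The increment of \<open>\<eta>\<close> over the unit interval lies in the
    half-plane, and \<open>\<eta> 0 = 0\<close> because \<open>\<phi>\<close> and \<open>X\<close>
    start together.\<close>
  have X1: "a \<bullet> X 1 \<omega> \<le> 0"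
    if "solves_ESP (wedge \<xi>) (refl_cone \<xi> \<theta>1 \<theta>2 V) (\<lambda>t. X t \<omega>) \<phi> \<eta>" for \<omega> \<phi> \<eta>
  proof -
    have start: "\<phi> 0 = X 0 \<omega>"
      and all: "\<And>t. 0 \<le> t \<Longrightarrow> \<phi> t = X t \<omega> + \<eta> t \<and> \<phi> t \<in> wedge \<xi> \<and> (\<forall>s. 0 \<le> s \<and> s < t \<longrightarrow>
        \<eta> t - \<eta> s \<in> closure (convex hull (\<Union>u\<in>{s<..t}. refl_cone \<xi> \<theta>1 \<theta>2 V (\<phi> u))))"
      using that unfolding solves_ESP_def by blast+
    have eq: "\<phi> 0 = X 0 \<omega> + \<eta> 0" "\<phi> 1 = X 1 \<omega> + \<eta> 1" "\<phi> 1 \<in> wedge \<xi>"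
      using all[OF order_refl] all[OF zero_le_one] by blast+
    have inc: "\<eta> 1 - \<eta> 0 \<in> closure (convex hull (\<Union>u\<in>{0<..1}. refl_cone \<xi> \<theta>1 \<theta>2 V (\<phi> u)))"
      using all[OF zero_le_one, THEN conjunct2, THEN conjunct2, THEN spec, of 0] by simp
    have "closure (convex hull (\<Union>u\<in>{0<..1}. refl_cone \<xi> \<theta>1 \<theta>2 V (\<phi> u))) \<subseteq> {v. 0 \<le> a \<bullet> v}"
      by (intro closure_minimal hull_minimal UN_least dpos convex_halfspace_ge[of 0 a, simplified]
          closed_Collect_le continuous_intros)
    then have "0 \<le> a \<bullet> (\<eta> 1 - \<eta> 0)" using inc by blast
    moreover have "\<eta> 0 = 0" using start eq(1) by simp
    moreover have "a \<bullet> \<phi> 1 \<le> 0" by (rule wedge_neg[OF eq(3)])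
    ultimately show ?thesis unfolding eq(2) by (simp add: inner_add_right)
  qed
  have X0: "AE \<omega> in M. X 0 \<omega> = z" using BM by (simp add: std_brownian_motion_def)
  \<comment> \<open>The increments that carry \<open>X\<close> from \<open>z\<close> to a point with
    \<open>a \<bullet> X 1 \<omega> > 0\<close>.\<close>
  define U where "U = {x. - (a \<bullet> z) < a \<bullet> x}"
  have U: "open U" unfolding U_def by (intro open_Collect_less continuous_intros)
  have "((1 - a \<bullet> z) / (a \<bullet> a)) *\<^sub>R a \<in> U" using a0 by (simp add: U_def)
  then have "emeasure M {\<omega>\<in>space M. X 1 \<omega> - X 0 \<omega> \<in> U} \<noteq> 0"
    using emeasure_pos_of_density[OF increments(1)[of 0 1] gaussian_density_nonzero U] by auto
  moreover have "AE \<omega> in M. X 1 \<omega> - X 0 \<omega> \<notin> U"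
    using sol X0
  proof eventually_elim
    case (elim \<omega>)
    then show ?case using X1 by (auto simp: U_def inner_diff_right not_less)
  qed
  moreover have "(\<lambda>\<omega>. X 1 \<omega> - X 0 \<omega>) \<in> borel_measurable M"
    using distributed_measurable[OF increments(1)[of 0 1]] by simp
  note [measurable] = this
  have [measurable]: "U \<in> sets borel" using U by simp
  have "{\<omega>\<in>space M. X 1 \<omega> - X 0 \<omega> \<in> U} \<in> events" by measurable
  note AE_iff_measurable[OF this, of "\<lambda>\<omega>. X 1 \<omega> - X 0 \<omega> \<notin> U"]
  ultimately show False by simp
qed

end

theorem theorem1p8:
  fixes \<xi> \<theta>1 \<theta>2 \<alpha> :: real
    and P :: "real^2 \<Rightarrow> path measure"
    and X Y :: "real \<Rightarrow> path \<Rightarrow> real^2"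
    and V :: "(real^2) set"
  assumes "0 < \<xi>" "\<xi> < 2 * pi"
    and "- pi/2 < \<theta>1" "\<theta>1 < pi/2" "- pi/2 < \<theta>2" "\<theta>2 < pi/2"
    and "\<alpha> = (\<theta>1 + \<theta>2) / \<xi>" "1 < \<alpha>" "\<alpha> < 2"
    and "reflected_BM_family \<xi> \<theta>1 \<theta>2 P"
    and "zero_energy_decomposition \<xi> P X Y"
    and "V \<noteq> {}" "closed V" "convex V" "cone V"
  shows "\<forall>z\<in>wedge \<xi>.
    ((AE \<omega> in univ_law \<xi> P z.
        \<exists>\<phi> \<eta>. solves_ESP (wedge \<xi>) (refl_cone \<xi> \<theta>1 \<theta>2 V) (\<lambda>t. X t \<omega>) \<phi> \<eta>) \<longleftrightarrow>
     closure (convex hull (V \<union> ray (refl1 \<theta>1) \<union> ray (refl2 \<xi> \<theta>2))) = UNIV) \<and>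
    (closure (convex hull (V \<union> ray (refl1 \<theta>1) \<union> ray (refl2 \<xi> \<theta>2))) = UNIV \<longrightarrow>
     (AE \<omega> in univ_law \<xi> P z.
        solves_ESP (wedge \<xi>) (refl_cone \<xi> \<theta>1 \<theta>2 V) (\<lambda>t. X t \<omega>) \<omega> (\<lambda>t. Y t \<omega>)))"
proof
  fix z assume z: "z \<in> wedge \<xi>"
  have "1 * \<xi> < \<alpha> * \<xi>" by (rule mult_strict_right_mono[OF assms(8,1)])
  then have \<alpha>: "\<xi> < \<theta>1 + \<theta>2" using assms(1,7) by simp
  then have "\<xi> < pi" using assms(4,6) by linarith
  then interpret canonical_process \<xi> \<theta>1 \<theta>2 P X Y z
    using assms z by unfold_locales auto
  have main: "AE \<omega> in univ_law \<xi> P z.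
        solves_ESP (wedge \<xi>) (refl_cone \<xi> \<theta>1 \<theta>2 V) (\<lambda>t. X t \<omega>) \<omega> (\<lambda>t. Y t \<omega>)"
    if "closure (convex hull (V \<union> ray (refl1 \<theta>1) \<union> ray (refl2 \<xi> \<theta>2))) = UNIV"
    using reflected_process.AE_solves_ESP[OF reflected_process assms(15,12) that Y_0] .
  then have "AE \<omega> in univ_law \<xi> P z.
        \<exists>\<phi> \<eta>. solves_ESP (wedge \<xi>) (refl_cone \<xi> \<theta>1 \<theta>2 V) (\<lambda>t. X t \<omega>) \<phi> \<eta>"
    if "closure (convex hull (V \<union> ray (refl1 \<theta>1) \<union> ray (refl2 \<xi> \<theta>2))) = UNIV"
    using that by (auto elim!: eventually_mono)
  with main hull_of_solution[OF \<alpha> assms(3-6,15)]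
  show "((AE \<omega> in univ_law \<xi> P z.
        \<exists>\<phi> \<eta>. solves_ESP (wedge \<xi>) (refl_cone \<xi> \<theta>1 \<theta>2 V) (\<lambda>t. X t \<omega>) \<phi> \<eta>) \<longleftrightarrow>
     closure (convex hull (V \<union> ray (refl1 \<theta>1) \<union> ray (refl2 \<xi> \<theta>2))) = UNIV) \<and>
    (closure (convex hull (V \<union> ray (refl1 \<theta>1) \<union> ray (refl2 \<xi> \<theta>2))) = UNIV \<longrightarrow>
     (AE \<omega> in univ_law \<xi> P z.
        solves_ESP (wedge \<xi>) (refl_cone \<xi> \<theta>1 \<theta>2 V) (\<lambda>t. X t \<omega>) \<omega> (\<lambda>t. Y t \<omega>)))"
    by blast
qed

end
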